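(* Let $d\ge1$ and $L>0$. There exists $\varepsilon_0>0$ (with $\varepsilon_0<1/(2L^2)$) such that for every $\varepsilon\in\mathbf{R}$ with $|\varepsilon|\le\varepsilon_0$ the truncated Gaussian field distribution $\mu_\varepsilon^L$ on $[-L,L]^{\mathbf{Z}^d}$ satisfies: 1. $\mu_\varepsilon^L$ is a finitary factor of an i.i.d. process (FFIID) with exponential tails. 2. There exists $c>0$ such that for all $l\in\mathbf{N}$ there exists an $l$-dependent distribution $\nu_l$ on $[-L,L]^{\mathbf{Z}^d}$ such that for every finite subset $\Lambda\subset\mathbf{Z}^d$, $$d_{\mathrm{TV}}(\mu_\varepsilon^L|_\Lambda,\nu_l|_\Lambda)\le|\Lambda|\,e^{-cl}.$$
   Context: For finite $\Lambda\subset\mathbf{Z}^d$ and $x\in\mathbf{R}^{\mathbf{Z}^d}$ let $$H_\Lambda(x)=\frac12\sum_{i\in\Lambda}x_i^2-\frac{\varepsilon}{2d}\sum_{\{i,j\}:\ \|i-j\|_1=1,\ \{i,j\}\cap\Lambda\neq\emptyset}x_ix_j$$ (sum over unordered pairs). The specification $\pi^{\varepsilon,L}$ is given, for finite $\Lambda$ and $\xi\in[-L,L]^{\mathbf{Z}^d}$, by the probability measure $\pi_\Lambda^{\varepsilon,L}(\cdot\mid\xi)$ on $[-L,L]^\Lambda$ with density proportional to $\exp(-H_\Lambda(x_\Lambda\xi_{\Lambda^c}))$ with respect to Lebesgue measure, where $x_\Lambda\xi_{\Lambda^c}$ equals $x_\Lambda$ on $\Lambda$ and $\xi$ on $\Lambda^c$.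 A Gibbs measure for $\pi^{\varepsilon,L}$ is a probability measure $\mu$ on $[-L,L]^{\mathbf{Z}^d}$ such that for every finite $\Lambda$, the conditional law of $X|_\Lambda$ given $X_i=\xi_i$ for all $i\notin\Lambda$ is $\pi_\Lambda^{\varepsilon,L}(\cdot\mid\xi)$ for $\mu$-a.e. $\xi$. For $|\varepsilon|<1/(2L^2)$ there is a unique Gibbs measure (existence by compactness, uniqueness by Dobrushin's condition), denoted $\mu_\varepsilon^L$. Under $\mu_\varepsilon^L$, the conditional law of $X_i$ given the rest is $\mathcal{N}(\frac{\varepsilon}{2d}\sum_{j:\|j-i\|_1=1}X_j,1)$ conditioned to be in $[-L,L]$. A translation-invariant probability measure $\mu$ on $S^{\mathbf{Z}^d}$ is a factor of an i.i.d. process (FIID) if there exist a probability space $(\mathcal{Y},\mathcal{F},\nu)$ and a measurable map $F:\mathcal{Y}^{\mathbf{Z}^d}\to S^{\mathbf{Z}^d}$ commuting with all translations such that $\mu$ is the image of $\nu^{\otimes\mathbf{Z}^d}$ by $F$. For $y\in\mathcal{Y}^{\mathbf{Z}^d}$, let $R(y)=\inf\{r\ge0:\forall y'\in\mathcal{Y}^{\mathbf{Z}^d},\ y'|_{B^0_r}=y|_{B^0_r}\Rightarrow F(y)_0=F(y')_0\}$, with $B_r^0=\{j:\|j\|_1\le r\}$; the coding radius of $F$ is $R=R(Y)$ with $Y\sim\nu^{\otimes\mathbf{Z}^d}$. $\mu$ is an FFIID if it is an FIID for some $F$ whose coding radius is a.s. finite, and an FFIID with exponential tails if moreover $\mathbf{P}(R\ge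 n)\le Ce^{-cn}$ for some $c,C>0$ and all $n\in\mathbf{N}$. A probability measure on $S^{\mathbf{Z}^d}$ is $l$-dependent if, when $X$ has this law, for all $A,A'\subset\mathbf{Z}^d$ at distance (for $\|\cdot\|_1$) greater than $l$, $X|_A$ and $X|_{A'}$ are independent. $\mu|_\Lambda$ denotes the law of $X|_\Lambda$ when $X\sim\mu$, and $d_{\mathrm{TV}}(\mu,\nu)=\sup_A|\mu(A)-\nu(A)|$. *)

theory Defs
  imports "HOL-Probability.Probability"
begin

text \<open>
  A site of the $d$-dimensional integer lattice is a vector of type \<^typ>\<open>int ^ 'd\<close>, with
  $d$ the cardinality of \<^typ>\<open>'d\<close>. For a measurable space \<open>S\<close>, the measurable space of
  configurations on \<open>\<Lambda>\<close> is the product \<open>Pi\<^sub>M \<Lambda> (\<lambda>_. S)\<close>.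
\<close>

definition norm1 :: "int ^ 'd \<Rightarrow> int" where
  "norm1 i = (\<Sum>k\<in>UNIV. \<bar>i $ k\<bar>)"

abbreviation config_space :: "'s measure \<Rightarrow> (int ^ 'd \<Rightarrow> 's) measure" where
  "config_space S \<equiv> Pi\<^sub>M UNIV (\<lambda>_. S)"

definition translate :: "int ^ 'd \<Rightarrow> (int ^ 'd \<Rightarrow> 's) \<Rightarrow> int ^ 'd \<Rightarrow> 's" where
  "translate v x = (\<lambda>i. x (i + v))"

definition marginal :: "'s measure \<Rightarrow> (int ^ 'd) set \<Rightarrow> (int ^ 'd \<Rightarrow> 's) measure \<Rightarrow> (int ^ 'd \<Rightarrow> 's) measure" where
  "marginal S \<Lambda> \<mu> = distr \<mu> (Pi\<^sub>M \<Lambda> (\<lambda>_. S)) (\<lambda>x. restrict x \<Lambda>)"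

definition field_distribution :: "'s measure \<Rightarrow> (int ^ 'd \<Rightarrow> 's) measure \<Rightarrow> bool" where
  "field_distribution S \<mu> \<longleftrightarrow> prob_space \<mu> \<and> sets \<mu> = sets (config_space S)"

definition translation_invariant :: "'s measure \<Rightarrow> (int ^ 'd \<Rightarrow> 's) measure \<Rightarrow> bool" where
  "translation_invariant S \<mu> \<longleftrightarrow> (\<forall>v. distr \<mu> (config_space S) (translate v) = \<mu>)"

text \<open>
  The edges are the two-element sets \<open>{i, j}\<close> of neighbours, so that each unordered pair is
  counted once and the product over an edge is \<open>x i * x j\<close>.
\<close>

definition edges_meeting :: "(int ^ 'd) set \<Rightarrow> (int ^ 'd) set set" where
  "edges_meeting \<Lambda> = {{i, j} | i j. norm1 (i - j) = 1 \<and> {i, j} \<inter> \<Lambda> \<noteq> {}}"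

definition hamiltonian :: "real \<Rightarrow> (int ^ 'd) set \<Rightarrow> (int ^ 'd \<Rightarrow> real) \<Rightarrow> real" where
  "hamiltonian \<epsilon> \<Lambda> x =
     1 / 2 * (\<Sum>i\<in>\<Lambda>. (x i)\<^sup>2) - \<epsilon> / (2 * real CARD('d)) * (\<Sum>e\<in>edges_meeting \<Lambda>. \<Prod>i\<in>e. x i)"

definition spin_space :: "real \<Rightarrow> real measure" where
  "spin_space L = restrict_space lborel {- L..L}"

definition boltzmann :: "real \<Rightarrow> (int ^ 'd) set \<Rightarrow> (int ^ 'd \<Rightarrow> real) \<Rightarrow> (int ^ 'd \<Rightarrow> real) \<Rightarrow> ennreal" where
  "boltzmann \<epsilon> \<Lambda> \<xi> x = ennreal (exp (- hamiltonian \<epsilon> \<Lambda> (merge \<Lambda> (- \<Lambda>) (x, \<xi>))))"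

definition gibbs_specification ::
    "real \<Rightarrow> real \<Rightarrow> (int ^ 'd) set \<Rightarrow> (int ^ 'd \<Rightarrow> real) \<Rightarrow> (int ^ 'd \<Rightarrow> real) measure" where
  "gibbs_specification \<epsilon> L \<Lambda> \<xi> =
     (let M = Pi\<^sub>M \<Lambda> (\<lambda>_. spin_space L)
      in density M (\<lambda>x. boltzmann \<epsilon> \<Lambda> \<xi> x / (\<integral>\<^sup>+ y. boltzmann \<epsilon> \<Lambda> \<xi> y \<partial>M)))"

text \<open>
  \<open>\<kappa> \<omega>\<close> is the conditional law of the \<open>N\<close>-valued variable \<open>X\<close> given the \<open>K\<close>-valued variable \<open>Y\<close>:
  for every event \<open>A\<close>, \<open>\<kappa> \<omega> A\<close> is a version of the conditional probability of \<open>X \<in> A\<close> given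
  the sigma-algebra generated by \<open>Y\<close>.
\<close>

definition conditional_law ::
    "'w measure \<Rightarrow> 'a measure \<Rightarrow> ('w \<Rightarrow> 'a) \<Rightarrow> 'b measure \<Rightarrow> ('w \<Rightarrow> 'b) \<Rightarrow> ('w \<Rightarrow> 'a measure) \<Rightarrow> bool" where
  "conditional_law P N X K Y \<kappa> \<longleftrightarrow>
     (\<forall>A\<in>sets N. AE \<omega> in P.
        real_cond_exp P (vimage_algebra (space P) Y K) (indicator (X -` A \<inter> space P)) \<omega>
          = measure (\<kappa> \<omega>) A)"

definition gibbs_measure :: "real \<Rightarrow> real \<Rightarrow> (int ^ 'd \<Rightarrow> real) measure \<Rightarrow> bool" where
  "gibbs_measure \<epsilon> L \<mu> \<longleftrightarrow>
     field_distribution (spin_space L) \<mu> \<and>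
     (\<forall>\<Lambda>. finite \<Lambda> \<longrightarrow>
        conditional_law \<mu>
          (Pi\<^sub>M \<Lambda> (\<lambda>_. spin_space L)) (\<lambda>x. restrict x \<Lambda>)
          (Pi\<^sub>M (- \<Lambda>) (\<lambda>_. spin_space L)) (\<lambda>x. restrict x (- \<Lambda>))
          (gibbs_specification \<epsilon> L \<Lambda>))"

text \<open>
  Exactly one Gibbs measure exists when $|\varepsilon| < 1/(2L^2)$; outside that range the description
  below need not denote a Gibbs measure.
\<close>

definition truncated_gaussian_field :: "real \<Rightarrow> real \<Rightarrow> (int ^ 'd \<Rightarrow> real) measure" where
  "truncated_gaussian_field \<epsilon> L = (THE \<mu>. gibbs_measure \<epsilon> L \<mu>)"

definition equivariant :: "'y measure \<Rightarrow> ((int ^ 'd \<Rightarrow> 'y) \<Rightarrow> int ^ 'd \<Rightarrow> 's) \<Rightarrow> bool" where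
  "equivariant \<nu> F \<longleftrightarrow>
     (\<forall>v. \<forall>y\<in>space (config_space \<nu>). F (translate v y) = translate v (F y))"

definition factor_of_iid ::
    "'s measure \<Rightarrow> (int ^ 'd \<Rightarrow> 's) measure \<Rightarrow> 'y measure \<Rightarrow> ((int ^ 'd \<Rightarrow> 'y) \<Rightarrow> int ^ 'd \<Rightarrow> 's) \<Rightarrow> bool" where
  "factor_of_iid S \<mu> \<nu> F \<longleftrightarrow>
     field_distribution S \<mu> \<and> translation_invariant S \<mu> \<and>
     prob_space \<nu> \<and> F \<in> config_space \<nu> \<rightarrow>\<^sub>M config_space S \<and> equivariant \<nu> F \<and>
     \<mu> = distr (config_space \<nu>) (config_space S) F"

definition coding_radius ::
    "'y measure \<Rightarrow> ((int ^ 'd \<Rightarrow> 'y) \<Rightarrow> int ^ 'd \<Rightarrow> 's) \<Rightarrow> (int ^ 'd \<Rightarrow> 'y) \<Rightarrow> ereal" where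
  "coding_radius \<nu> F y =
     Inf (ereal ` {r. 0 \<le> r \<and>
       (\<forall>y'\<in>space (config_space \<nu>).
          (\<forall>j. real_of_int (norm1 j) \<le> r \<longrightarrow> y' j = y j) \<longrightarrow> F y 0 = F y' 0)})"

definition finitary :: "'y measure \<Rightarrow> ((int ^ 'd \<Rightarrow> 'y) \<Rightarrow> int ^ 'd \<Rightarrow> 's) \<Rightarrow> bool" where
  "finitary \<nu> F \<longleftrightarrow> (AE y in config_space \<nu>. coding_radius \<nu> F y < \<infinity>)"

text \<open>
  For an arbitrary probability space \<open>\<nu>\<close> the coding radius need not be measurable, and
  \<^const>\<open>measure\<close> is 0 on non-measurable sets. The outer measure avoids this; on measurable
  (or completion-measurable) events it is their probability.
\<close>

definition exponential_tails :: "'y measure \<Rightarrow> ((int ^ 'd \<Rightarrow> 'y) \<Rightarrow> int ^ 'd \<Rightarrow> 's) \<Rightarrow> bool" where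
  "exponential_tails \<nu> F \<longleftrightarrow>
     (\<exists>c>0. \<exists>C>0. \<forall>n::nat.
        outer_measure_of (config_space \<nu>)
            {y \<in> space (config_space \<nu>). coding_radius \<nu> F y \<ge> ereal (real n)}
          \<le> ennreal (C * exp (- c * real n)))"

text \<open>
  HOL cannot quantify existentially over the type carrying \<open>\<nu>\<close>; we fix the carrier type to be the
  real sequences, with an arbitrary sigma-algebra on an arbitrary subset.
\<close>

definition ffiid_exponential_tails :: "'s measure \<Rightarrow> (int ^ 'd \<Rightarrow> 's) measure \<Rightarrow> bool" where
  "ffiid_exponential_tails S \<mu> \<longleftrightarrow>
     (\<exists>(\<nu> :: (nat \<Rightarrow> real) measure) F.
        factor_of_iid S \<mu> \<nu> F \<and> finitary \<nu> F \<and> exponential_tails \<nu> F)"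

text \<open>
  Two sets of sites are at distance greater than \<open>l\<close> iff all their cross distances are, since
  these are integers.
\<close>

definition dependent_within :: "'s measure \<Rightarrow> nat \<Rightarrow> (int ^ 'd \<Rightarrow> 's) measure \<Rightarrow> bool" where
  "dependent_within S l \<mu> \<longleftrightarrow>
     field_distribution S \<mu> \<and>
     (\<forall>A A'. (\<forall>i\<in>A. \<forall>j\<in>A'. norm1 (i - j) > int l) \<longrightarrow>
        prob_space.indep_var \<mu>
          (Pi\<^sub>M A (\<lambda>_. S)) (\<lambda>x. restrict x A)
          (Pi\<^sub>M A' (\<lambda>_. S)) (\<lambda>x. restrict x A'))"

definition tv_distance :: "'a measure \<Rightarrow> 'a measure \<Rightarrow> real" where
  "tv_distance M N = (SUP A\<in>sets M. \<bar>measure M A - measure N A\<bar>)"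

end

theory Submission
  imports Defs
begin

text \<open>
  The field is constructed by coupling from the past, from a local dynamics on configurations that
  is driven by i.i.d. noise, preserves the single-site conditional laws and forgets its past
  exponentially fast.

  In one time step every site tosses a fair coin. A site is \<^emph>\<open>active\<close> if its coin shows heads and
  the coins of all its neighbours show tails, so that no two active sites are neighbours; this chooses
  an independent set in a translation-equivariant way. An active site \<open>i\<close> receives a proposal
  \<open>s\<close> drawn from the standard Gaussian law conditioned on \<open>[- L, L]\<close> and adopts it if an
  independent uniform variable \<open>v\<close> satisfies \<open>v \<le> exp (h * s - K)\<close>, where \<open>h\<close> is the local
  field at \<open>i\<close> and \<open>K\<close> bounds \<open>\<bar>h * s\<bar>\<close>; otherwise the old value stays. The acceptance
  probability is proportional to the density \<open>exp (h * s)\<close> of the conditional law with respect to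
  the law of the proposal and does not depend on the old value, so the move is reversible for the
  conditional law. Active sites do not see each other, so moving them all at once amounts to moving
  them one after the other, and every measure with the right single-site conditional laws in a finite
  set \<open>V\<close> is preserved by the dynamics that only moves sites of \<open>V\<close>
  (\<open>update_preserves\<close>, \<open>run_preserves\<close>).

  If \<open>v \<le> exp (- 2 * K)\<close>, the proposal is adopted whatever the surroundings are. For small
  \<open>K\<close> this is nearly always the case. The set \<open>uncertain n y\<close> of sites whose value after
  \<open>n\<close> steps may still depend on the initial configuration can therefore be followed recursively:
  an active site leaves it except with probability at most \<open>2 * K\<close>, and enters it with that small
  probability when a neighbour was uncertain. A union bound gives
  \<open>P (i \<in> uncertain n) \<le> rate ^ n\<close> with \<open>rate < 1\<close> (\<open>emeasure_uncertain\<close>).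

  All claims follow from this. The value at time 0 of the dynamics started infinitely long ago is an
  equivariant function \<open>factor\<close> of the noise, and its coding radius is at most \<open>n\<close> unless the
  origin is uncertain after \<open>n\<close> steps. A measure with the right single-site conditional laws in a
  finite set \<open>V\<close> agrees with the law of \<open>factor\<close> far inside \<open>V\<close> up to an exponentially
  small error (\<open>balanced_close_to_field_law\<close>). Applied to a Gibbs measure, this gives uniqueness;
  applied to the finite-volume Gibbs measures, it transports their DLR equations to the law of
  \<open>factor\<close> (\<open>dlr_field_law\<close>), which gives existence. Running the dynamics for only
  \<open>l div 2\<close> steps yields an \<open>l\<close>-dependent field that differs from \<open>factor\<close> at a given site
  with exponentially small probability (\<open>block_approximation\<close>). For \<open>l \<le> 1\<close>, where this
  bound is not of the form \<open>exp (- c * l)\<close>, the product of the one-site marginals is used instead: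
  it is exact on single sites, and on two or more sites an error of \<open>1 / 2\<close> per site is trivial
  (\<open>independent_approximation\<close>).
\<close>

section \<open>Product measures\<close>

abbreviation iid :: "'a measure \<Rightarrow> ('i \<Rightarrow> 'a) measure" where
  "iid M \<equiv> Pi\<^sub>M UNIV (\<lambda>_. M)"

lemma measurable_pointwise_PiM:
  assumes [measurable]: "f \<in> M \<rightarrow>\<^sub>M N"
  shows "(\<lambda>w i. f (w i)) \<in> Pi\<^sub>M UNIV (\<lambda>_::'i. M) \<rightarrow>\<^sub>M iid N"
  by (intro measurable_PiM_single') (auto simp: space_PiM PiE_iff measurable_space[OF assms])

lemma distr_PiM_pointwise:
  assumes "prob_space M" and [measurable]: "f \<in> M \<rightarrow>\<^sub>M N"
  shows "distr (Pi\<^sub>M UNIV (\<lambda>_::'i. M)) (iid N) (\<lambda>w i. f (w i)) =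
    iid (distr M N f)"
proof -
  interpret M: prob_space M by fact
  interpret D: prob_space "distr M N f" by (rule M.prob_space_distr) simp
  interpret P: product_prob_space "\<lambda>_::'i. M" UNIV by unfold_locales
  interpret Q: product_prob_space "\<lambda>_::'i. distr M N f" UNIV by unfold_locales
  show ?thesis
  proof (rule Q.PiM_eq)
    show "sets (distr (Pi\<^sub>M UNIV (\<lambda>_::'i. M)) (iid N) (\<lambda>w i. f (w i))) =
        sets (Pi\<^sub>M UNIV (\<lambda>_::'i. distr M N f))"
      by (simp cong: sets_PiM_cong)
  next
    fix J :: "'i set" and A
    assume J: "finite J" "J \<subseteq> UNIV" and A: "\<And>j. j \<in> J \<Longrightarrow> A j \<in> sets (distr M N f)"
    have "emeasure (distr (Pi\<^sub>M UNIV (\<lambda>_::'i. M)) (iid N) (\<lambda>w i. f (w i)))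
        (prod_emb UNIV (\<lambda>_. distr M N f) J (Pi\<^sub>E J A)) =
      emeasure (Pi\<^sub>M UNIV (\<lambda>_::'i. M)) {x\<in>space (Pi\<^sub>M UNIV (\<lambda>_::'i. M)). \<forall>i\<in>J. x i \<in> f -` A i \<inter> space M}"
    proof (subst emeasure_distr)
      show "prod_emb UNIV (\<lambda>_. distr M N f) J (Pi\<^sub>E J A) \<in> sets (Pi\<^sub>M UNIV (\<lambda>_::'i. N))"
        using sets_PiM_I[of J UNIV A "\<lambda>_. N"] J A by (simp add: prod_emb_def)
    qed (auto simp: prod_emb_def space_PiM PiE_iff measurable_space[OF assms(2)]
          intro!: arg_cong2[where f=emeasure] measurable_pointwise_PiM)
    also have "\<dots> = (\<Prod>i\<in>J. emeasure M (f -` A i \<inter> space M))"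
      using A J by (intro P.emeasure_PiM_Collect) auto
    also have "\<dots> = (\<Prod>j\<in>J. emeasure (distr M N f) (A j))"
      using A by (intro prod.cong) (auto simp: emeasure_distr)
    finally show "emeasure (distr (Pi\<^sub>M UNIV (\<lambda>_::'i. M)) (iid N) (\<lambda>w i. f (w i)))
        (prod_emb UNIV (\<lambda>_. distr M N f) J (Pi\<^sub>E J A)) = (\<Prod>j\<in>J. emeasure (distr M N f) (A j))" .
  qed
qed

lemma measurable_zip_PiM:
  "(\<lambda>(u, v) i. (u i, v i)) \<in> Pi\<^sub>M UNIV (\<lambda>_::'i. M) \<Otimes>\<^sub>M Pi\<^sub>M UNIV (\<lambda>_::'i. N)
    \<rightarrow>\<^sub>M iid (M \<Otimes>\<^sub>M N)"
  unfolding split_beta'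
  by (intro measurable_PiM_single') (auto simp: space_PiM space_pair_measure PiE_iff)

text \<open>
  For a fixed second field, a cylinder event of the zipped field is a cylinder event of the first one.
  Its probability is a product over finitely many sites, and by Fubini the integral of this product
  against the second field factorizes again.
\<close>

lemma distr_zip_PiM:
  assumes "prob_space M" "prob_space N"
  shows "distr (Pi\<^sub>M UNIV (\<lambda>_::'i. M) \<Otimes>\<^sub>M Pi\<^sub>M UNIV (\<lambda>_::'i. N)) (iid (M \<Otimes>\<^sub>M N))
    (\<lambda>(u, v) i. (u i, v i)) = iid (M \<Otimes>\<^sub>M N)"
proof -
  interpret M: prob_space M by fact
  interpret N: prob_space N by fact
  interpret MN: pair_prob_space M N ..
  interpret PM: product_prob_space "\<lambda>_::'i. M" UNIV by unfold_locales
  interpret PN: product_prob_space "\<lambda>_::'i. N" UNIV by unfold_locales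
  interpret Q: product_prob_space "\<lambda>_::'i. M \<Otimes>\<^sub>M N" UNIV by unfold_locales
  interpret MN': pair_prob_space "Pi\<^sub>M UNIV (\<lambda>_::'i. M)" "Pi\<^sub>M UNIV (\<lambda>_::'i. N)" ..
  let ?M = "Pi\<^sub>M UNIV (\<lambda>_::'i. M)" and ?N = "Pi\<^sub>M UNIV (\<lambda>_::'i. N)"
  let ?Q = "Pi\<^sub>M UNIV (\<lambda>_::'i. M \<Otimes>\<^sub>M N)"
  note measurable_zip_PiM[measurable]
  show ?thesis
  proof (rule Q.PiM_eq)
    fix J :: "'i set" and A
    assume J: "finite J" "J \<subseteq> UNIV" and A: "\<And>j. j \<in> J \<Longrightarrow> A j \<in> sets (M \<Otimes>\<^sub>M N)"
    let ?E = "{p\<in>space (?M \<Otimes>\<^sub>M ?N). \<forall>i\<in>J. (fst p i, snd p i) \<in> A i}"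
    have sets: "prod_emb UNIV (\<lambda>_. M \<Otimes>\<^sub>M N) J (Pi\<^sub>E J A) \<in> sets ?Q"
      using J A by (intro sets_PiM_I) auto
    have vim: "(\<lambda>(u, v) i. (u i, v i)) -` prod_emb UNIV (\<lambda>_. M \<Otimes>\<^sub>M N) J (Pi\<^sub>E J A) \<inter> space (?M \<Otimes>\<^sub>M ?N) = ?E"
      by (auto simp: prod_emb_def space_PiM space_pair_measure PiE_iff)
    have E: "?E \<in> sets (?M \<Otimes>\<^sub>M ?N)"
      unfolding vim[symmetric] using sets by (rule measurable_sets[rotated]) simp
    have "(\<lambda>v. emeasure M ((\<lambda>a. (a, v i)) -` A i)) \<in> borel_measurable (Pi\<^sub>M J (\<lambda>_. N))" if "i \<in> J" for i
      by (rule measurable_compose[where f="\<lambda>v. v i", OF _ MN.measurable_emeasure_Pair2[OF A[OF that]]])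
        (simp add: that)
    then have meas: "(\<lambda>v. \<Prod>i\<in>J. emeasure M ((\<lambda>a. (a, v i)) -` A i)) \<in> borel_measurable (Pi\<^sub>M J (\<lambda>_. N))"
      by (rule borel_measurable_prod_ennreal)
    have "emeasure (distr (?M \<Otimes>\<^sub>M ?N) ?Q (\<lambda>(u, v) i. (u i, v i)))
        (prod_emb UNIV (\<lambda>_. M \<Otimes>\<^sub>M N) J (Pi\<^sub>E J A)) = emeasure (?M \<Otimes>\<^sub>M ?N) ?E"
      by (simp add: emeasure_distr sets vim)
    also have "\<dots> = (\<integral>\<^sup>+v. emeasure ?M ((\<lambda>u. (u, v)) -` ?E) \<partial>?N)"
      by (rule MN'.emeasure_pair_measure_alt2[OF E])
    also have "\<dots> = (\<integral>\<^sup>+v. (\<Prod>i\<in>J. emeasure M ((\<lambda>a. (a, v i)) -` A i)) \<partial>?N)"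
    proof (rule nn_integral_cong)
      fix v assume v: "v \<in> space ?N"
      have "(\<lambda>u. (u, v)) -` ?E = {u\<in>space ?M. \<forall>i\<in>J. u i \<in> (\<lambda>a. (a, v i)) -` A i}"
        using v by (auto simp: space_pair_measure)
      then show "emeasure ?M ((\<lambda>u. (u, v)) -` ?E) = (\<Prod>i\<in>J. emeasure M ((\<lambda>a. (a, v i)) -` A i))"
        by (simp only:) (rule PM.emeasure_PiM_Collect[OF J(2,1) sets_Pair2[OF A]])
    qed
    also have "\<dots> = (\<integral>\<^sup>+v. (\<Prod>i\<in>J. emeasure M ((\<lambda>a. (a, restrict v J i)) -` A i)) \<partial>?N)"
      by (intro nn_integral_cong prod.cong refl) (simp only: restrict_apply')
    also have "\<dots> = (\<integral>\<^sup>+v. (\<Prod>i\<in>J. emeasure M ((\<lambda>a. (a, v i)) -` A i)) \<partial>distr ?N (Pi\<^sub>M J (\<lambda>_. N)) (\<lambda>v. restrict v J))"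
    proof (rule nn_integral_distr[symmetric])
      show "(\<lambda>v. restrict v J) \<in> ?N \<rightarrow>\<^sub>M Pi\<^sub>M J (\<lambda>_. N)"
        by (rule measurable_restrict_subset) (rule subset_UNIV)
    qed (simp only: meas measurable_distr_eq1)
    also have "\<dots> = (\<integral>\<^sup>+v. (\<Prod>i\<in>J. emeasure M ((\<lambda>a. (a, v i)) -` A i)) \<partial>Pi\<^sub>M J (\<lambda>_. N))"
      by (simp only: PN.distr_PiM_restrict_finite[OF J])
    also have "\<dots> = (\<Prod>i\<in>J. \<integral>\<^sup>+b. emeasure M ((\<lambda>a. (a, b)) -` A i) \<partial>N)"
      using J(1) A by (rule PN.product_nn_integral_prod[OF _ MN.measurable_emeasure_Pair2])
    also have "\<dots> = (\<Prod>j\<in>J. emeasure (M \<Otimes>\<^sub>M N) (A j))"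
      using A by (intro prod.cong refl MN.emeasure_pair_measure_alt2[symmetric])
    finally show "emeasure (distr (?M \<Otimes>\<^sub>M ?N) ?Q (\<lambda>(u, v) i. (u i, v i)))
        (prod_emb UNIV (\<lambda>_. M \<Otimes>\<^sub>M N) J (Pi\<^sub>E J A)) = (\<Prod>j\<in>J. emeasure (M \<Otimes>\<^sub>M N) (A j))" .
  qed simp
qed

lemma measurable_unzip_PiM [measurable]:
  "(\<lambda>w. (\<lambda>i. fst (w i), \<lambda>i. snd (w i))) \<in>
     Pi\<^sub>M UNIV (\<lambda>_::'i. M \<Otimes>\<^sub>M N) \<rightarrow>\<^sub>M iid M \<Otimes>\<^sub>M iid N"
  by (intro measurable_Pair measurable_PiM_single')
    (auto simp: space_PiM space_pair_measure PiE_iff mem_Times_iff)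

lemma distr_unzip_PiM:
  fixes M :: "'a measure" and N :: "'b measure"
  assumes "prob_space M" "prob_space N"
  shows "distr (Pi\<^sub>M UNIV (\<lambda>_::'i. M \<Otimes>\<^sub>M N)) (iid M \<Otimes>\<^sub>M iid N)
    (\<lambda>w. (\<lambda>i. fst (w i), \<lambda>i. snd (w i))) = iid M \<Otimes>\<^sub>M iid N"
proof -
  note measurable_zip_PiM[measurable]
  let ?zip = "\<lambda>(u :: 'i \<Rightarrow> 'a, v :: 'i \<Rightarrow> 'b) i. (u i, v i)"
  let ?unzip = "\<lambda>w :: 'i \<Rightarrow> 'a \<times> 'b. (\<lambda>i. fst (w i), \<lambda>i. snd (w i))"
  let ?MN = "iid M \<Otimes>\<^sub>M iid N"
  have "distr (iid (M \<Otimes>\<^sub>M N)) ?MN ?unzip =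
      distr (distr ?MN (iid (M \<Otimes>\<^sub>M N)) ?zip) ?MN ?unzip"
    by (simp only: distr_zip_PiM[OF assms])
  also have "\<dots> = distr ?MN ?MN (?unzip \<circ> ?zip)"
    by (rule distr_distr) measurable
  also have "?unzip \<circ> ?zip = (\<lambda>p. p)"
    by (auto simp: fun_eq_iff)
  finally show ?thesis
    by simp
qed

section \<open>The lattice\<close>

definition nbrs :: "int ^ 'd \<Rightarrow> (int ^ 'd) set" where
  "nbrs i = {j. norm1 (i - j) = 1}"

definition ball1 :: "int ^ 'd \<Rightarrow> nat \<Rightarrow> (int ^ 'd) set" where
  "ball1 i r = {j. norm1 (i - j) \<le> int r}"

lemma norm1_zero [simp]: "norm1 0 = 0"
  by (simp add: norm1_def)

lemma norm1_minus_commute: "norm1 (i - j) = norm1 (j - i)"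
  unfolding norm1_def by (intro sum.cong refl) simp

lemma norm1_triangle: "norm1 (i - k) \<le> norm1 (i - j) + norm1 (j - k)"
  unfolding norm1_def sum.distrib[symmetric] by (intro sum_mono) simp

lemma not_self_nbrs [simp]: "i \<notin> nbrs i"
  by (simp add: nbrs_def)

lemma finite_ball1 [simp]: "finite (ball1 (i :: int ^ 'd) r)"
proof -
  have bound: "\<bar>i $ k - j $ k\<bar> \<le> int r" if "j \<in> ball1 i r" for j k
  proof -
    have "\<bar>(i - j) $ k\<bar> \<le> norm1 (i - j)"
      unfolding norm1_def by (rule member_le_sum) auto
    then show ?thesis using that by (simp add: ball1_def)
  qed
  have "ball1 i r \<subseteq> vec_lambda ` (\<Pi>\<^sub>E k\<in>UNIV. {i $ k - int r .. i $ k + int r})"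
  proof
    fix j assume "j \<in> ball1 i r"
    then have "vec_nth j \<in> (\<Pi>\<^sub>E k\<in>UNIV. {i $ k - int r .. i $ k + int r})"
    proof (intro PiE_I)
      fix k show "j $ k \<in> {i $ k - int r .. i $ k + int r}"
        using bound[OF \<open>j \<in> ball1 i r\<close>, of k] by auto
    qed simp
    then show "j \<in> vec_lambda ` (\<Pi>\<^sub>E k\<in>UNIV. {i $ k - int r .. i $ k + int r})"
      by (intro image_eqI[of _ _ "vec_nth j"]) (simp_all add: vec_nth_inverse)
  qed
  then show ?thesis
    by (rule finite_subset) (intro finite_imageI finite_PiE; simp)
qed

lemma nbrs_eq_Diff: "nbrs i = {j \<in> ball1 i 1. norm1 (i - j) = 1}"
  by (auto simp: nbrs_def ball1_def)

lemma finite_nbrs [simp]: "finite (nbrs i)"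
  by (simp add: nbrs_eq_Diff)

lemma self_in_ball1 [simp]: "i \<in> ball1 i r"
  by (simp add: ball1_def)

lemma ball1_subset_Suc: "j \<in> insert i (nbrs i) \<Longrightarrow> ball1 j r \<subseteq> ball1 i (Suc r)"
proof
  fix k assume "j \<in> insert i (nbrs i)" "k \<in> ball1 j r"
  then show "k \<in> ball1 i (Suc r)"
    using norm1_triangle[of i k j] by (auto simp: nbrs_def ball1_def)
qed

lemma nbrs_subset_ball1: "insert i (nbrs i) \<subseteq> ball1 i (Suc r)"
  by (auto simp: nbrs_def ball1_def)

lemma nbrs_translate: "nbrs (i + v) = (\<lambda>j. j + v) ` nbrs i"
proof -
  have "j \<in> (\<lambda>j. j + v) ` nbrs i" if "j \<in> nbrs (i + v)" for j
    using that by (intro image_eqI[of _ _ "j - v"]) (simp_all add: nbrs_def algebra_simps)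
  then show ?thesis
    by (auto simp: nbrs_def)
qed

lemma card_nbrs: "card (nbrs i) = card (nbrs (0 :: int ^ 'd))" for i :: "int ^ 'd"
  using nbrs_translate[of 0 i] by (simp add: card_image)

text \<open>
  Only one endpoint has to lie in \<open>\<Lambda>\<close>, and an unordered pair can be read off from either end.
\<close>

lemma edges_meeting_eq: "edges_meeting \<Lambda> = (\<Union>i\<in>\<Lambda>. (\<lambda>j. {i, j}) ` nbrs i)"
proof (intro set_eqI iffI)
  fix e assume "e \<in> edges_meeting \<Lambda>"
  then obtain i j where e: "e = {i, j}" "j \<in> nbrs i" "i \<in> nbrs j" "i \<in> \<Lambda> \<or> j \<in> \<Lambda>"
    by (auto simp: edges_meeting_def nbrs_def norm1_minus_commute)
  then have "e = {j, i}" by auto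
  with e show "e \<in> (\<Union>i\<in>\<Lambda>. (\<lambda>j. {i, j}) ` nbrs i)" by blast
next
  fix e assume "e \<in> (\<Union>i\<in>\<Lambda>. (\<lambda>j. {i, j}) ` nbrs i)"
  then show "e \<in> edges_meeting \<Lambda>"
    by (auto simp: edges_meeting_def nbrs_def)
qed

lemma finite_edges_meeting: "finite \<Lambda> \<Longrightarrow> finite (edges_meeting \<Lambda>)"
  by (simp add: edges_meeting_eq)

text \<open>
  The edges at \<open>i\<close> correspond to the neighbours of \<open>i\<close>, so the interaction energy at a single
  site is linear in the spin there. This makes the single-site conditional law a truncated Gaussian
  with an exponential tilt.
\<close>

lemma sum_edges_meeting_singleton:
  "(\<Sum>e\<in>edges_meeting {i}. \<Prod>k\<in>e. x k) = (x i :: real) * (\<Sum>j\<in>nbrs i. x j)"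
proof -
  have "inj_on (\<lambda>j. {i, j}) (nbrs i)"
    by (auto simp: inj_on_def doubleton_eq_iff)
  then have "(\<Sum>e\<in>edges_meeting {i}. \<Prod>k\<in>e. x k) = (\<Sum>j\<in>nbrs i. \<Prod>k\<in>{i, j}. x k)"
    by (simp add: edges_meeting_eq sum.reindex)
  also have "\<dots> = (\<Sum>j\<in>nbrs i. x i * x j)"
    by (intro sum.cong refl, subst prod.insert) auto
  finally show ?thesis
    by (simp add: sum_distrib_left)
qed

section \<open>Independent noise in space and time\<close>

definition unif01 :: "real measure" where
  "unif01 = uniform_measure lborel {0..1}"

lemma sets_unif01 [simp, measurable_cong]: "sets unif01 = sets borel"
  by (simp add: unif01_def)

lemma space_unif01 [simp]: "space unif01 = UNIV"
  by (simp add: unif01_def)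

lemma prob_space_unif01: "prob_space unif01"
  unfolding unif01_def by (rule prob_space_uniform_measure) auto

lemma emeasure_unif01_atMost:
  assumes "0 \<le> a" "a \<le> 1" shows "emeasure unif01 {..a} = ennreal a"
proof -
  have "{0..1} \<inter> {..a} = {0..a}" using assms by auto
  then show ?thesis using assms by (simp add: unif01_def divide_ennreal_def)
qed

lemma emeasure_unif01_greaterThan:
  assumes "0 \<le> a" "a \<le> 1" shows "emeasure unif01 {a<..} = ennreal (1 - a)"
proof -
  have "{0..1} \<inter> {a<..} = {a<..1}" using assms by auto
  then show ?thesis using assms by (simp add: unif01_def divide_ennreal_def)
qed

definition gauss_weight :: "real \<Rightarrow> ennreal" where
  "gauss_weight s = ennreal (exp (- s\<^sup>2 / 2))"

lemma borel_measurable_gauss_weight [measurable]: "gauss_weight \<in> borel_measurable borel"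
  unfolding gauss_weight_def by measurable

lemma space_spin_space [simp]: "space (spin_space L) = {- L..L}"
  by (simp add: spin_space_def space_restrict_space)

lemma measurable_spin_space_real: "(\<lambda>s. s) \<in> borel_measurable (spin_space L)"
  unfolding spin_space_def by (rule measurable_restrict_space1) simp

lemma measurable_from_spin_space [measurable (raw)]:
  "f \<in> M \<rightarrow>\<^sub>M spin_space L \<Longrightarrow> f \<in> borel_measurable M"
  using measurable_compose[OF _ measurable_spin_space_real] .

lemma measurable_to_spin_space:
  "f \<in> borel_measurable M \<Longrightarrow> (\<And>x. x \<in> space M \<Longrightarrow> f x \<in> {- L..L}) \<Longrightarrow> f \<in> M \<rightarrow>\<^sub>M spin_space L"
  unfolding spin_space_def by (intro measurable_restrict_space2) auto

definition gauss_mass :: "real \<Rightarrow> ennreal" where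
  "gauss_mass L = (\<integral>\<^sup>+s. gauss_weight s \<partial>spin_space L)"

lemma finite_measure_spin_space: "finite_measure (spin_space L)"
proof (rule finite_measureI)
  show "emeasure (spin_space L) (space (spin_space L)) \<noteq> \<infinity>"
    unfolding spin_space_def by (cases "- L \<le> L") (simp_all add: emeasure_restrict_space space_restrict_space)
qed

lemma gauss_mass_bounds:
  assumes "L > 0" shows "gauss_mass L \<noteq> 0" "gauss_mass L \<noteq> \<infinity>"
proof -
  have S: "emeasure (spin_space L) {- L..L} = ennreal (2 * L)"
    using assms by (simp add: spin_space_def emeasure_restrict_space)
  have "gauss_mass L \<le> (\<integral>\<^sup>+s. 1 \<partial>spin_space L)"
    unfolding gauss_mass_def gauss_weight_def by (intro nn_integral_mono) (simp add: ennreal_le_1)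
  then show "gauss_mass L \<noteq> \<infinity>"
    using S by (auto simp: top_unique)
  have "ennreal (exp (- L\<^sup>2 / 2)) * ennreal (2 * L) = (\<integral>\<^sup>+s. ennreal (exp (- L\<^sup>2 / 2)) \<partial>spin_space L)"
    using S by (simp add: nn_integral_const)
  also have "\<dots> \<le> gauss_mass L"
    unfolding gauss_mass_def gauss_weight_def
  proof (intro nn_integral_mono ennreal_leI)
    fix s assume "s \<in> space (spin_space L)"
    then have "s\<^sup>2 \<le> L\<^sup>2" by (auto intro!: abs_le_square_iff[THEN iffD1])
    then show "exp (- L\<^sup>2 / 2) \<le> exp (- s\<^sup>2 / 2)" by simp
  qed
  finally show "gauss_mass L \<noteq> 0"
    using assms by (auto simp flip: ennreal_mult simp: ennreal_eq_0_iff mult_le_0_iff)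
qed

definition trunc_gauss :: "real \<Rightarrow> real measure" where
  "trunc_gauss L = density (spin_space L) (\<lambda>s. gauss_weight s / gauss_mass L)"

lemma sets_trunc_gauss [simp, measurable_cong]: "sets (trunc_gauss L) = sets (spin_space L)"
  by (simp add: trunc_gauss_def)

lemma space_trunc_gauss [simp]: "space (trunc_gauss L) = {- L..L}"
  by (simp add: trunc_gauss_def)

lemma borel_measurable_gauss_weight_spin [measurable]:
  "gauss_weight \<in> borel_measurable (spin_space L)"
  using measurable_compose[OF measurable_spin_space_real borel_measurable_gauss_weight] .

lemma nn_integral_trunc_gauss:
  assumes [measurable]: "f \<in> borel_measurable (spin_space L)"
  shows "(\<integral>\<^sup>+s. f s \<partial>trunc_gauss L) = (\<integral>\<^sup>+s. gauss_weight s * f s \<partial>spin_space L) / gauss_mass L"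
proof -
  have "(\<integral>\<^sup>+s. f s \<partial>trunc_gauss L) = (\<integral>\<^sup>+s. gauss_weight s / gauss_mass L * f s \<partial>spin_space L)"
    unfolding trunc_gauss_def by (rule nn_integral_density) measurable
  also have "\<dots> = (\<integral>\<^sup>+s. gauss_weight s * f s / gauss_mass L \<partial>spin_space L)"
    by (intro nn_integral_cong) (simp add: divide_ennreal_def mult_ac)
  also have "\<dots> = (\<integral>\<^sup>+s. gauss_weight s * f s \<partial>spin_space L) / gauss_mass L"
    by (rule nn_integral_divide) measurable
  finally show ?thesis .
qed

lemma prob_space_trunc_gauss:
  assumes "L > 0" shows "prob_space (trunc_gauss L)"
proof (rule prob_spaceI)
  have "emeasure (trunc_gauss L) (space (trunc_gauss L)) = (\<integral>\<^sup>+s. 1 \<partial>trunc_gauss L)"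
    by simp
  also have "\<dots> = gauss_mass L / gauss_mass L"
    by (subst nn_integral_trunc_gauss) (simp_all add: gauss_mass_def)
  also have "\<dots> = 1"
    using gauss_mass_bounds[OF assms] by (intro ennreal_divide_self) (auto simp: top.not_eq_extremum)
  finally show "emeasure (trunc_gauss L) (space (trunc_gauss L)) = 1" .
qed

definition proposal_law :: "real \<Rightarrow> (real \<times> real) measure" where
  "proposal_law L = trunc_gauss L \<Otimes>\<^sub>M unif01"

text \<open>
  All the randomness of a site has to be one real sequence. Its entries \<open>3 * n\<close>,
  \<open>3 * n + 1\<close> and \<open>3 * n + 2\<close> hold the coin, the proposed spin and the acceptance variable
  of a step, and \<open>n = 0\<close> is the latest one.
\<close>

definition pack :: "(nat \<Rightarrow> real \<times> real \<times> real) \<Rightarrow> nat \<Rightarrow> real" where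
  "pack w n = (case w (n div 3) of (t, s, v) \<Rightarrow>
     if n mod 3 = 0 then t else if n mod 3 = 1 then s else v)"

definition noise_law :: "real \<Rightarrow> (nat \<Rightarrow> real) measure" where
  "noise_law L = distr (iid (unif01 \<Otimes>\<^sub>M proposal_law L)) (iid borel) pack"

text \<open>
  Proposals drawn from the noise lie in \<open>[- L, L]\<close> almost surely. Clipping makes this true of every
  sequence, so that configurations stay in their space for every realization of the noise and not just
  for almost every one; the coding radius is a pointwise notion.
\<close>

definition clip :: "real \<Rightarrow> real \<Rightarrow> real" where
  "clip L r = max (- L) (min L r)"

definition head :: "real \<Rightarrow> (nat \<Rightarrow> real) \<Rightarrow> real \<times> real \<times> real" where
  "head L z = (z 0, clip L (z 1), z 2)"

definition rest :: "(nat \<Rightarrow> real) \<Rightarrow> nat \<Rightarrow> real" where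
  "rest z n = z (n + 3)"

lemma sets_proposal_law [measurable_cong]: "sets (proposal_law L) = sets (spin_space L \<Otimes>\<^sub>M borel)"
  unfolding proposal_law_def by (intro sets_pair_measure_cong) simp_all

lemma space_proposal_law: "space (proposal_law L) = {- L..L} \<times> UNIV"
  by (simp add: proposal_law_def space_pair_measure)

lemma prob_space_proposal_law:
  assumes "L > 0" shows "prob_space (proposal_law L)"
proof -
  interpret A: prob_space "trunc_gauss L" using assms by (rule prob_space_trunc_gauss)
  interpret B: prob_space unif01 by (rule prob_space_unif01)
  interpret pair_prob_space "trunc_gauss L" unif01 ..
  show ?thesis unfolding proposal_law_def by unfold_locales
qed

lemma prob_space_innovation:
  assumes "L > 0" shows "prob_space (unif01 \<Otimes>\<^sub>M proposal_law L)"
proof -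
  interpret A: prob_space "proposal_law L" using assms by (rule prob_space_proposal_law)
  interpret B: prob_space unif01 by (rule prob_space_unif01)
  interpret pair_prob_space unif01 "proposal_law L" ..
  show ?thesis by unfold_locales
qed

lemma measurable_pack [measurable]:
  "pack \<in> iid (unif01 \<Otimes>\<^sub>M proposal_law L) \<rightarrow>\<^sub>M iid borel"
proof (intro measurable_PiM_single')
  fix n :: nat
  let ?I = "unif01 \<Otimes>\<^sub>M proposal_law L"
  have c: "(\<lambda>w. w (n div 3)) \<in> iid ?I \<rightarrow>\<^sub>M ?I"
    by simp
  have "(\<lambda>q. fst q) \<in> borel_measurable ?I"
    by measurable
  moreover have "(\<lambda>q. fst (snd q)) \<in> borel_measurable ?I" "(\<lambda>q. snd (snd q)) \<in> borel_measurable ?I"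
    by measurable
  ultimately show "(\<lambda>w. pack w n) \<in> borel_measurable (iid ?I)"
    unfolding pack_def split_beta' using c
    by (cases "n mod 3 = 0"; cases "n mod 3 = 1") (auto intro: measurable_compose[OF c])
qed simp

lemma sets_noise_law [simp, measurable_cong]: "sets (noise_law L) = sets (iid borel)"
  by (simp add: noise_law_def)

lemma space_noise_law [simp]: "space (noise_law L) = UNIV"
  by (simp add: noise_law_def space_PiM)

lemma prob_space_noise_law:
  assumes "L > 0" shows "prob_space (noise_law L)"
proof -
  interpret prob_space "Pi\<^sub>M (UNIV :: nat set) (\<lambda>_. unif01 \<Otimes>\<^sub>M proposal_law L)"
    using assms by (intro prob_space_PiM prob_space_innovation)
  show ?thesis unfolding noise_law_def by (intro prob_space_distr) simp
qed

lemma clip_in: "L > 0 \<Longrightarrow> clip L r \<in> {- L..L}"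
  by (auto simp: clip_def)

lemma clip_id: "r \<in> {- L..L} \<Longrightarrow> clip L r = r"
  by (auto simp: clip_def)

lemma measurable_clip [measurable]: "L > 0 \<Longrightarrow> clip L \<in> borel \<rightarrow>\<^sub>M spin_space L"
  by (rule measurable_to_spin_space) (simp add: clip_def[abs_def], erule clip_in)

lemma measurable_head:
  assumes "L > 0" shows "head L \<in> iid borel \<rightarrow>\<^sub>M unif01 \<Otimes>\<^sub>M proposal_law L"
  unfolding head_def using assms by measurable

lemma measurable_rest: "rest \<in> iid borel \<rightarrow>\<^sub>M iid borel"
  unfolding rest_def[abs_def] by (intro measurable_PiM_single') auto

text \<open>
  An i.i.d. sequence is its first entry followed by an independent copy of itself, and \<open>head\<close> and
  \<open>rest\<close> recover these two parts from the packed sequence.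
\<close>

lemma distr_noise_head_rest:
  assumes "L > 0"
  shows "distr (noise_law L) ((unif01 \<Otimes>\<^sub>M proposal_law L) \<Otimes>\<^sub>M noise_law L) (\<lambda>z. (head L z, rest z)) =
    (unif01 \<Otimes>\<^sub>M proposal_law L) \<Otimes>\<^sub>M noise_law L"
proof -
  let ?I = "unif01 \<Otimes>\<^sub>M proposal_law L"
  let ?W = "Pi\<^sub>M (UNIV :: nat set) (\<lambda>_. ?I)" and ?B = "Pi\<^sub>M (UNIV :: nat set) (\<lambda>_. borel :: real measure)"
  interpret I: prob_space ?I using assms by (rule prob_space_innovation)
  interpret sequence_space ?I by unfold_locales
  interpret nu: prob_space "noise_law L" using assms by (rule prob_space_noise_law)
  note [measurable] = measurable_head[OF assms] measurable_rest
  have pack: "head L (pack (case_nat q w)) = q" "rest (pack (case_nat q w)) = pack w"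
    if "q \<in> space ?I" for q w
    using that
    by (auto simp: head_def rest_def pack_def fun_eq_iff space_pair_measure space_proposal_law clip_id
        split: prod.split)
  have "distr (noise_law L) (?I \<Otimes>\<^sub>M noise_law L) (\<lambda>z. (head L z, rest z)) =
      distr ?W (?I \<Otimes>\<^sub>M noise_law L) (\<lambda>w. (head L (pack w), rest (pack w)))"
    unfolding noise_law_def by (subst distr_distr) (auto simp: comp_def)
  also have "\<dots> = distr (?I \<Otimes>\<^sub>M ?W) (?I \<Otimes>\<^sub>M noise_law L)
      (\<lambda>(q, w). (head L (pack (case_nat q w)), rest (pack (case_nat q w))))"
    by (subst PiM_iter[symmetric], subst distr_distr) (auto simp: comp_def split_beta')
  also have "\<dots> = distr (?I \<Otimes>\<^sub>M ?W) (?I \<Otimes>\<^sub>M noise_law L) (\<lambda>(q, w). (q, pack w))"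
    by (intro distr_cong) (auto simp: pack space_pair_measure)
  also have "\<dots> = distr (?I \<Otimes>\<^sub>M ?W) (?I \<Otimes>\<^sub>M ?B) (\<lambda>(q, w). (q, pack w))"
    by (intro distr_cong sets_pair_measure_cong) auto
  also have "\<dots> = distr ?I ?I (\<lambda>q. q) \<Otimes>\<^sub>M distr ?W ?B pack"
    using nu.sigma_finite_measure_axioms unfolding noise_law_def
    by (intro pair_measure_distr[symmetric]) auto
  finally show ?thesis
    by (simp add: noise_law_def)
qed

definition coins :: "('a \<Rightarrow> nat \<Rightarrow> real) \<Rightarrow> 'a \<Rightarrow> real" where
  "coins y i = y i 0"

definition proposals :: "real \<Rightarrow> ('a \<Rightarrow> nat \<Rightarrow> real) \<Rightarrow> 'a \<Rightarrow> real \<times> real" where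
  "proposals L y i = (clip L (y i 1), y i 2)"

definition past :: "('a \<Rightarrow> nat \<Rightarrow> real) \<Rightarrow> 'a \<Rightarrow> nat \<Rightarrow> real" where
  "past y i = rest (y i)"

lemma measurable_noise_fields [measurable]:
  shows "coins \<in> iid (noise_law L) \<rightarrow>\<^sub>M iid unif01"
    and "L > 0 \<Longrightarrow> proposals L \<in> iid (noise_law L) \<rightarrow>\<^sub>M iid (proposal_law L)"
    and "past \<in> iid (noise_law L) \<rightarrow>\<^sub>M iid (noise_law L)"
  unfolding coins_def[abs_def] proposals_def[abs_def] past_def[abs_def]
proof -
  show "(\<lambda>y i. y i 0) \<in> iid (noise_law L) \<rightarrow>\<^sub>M iid unif01"
    by (rule measurable_pointwise_PiM) measurable
  show "(\<lambda>y i. rest (y i)) \<in> iid (noise_law L) \<rightarrow>\<^sub>M iid (noise_law L)"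
    using measurable_rest by (intro measurable_pointwise_PiM) simp
  show "(\<lambda>y i. (clip L (y i 1), y i 2)) \<in> iid (noise_law L) \<rightarrow>\<^sub>M iid (proposal_law L)"
    if [measurable, simp]: "L > 0" by (rule measurable_pointwise_PiM) measurable
qed

lemma distr_noise_fields:
  assumes "L > 0"
  shows "distr (Pi\<^sub>M UNIV (\<lambda>_::'i. noise_law L))
      ((iid unif01 \<Otimes>\<^sub>M iid (proposal_law L)) \<Otimes>\<^sub>M iid (noise_law L))
      (\<lambda>y. ((coins y, proposals L y), past y)) =
    (iid unif01 \<Otimes>\<^sub>M iid (proposal_law L)) \<Otimes>\<^sub>M iid (noise_law L)"
proof -
  let ?I = "unif01 \<Otimes>\<^sub>M proposal_law L"
  let ?C = "Pi\<^sub>M (UNIV::'i set) (\<lambda>_. unif01)" and ?P = "Pi\<^sub>M (UNIV::'i set) (\<lambda>_. proposal_law L)"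
  let ?Y = "Pi\<^sub>M (UNIV::'i set) (\<lambda>_. noise_law L)" and ?IF = "Pi\<^sub>M (UNIV::'i set) (\<lambda>_. ?I)"
  interpret I: prob_space ?I using assms by (rule prob_space_innovation)
  interpret U: prob_space unif01 by (rule prob_space_unif01)
  interpret P: prob_space "proposal_law L" using assms by (rule prob_space_proposal_law)
  interpret nu: prob_space "noise_law L" using assms by (rule prob_space_noise_law)
  interpret Y: prob_space ?Y by (intro prob_space_PiM nu.prob_space_axioms)
  note [measurable] = measurable_head[OF assms] measurable_rest
  note [measurable] = measurable_pointwise_PiM[of "\<lambda>z. (head L z, rest z)" "noise_law L" "?I \<Otimes>\<^sub>M noise_law L"]
  have "(?C \<Otimes>\<^sub>M ?P) \<Otimes>\<^sub>M ?Y = distr ?IF (?C \<Otimes>\<^sub>M ?P) (\<lambda>w. (\<lambda>i. fst (w i), \<lambda>i. snd (w i))) \<Otimes>\<^sub>M distr ?Y ?Y (\<lambda>y. y)"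
    by (simp add: distr_unzip_PiM[OF U.prob_space_axioms P.prob_space_axioms])
  also have "\<dots> = distr (?IF \<Otimes>\<^sub>M ?Y) ((?C \<Otimes>\<^sub>M ?P) \<Otimes>\<^sub>M ?Y) (\<lambda>(w, y). ((\<lambda>i. fst (w i), \<lambda>i. snd (w i)), y))"
    using Y.sigma_finite_measure_axioms by (intro pair_measure_distr) auto
  also have "?IF \<Otimes>\<^sub>M ?Y = distr (iid (?I \<Otimes>\<^sub>M noise_law L)) (?IF \<Otimes>\<^sub>M ?Y)
      (\<lambda>w. (\<lambda>i. fst (w i), \<lambda>i. snd (w i)))"
    by (rule distr_unzip_PiM[OF I.prob_space_axioms nu.prob_space_axioms, symmetric])
  also have "Pi\<^sub>M UNIV (\<lambda>_::'i. ?I \<Otimes>\<^sub>M noise_law L) =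
      distr ?Y (iid (?I \<Otimes>\<^sub>M noise_law L)) (\<lambda>y i. (head L (y i), rest (y i)))"
    using distr_PiM_pointwise[OF nu.prob_space_axioms, where 'i='i and
        f="\<lambda>z. (head L z, rest z)" and N="?I \<Otimes>\<^sub>M noise_law L"]
    by (simp add: distr_noise_head_rest[OF assms])
  finally have "(?C \<Otimes>\<^sub>M ?P) \<Otimes>\<^sub>M ?Y = distr (distr (distr ?Y (iid (?I \<Otimes>\<^sub>M noise_law L)) (\<lambda>y i. (head L (y i), rest (y i))))
      (?IF \<Otimes>\<^sub>M ?Y) (\<lambda>w. (\<lambda>i. fst (w i), \<lambda>i. snd (w i))))
      ((?C \<Otimes>\<^sub>M ?P) \<Otimes>\<^sub>M ?Y) (\<lambda>(w, y). ((\<lambda>i. fst (w i), \<lambda>i. snd (w i)), y))" .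
  also have "\<dots> = distr ?Y ((?C \<Otimes>\<^sub>M ?P) \<Otimes>\<^sub>M ?Y)
      (\<lambda>y. ((\<lambda>i. fst (head L (y i)), \<lambda>i. snd (head L (y i))), \<lambda>i. rest (y i)))"
  proof -
    let ?g1 = "\<lambda>(y :: 'i \<Rightarrow> nat \<Rightarrow> real) i. (head L (y i), rest (y i))"
    let ?g2 = "\<lambda>w :: 'i \<Rightarrow> (real \<times> real \<times> real) \<times> (nat \<Rightarrow> real). (\<lambda>i. fst (w i), \<lambda>i. snd (w i))"
    let ?g3 = "\<lambda>(w :: 'i \<Rightarrow> real \<times> real \<times> real, y :: 'i \<Rightarrow> nat \<Rightarrow> real). ((\<lambda>i. fst (w i), \<lambda>i. snd (w i)), y)"
    let ?A = "Pi\<^sub>M UNIV (\<lambda>_::'i. ?I \<Otimes>\<^sub>M noise_law L)"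
    have g1: "?g1 \<in> ?Y \<rightarrow>\<^sub>M ?A" and g2: "?g2 \<in> ?A \<rightarrow>\<^sub>M ?IF \<Otimes>\<^sub>M ?Y"
      and g3: "?g3 \<in> ?IF \<Otimes>\<^sub>M ?Y \<rightarrow>\<^sub>M (?C \<Otimes>\<^sub>M ?P) \<Otimes>\<^sub>M ?Y"
      by measurable
    have "distr (distr (distr ?Y ?A ?g1) (?IF \<Otimes>\<^sub>M ?Y) ?g2) ((?C \<Otimes>\<^sub>M ?P) \<Otimes>\<^sub>M ?Y) ?g3 =
        distr (distr ?Y ?A ?g1) ((?C \<Otimes>\<^sub>M ?P) \<Otimes>\<^sub>M ?Y) (?g3 \<circ> ?g2)"
      using g2 by (intro distr_distr g3) simp
    also have "\<dots> = distr ?Y ((?C \<Otimes>\<^sub>M ?P) \<Otimes>\<^sub>M ?Y) ((?g3 \<circ> ?g2) \<circ> ?g1)"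
      by (rule distr_distr[OF measurable_comp[OF g2 g3] g1])
    finally show ?thesis by (simp add: comp_def)
  qed
  finally show ?thesis
    by (simp add: head_def coins_def[abs_def] proposals_def[abs_def] past_def[abs_def])
qed

text \<open>
  This identity drives every induction over time: the coins and proposals of the latest step and
  the noise of all earlier steps can be integrated one after the other.
\<close>

lemma nn_integral_noise_fields:
  fixes f :: "('i \<Rightarrow> real) \<Rightarrow> ('i \<Rightarrow> real \<times> real) \<Rightarrow> ('i \<Rightarrow> nat \<Rightarrow> real) \<Rightarrow> ennreal"
  assumes "L > 0"
    and f: "(\<lambda>((c, p), y). f c p y) \<in> borel_measurable
      ((iid unif01 \<Otimes>\<^sub>M iid (proposal_law L)) \<Otimes>\<^sub>M iid (noise_law L))"
  shows "(\<integral>\<^sup>+y. f (coins y) (proposals L y) (past y) \<partial>iid (noise_law L)) =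
    (\<integral>\<^sup>+c. \<integral>\<^sup>+p. \<integral>\<^sup>+y. f c p y \<partial>iid (noise_law L) \<partial>iid (proposal_law L) \<partial>iid unif01)"
proof -
  let ?C = "Pi\<^sub>M (UNIV::'i set) (\<lambda>_. unif01)" and ?P = "Pi\<^sub>M (UNIV::'i set) (\<lambda>_. proposal_law L)"
  let ?Y = "Pi\<^sub>M (UNIV::'i set) (\<lambda>_. noise_law L)"
  note f[measurable]
  interpret C: prob_space ?C by (intro prob_space_PiM prob_space_unif01)
  interpret P: prob_space ?P by (intro prob_space_PiM prob_space_proposal_law assms(1))
  interpret Y: prob_space ?Y by (intro prob_space_PiM prob_space_noise_law assms(1))
  have "(\<integral>\<^sup>+y. f (coins y) (proposals L y) (past y) \<partial>?Y) =
      (\<integral>\<^sup>+q. (\<lambda>((c, p), y). f c p y) q \<partial>distr ?Y ((?C \<Otimes>\<^sub>M ?P) \<Otimes>\<^sub>M ?Y) (\<lambda>y. ((coins y, proposals L y), past y)))"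
    using assms(1) by (subst nn_integral_distr) auto
  also have "\<dots> = (\<integral>\<^sup>+q. (\<lambda>((c, p), y). f c p y) q \<partial>((?C \<Otimes>\<^sub>M ?P) \<Otimes>\<^sub>M ?Y))"
    by (simp only: distr_noise_fields[OF assms(1)])
  also have "\<dots> = (\<integral>\<^sup>+q. \<integral>\<^sup>+y. (\<lambda>((c, p), y). f c p y) (q, y) \<partial>?Y \<partial>(?C \<Otimes>\<^sub>M ?P))"
    by (rule Y.nn_integral_fst[symmetric]) fact
  also have "\<dots> = (\<integral>\<^sup>+c. \<integral>\<^sup>+p. \<integral>\<^sup>+y. (\<lambda>((c, p), y). f c p y) ((c, p), y) \<partial>?Y \<partial>?P \<partial>?C)"
    by (rule P.nn_integral_fst[symmetric]) measurable
  finally show ?thesis by simp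
qed

section \<open>Local dynamics driven by the noise\<close>

definition local_field :: "real \<Rightarrow> (int ^ 'd \<Rightarrow> real) \<Rightarrow> int ^ 'd \<Rightarrow> real" where
  "local_field \<epsilon> x i = \<epsilon> / (2 * real CARD('d)) * (\<Sum>j\<in>nbrs i. x j)"

text \<open>
  A coin shows heads if it is at most \<open>1 / 2\<close>.
\<close>

definition active :: "(int ^ 'd \<Rightarrow> real) \<Rightarrow> (int ^ 'd) set" where
  "active c = {i. c i \<le> 1 / 2 \<and> (\<forall>j\<in>nbrs i. c j > 1 / 2)}"

lemma active_nbrs: "i \<in> active c \<Longrightarrow> j \<in> nbrs i \<Longrightarrow> j \<notin> active c"
  by (force simp: active_def)

lemma active_cong: "(\<And>j. j \<in> insert i (nbrs i) \<Longrightarrow> c j = c' j) \<Longrightarrow> i \<in> active c \<longleftrightarrow> i \<in> active c'"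
  by (auto simp: active_def)

lemma active_translate: "i \<in> active (\<lambda>j. c (j + v)) \<longleftrightarrow> i + v \<in> active c"
  by (simp add: active_def nbrs_translate)

lemma local_field_cong: "(\<And>j. j \<in> nbrs i \<Longrightarrow> x j = x' j) \<Longrightarrow> local_field \<epsilon> x i = local_field \<epsilon> x' i"
  by (simp add: local_field_def)

lemma local_field_translate: "local_field \<epsilon> (\<lambda>j. x (j + v)) i = local_field \<epsilon> x (i + v)"
  by (simp add: local_field_def nbrs_translate sum.reindex)

lemma nn_integral_indicator_Collect:
  assumes "Measurable.pred M P"
  shows "(\<integral>\<^sup>+x. indicator {x. P x} x \<partial>M) = emeasure M {x \<in> space M. P x}"
proof -
  have "(\<integral>\<^sup>+x. indicator {x. P x} x \<partial>M) = (\<integral>\<^sup>+x. indicator {x \<in> space M. P x} x \<partial>M)"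
    by (intro nn_integral_cong) (auto split: split_indicator)
  also have "\<dots> = emeasure M {x \<in> space M. P x}"
    using assms by (intro nn_integral_indicator) (simp add: pred_def)
  finally show ?thesis .
qed

text \<open>
  The first bound says that \<open>K\<close> dominates the interaction energy of one site, since
  \<open>nbrs 0\<close> has as many elements as any other neighbourhood. The second keeps the expected number
  of uncertain sites that one uncertain site can give rise to below one.
\<close>

locale small_coupling =
  fixes L \<epsilon> K :: real and dim :: "'d::finite itself"
  assumes L_pos: "L > 0"
    and coupling: "\<bar>\<epsilon>\<bar> / (2 * real CARD('d)) * real (card (nbrs (0 :: int ^ 'd))) * L\<^sup>2 \<le> K"
    and K_small: "4 * K * (real (card (nbrs (0 :: int ^ 'd))) + 1) \<le> 1"
begin

abbreviation configs :: "(int ^ 'd \<Rightarrow> real) measure" where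
  "configs \<equiv> config_space (spin_space L)"

abbreviation noise :: "(int ^ 'd \<Rightarrow> nat \<Rightarrow> real) measure" where
  "noise \<equiv> config_space (noise_law L)"

abbreviation coin_field :: "(int ^ 'd \<Rightarrow> real) measure" where
  "coin_field \<equiv> iid unif01"

abbreviation proposal_field :: "(int ^ 'd \<Rightarrow> real \<times> real) measure" where
  "proposal_field \<equiv> iid (proposal_law L)"

definition update :: "(int ^ 'd) set \<Rightarrow> (int ^ 'd \<Rightarrow> real \<times> real) \<Rightarrow> (int ^ 'd \<Rightarrow> real) \<Rightarrow> int ^ 'd \<Rightarrow> real" where
  "update A p x i =
     (if i \<in> A \<and> snd (p i) \<le> exp (local_field \<epsilon> x i * fst (p i) - K) then fst (p i) else x i)"

text \<open>
  The noise starts with the latest step, so a run of \<open>n\<close> steps ends at the present. Only sites in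
  \<open>V\<close> may move: \<open>V = UNIV\<close> is the dynamics of interest, and a finite \<open>V\<close> is used to compare
  it with stationary measures in \<open>V\<close>.
\<close>

primrec run :: "(int ^ 'd) set \<Rightarrow> nat \<Rightarrow> (int ^ 'd \<Rightarrow> nat \<Rightarrow> real) \<Rightarrow> (int ^ 'd \<Rightarrow> real) \<Rightarrow> int ^ 'd \<Rightarrow> real" where
  "run V 0 y x = x"
| "run V (Suc n) y x = update (active (coins y) \<inter> V) (proposals L y) (run V n (past y) x)"

text \<open>
  An upper bound, computed from the noise alone, on the set of sites where the value after \<open>n\<close>
  steps depends on the initial configuration. An active site with acceptance variable at most
  \<open>exp (- 2 * K)\<close> adopts its proposal under every configuration; otherwise its new value is a
  function of the old values at the site and its neighbours.
\<close>

primrec uncertain :: "nat \<Rightarrow> (int ^ 'd \<Rightarrow> nat \<Rightarrow> real) \<Rightarrow> (int ^ 'd) set" where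
  "uncertain 0 y = UNIV"
| "uncertain (Suc n) y = {i.
     if i \<in> active (coins y)
     then snd (proposals L y i) > exp (- 2 * K) \<and> insert i (nbrs i) \<inter> uncertain n (past y) \<noteq> {}
     else i \<in> uncertain n (past y)}"

lemma uncertain_Suc_iff:
  "i \<in> uncertain (Suc n) y \<longleftrightarrow>
    (if i \<in> active (coins y)
     then snd (proposals L y i) > exp (- 2 * K) \<and> (\<exists>j\<in>insert i (nbrs i). j \<in> uncertain n (past y))
     else i \<in> uncertain n (past y))"
  by auto

declare uncertain.simps(2) [simp del]

text \<open>
  Once a site is not uncertain, longer runs do not change its value, so this is the limit of runs
  started further and further in the past. If the site is uncertain at all times, which has
  probability zero, \<open>LEAST\<close> is an arbitrary number and the value still lies in \<open>[- L, L]\<close>.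
\<close>

definition factor :: "(int ^ 'd \<Rightarrow> nat \<Rightarrow> real) \<Rightarrow> int ^ 'd \<Rightarrow> real" where
  "factor y i = run UNIV (LEAST n. i \<notin> uncertain n y) y (\<lambda>_. 0) i"

lemma K_nonneg: "0 \<le> K"
proof -
  have "0 \<le> \<bar>\<epsilon>\<bar> / (2 * real CARD('d)) * real (card (nbrs (0 :: int ^ 'd))) * L\<^sup>2"
    by (intro mult_nonneg_nonneg divide_nonneg_nonneg) auto
  then show ?thesis using coupling by linarith
qed

lemma in_configs: "x \<in> space configs \<longleftrightarrow> (\<forall>i. x i \<in> {- L..L})"
  by (simp add: space_PiM PiE_iff)

lemma zero_in_configs: "(\<lambda>_. 0) \<in> space configs"
  using L_pos by (simp add: in_configs)

lemma proposals_in: "fst (proposals L y i) \<in> {- L..L}"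
  using clip_in[OF L_pos] by (simp add: proposals_def)

lemma local_field_bound:
  fixes x :: "int ^ 'd \<Rightarrow> real"
  assumes "x \<in> space configs" "s \<in> {- L..L}"
  shows "\<bar>local_field \<epsilon> x i * s\<bar> \<le> K"
proof -
  have "\<bar>\<Sum>j\<in>nbrs i. x j\<bar> \<le> (\<Sum>j\<in>nbrs i. L)"
    using assms by (intro order.trans[OF sum_abs] sum_mono) (auto simp: in_configs abs_le_iff minus_le_iff)
  then have sum: "\<bar>\<Sum>j\<in>nbrs i. x j\<bar> \<le> real (card (nbrs (0 :: int ^ 'd))) * L"
    by (simp add: card_nbrs[of i])
  have "\<bar>local_field \<epsilon> x i * s\<bar> = \<bar>\<epsilon>\<bar> / (2 * real CARD('d)) * (\<bar>\<Sum>j\<in>nbrs i. x j\<bar> * \<bar>s\<bar>)"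
    by (simp add: local_field_def abs_mult)
  also have "\<dots> \<le> \<bar>\<epsilon>\<bar> / (2 * real CARD('d)) * ((real (card (nbrs (0 :: int ^ 'd))) * L) * L)"
    using assms(2) sum L_pos by (intro mult_left_mono mult_mono) auto
  also have "\<dots> \<le> K"
    using coupling by (simp add: power2_eq_square mult.assoc)
  finally show ?thesis .
qed

lemma update_in_configs:
  assumes "x \<in> space configs" "\<And>i. fst (p i) \<in> {- L..L}" shows "update A p x \<in> space configs"
  using assms by (auto simp: in_configs update_def)

lemma run_in_configs: "x \<in> space configs \<Longrightarrow> run V n y x \<in> space configs"
  by (induction n arbitrary: y)
    (auto intro!: update_in_configs proposals_in simp del: atLeastAtMost_iff)

text \<open>
  Coalescence: outside the uncertain set neither the initial configuration nor the restriction of the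
  moves to \<open>V\<close> matters, because \<open>n\<close> steps carry information over a distance of at most \<open>n\<close>.
\<close>

lemma run_eq:
  assumes "i \<notin> uncertain n y" "x \<in> space configs" "x' \<in> space configs" "ball1 i n \<subseteq> V"
  shows "run V n y x i = run UNIV n y x' i"
  using assms
proof (induction n arbitrary: y i)
  case (Suc n)
  let ?z = "run V n (past y) x" and ?z' = "run UNIV n (past y) x'"
  have z: "?z \<in> space configs" "?z' \<in> space configs"
    using Suc.prems by (auto intro: run_in_configs)
  \<comment> \<open>Information travels one unit of distance per step.\<close>
  have ball: "ball1 j n \<subseteq> V" if "j \<in> insert i (nbrs i)" for j
    using ball1_subset_Suc[OF that, of n] Suc.prems(4) by blast
  have iV: "i \<in> V"
    using Suc.prems(4) self_in_ball1 by blast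
  show ?case
  proof (cases "i \<in> active (coins y)")
    case False
    then have "i \<notin> uncertain n (past y)" using Suc.prems(1) by (simp add: uncertain_Suc_iff)
    then have "?z i = ?z' i" using Suc.IH[of i "past y"] Suc.prems ball[of i] by blast
    with False show ?thesis by (simp add: update_def)
  next
    case True
    then consider "snd (proposals L y i) \<le> exp (- 2 * K)"
      | "\<And>j. j \<in> insert i (nbrs i) \<Longrightarrow> j \<notin> uncertain n (past y)"
      using Suc.prems(1) unfolding uncertain_Suc_iff by (meson not_less)
    then show ?thesis
    proof cases
      case 1
      have "- 2 * K \<le> local_field \<epsilon> w i * fst (proposals L y i) - K" if "w \<in> space configs" for w
        using local_field_bound[OF that proposals_in[of y i], of i] by (simp add: abs_le_iff)
      then have "snd (proposals L y i) \<le> exp (local_field \<epsilon> w i * fst (proposals L y i) - K)"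
        if "w \<in> space configs" for w
        using that 1 by (meson exp_le_cancel_iff order_trans)
      from this[OF z(1)] this[OF z(2)] show ?thesis
        using True iV by (simp add: update_def)
    next
      case 2
      have eq: "?z j = ?z' j" if "j \<in> insert i (nbrs i)" for j
        by (rule Suc.IH[OF 2[OF that] Suc.prems(2,3) ball[OF that]])
      then have "local_field \<epsilon> ?z i = local_field \<epsilon> ?z' i"
        by (intro local_field_cong) simp
      then show ?thesis
        using eq iV by (simp add: update_def)
    qed
  qed
qed simp

lemma uncertain_Suc: "uncertain (Suc n) y \<subseteq> uncertain n y"
proof (induction n arbitrary: y)
  case (Suc n)
  show ?case
  proof
    fix i assume "i \<in> uncertain (Suc (Suc n)) y"
    then show "i \<in> uncertain (Suc n) y"
      using Suc.IH[of "past y"] unfolding uncertain_Suc_iff[of i _ y]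
      by (cases "i \<in> active (coins y)") auto
  qed
qed simp

lemma run_Suc_start:
  assumes "x \<in> space configs"
  shows "\<exists>x'\<in>space configs. run V (Suc n) y x = run V n y x'"
proof (induction n arbitrary: y)
  case 0
  show ?case
    using assms by (auto intro!: bexI[of _ "run V (Suc 0) y x"] run_in_configs simp del: run.simps(2))
next
  case (Suc n)
  obtain x' where "x' \<in> space configs" "run V (Suc n) (past y) x = run V n (past y) x'"
    using Suc.IH by blast
  then show ?case
    by (intro bexI[of _ x']) simp_all
qed

text \<open>
  A longer run is a run of \<open>n\<close> steps from the configuration reached by its earlier part.
\<close>

lemma run_add_start:
  assumes "x \<in> space configs"
  shows "\<exists>x'\<in>space configs. run V (n + k) y x = run V n y x'"
  using assms
proof (induction k arbitrary: x)
  case (Suc k)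
  obtain x' where "x' \<in> space configs" "run V (n + Suc k) y x = run V (n + k) y x'"
    using run_Suc_start[OF Suc.prems, of V "n + k" y] by auto
  with Suc.IH[of x'] show ?case by auto
qed auto

lemma run_eq_factor:
  assumes "i \<notin> uncertain n y" "x \<in> space configs" "ball1 i n \<subseteq> V"
  shows "run V n y x i = factor y i"
proof -
  let ?m = "LEAST n. i \<notin> uncertain n y"
  have m: "i \<notin> uncertain ?m y" "?m \<le> n"
    using assms(1) by (rule LeastI, rule Least_le)
  obtain x' where x': "x' \<in> space configs" "run UNIV n y x = run UNIV ?m y x'"
    using run_add_start[OF assms(2), of UNIV ?m "n - ?m" y] m(2) by auto
  have "run V n y x i = run UNIV n y x i"
    using assms by (intro run_eq) auto
  also have "\<dots> = run UNIV ?m y x' i"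
    by (simp add: x'(2))
  also have "\<dots> = factor y i"
    unfolding factor_def using m(1) x'(1) zero_in_configs by (intro run_eq) auto
  finally show ?thesis .
qed

lemma factor_in_configs: "factor y \<in> space configs"
  using run_in_configs[OF zero_in_configs] unfolding in_configs factor_def by blast

lemma uncertain_cong:
  "(\<And>j. j \<in> ball1 i n \<Longrightarrow> y j = y' j) \<Longrightarrow> i \<in> uncertain n y \<longleftrightarrow> i \<in> uncertain n y'"
proof (induction n arbitrary: y y' i)
  case (Suc n)
  have *: "y j = y' j" if "j \<in> insert i (nbrs i)" for j
    using Suc.prems that nbrs_subset_ball1 by blast
  have "j \<in> uncertain n (past y) \<longleftrightarrow> j \<in> uncertain n (past y')" if "j \<in> insert i (nbrs i)" for j
    using ball1_subset_Suc[OF that, of n] Suc.prems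
    by (intro Suc.IH) (auto simp: past_def subset_iff)
  moreover have "i \<in> active (coins y) \<longleftrightarrow> i \<in> active (coins y')"
    using * by (intro active_cong) (simp add: coins_def)
  moreover have "proposals L y i = proposals L y' i"
    using * by (simp add: proposals_def)
  ultimately show ?case
    unfolding uncertain_Suc_iff by (metis insertI1)
qed simp

lemma run_cong:
  "(\<And>j. j \<in> ball1 i n \<Longrightarrow> y j = y' j) \<Longrightarrow> (\<And>j. j \<in> ball1 i n \<Longrightarrow> x j = x' j) \<Longrightarrow>
    run V n y x i = run V n y' x' i"
proof (induction n arbitrary: y y' i)
  case (Suc n)
  have *: "y j = y' j" if "j \<in> insert i (nbrs i)" for j
    using Suc.prems that nbrs_subset_ball1 by blast
  have "run V n (past y) x j = run V n (past y') x' j" if "j \<in> insert i (nbrs i)" for j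
    using ball1_subset_Suc[OF that, of n] Suc.prems
    by (intro Suc.IH) (auto simp: past_def subset_iff)
  moreover have "i \<in> active (coins y) \<longleftrightarrow> i \<in> active (coins y')"
    using * by (intro active_cong) (simp add: coins_def)
  moreover have "proposals L y i = proposals L y' i"
    using * by (simp add: proposals_def)
  moreover have "local_field \<epsilon> (run V n (past y) x) i = local_field \<epsilon> (run V n (past y') x') i"
    using calculation(1) by (intro local_field_cong) simp
  ultimately show ?case
    by (simp add: update_def)
qed simp

lemma noise_translate:
  "coins (translate v y) = (\<lambda>i. coins y (i + v))" "proposals L (translate v y) = (\<lambda>i. proposals L y (i + v))"
  "past (translate v y) = translate v (past y)"
  by (simp_all add: fun_eq_iff coins_def proposals_def past_def translate_def)

lemma uncertain_translate: "i \<in> uncertain n (translate v y) \<longleftrightarrow> i + v \<in> uncertain n y"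
proof (induction n arbitrary: y i)
  case (Suc n)
  have "(\<exists>j\<in>insert i (nbrs i). j \<in> uncertain n (past (translate v y))) \<longleftrightarrow>
      (\<exists>j\<in>insert (i + v) (nbrs (i + v)). j \<in> uncertain n (past y))"
    unfolding noise_translate nbrs_translate Suc.IH by simp
  then show ?case
    using Suc.IH unfolding uncertain_Suc_iff by (simp only: noise_translate active_translate)
qed simp

lemma run_translate: "run UNIV n (translate v y) (translate v x) = translate v (run UNIV n y x)"
proof (induction n arbitrary: y)
  case (Suc n)
  show ?case
    by (simp add: Suc.IH noise_translate fun_eq_iff update_def active_translate)
      (simp add: translate_def local_field_translate)
qed simp

lemma factor_translate: "factor (translate v y) = translate v (factor y)"
proof
  fix i
  have "translate v (\<lambda>_. 0) = (\<lambda>_ :: int ^ 'd. 0 :: real)"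
    by (simp add: translate_def)
  then show "factor (translate v y) i = translate v (factor y) i"
    unfolding factor_def uncertain_translate using run_translate[of _ v y "\<lambda>_. 0"]
    by (simp add: translate_def factor_def)
qed

section \<open>Measurability of the dynamics\<close>

lemma measurable_local_field [measurable (raw)]:
  fixes x :: "'w \<Rightarrow> int ^ 'd \<Rightarrow> real"
  assumes "x \<in> M \<rightarrow>\<^sub>M configs" shows "(\<lambda>w. local_field \<epsilon> (x w) i) \<in> borel_measurable M"
proof -
  have [measurable]: "(\<lambda>w. x w j) \<in> borel_measurable M" for j
    using measurable_compose[OF assms measurable_component_singleton[of j UNIV]]
    by (intro measurable_from_spin_space) simp
  show ?thesis unfolding local_field_def by measurable
qed

lemma pred_active [measurable]: "Measurable.pred coin_field (\<lambda>c. i \<in> active c)"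
proof -
  have [measurable]: "Measurable.pred coin_field (\<lambda>c. \<forall>j\<in>nbrs i. c j > 1 / 2)"
    by (intro pred_intros_finite) (simp, measurable)
  show ?thesis unfolding active_def by measurable
qed

lemma measurable_update:
  assumes A: "\<And>i. Measurable.pred M (\<lambda>w. i \<in> A w)"
    and p: "p \<in> M \<rightarrow>\<^sub>M proposal_field" and x: "x \<in> M \<rightarrow>\<^sub>M configs"
  shows "(\<lambda>w. update (A w) (p w) (x w)) \<in> M \<rightarrow>\<^sub>M configs"
proof (rule measurable_PiM_single')
  fix i :: "int ^ 'd"
  note [measurable] = A p x
  have pi: "(\<lambda>w. p w i) \<in> M \<rightarrow>\<^sub>M proposal_law L"
    by (rule measurable_compose[OF p]) simp
  have [measurable]: "(\<lambda>w. fst (p w i)) \<in> M \<rightarrow>\<^sub>M spin_space L" "(\<lambda>w. snd (p w i)) \<in> borel_measurable M"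
    by (rule measurable_compose[OF pi], measurable)+
  have [measurable]: "(\<lambda>w. x w i) \<in> M \<rightarrow>\<^sub>M spin_space L"
    by (rule measurable_compose[OF x]) simp
  show "(\<lambda>w. update (A w) (p w) (x w) i) \<in> M \<rightarrow>\<^sub>M spin_space L"
    unfolding update_def by measurable
next
  show "(\<lambda>w. update (A w) (p w) (x w)) \<in> space M \<rightarrow> (\<Pi>\<^sub>E i\<in>UNIV. space (spin_space L))"
  proof
    fix w assume w: "w \<in> space M"
    have "fst (p w i) \<in> {- L..L}" for i
      using measurable_space[OF p w] by (auto simp: space_PiM PiE_iff space_proposal_law mem_Times_iff)
    then show "update (A w) (p w) (x w) \<in> (\<Pi>\<^sub>E i\<in>UNIV. space (spin_space L))"
      using update_in_configs[OF measurable_space[OF x w], of "p w" "A w"] unfolding space_PiM by blast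
  qed
qed

lemma measurable_run [measurable (raw)]:
  assumes "y \<in> M \<rightarrow>\<^sub>M noise" "x \<in> M \<rightarrow>\<^sub>M configs"
  shows "(\<lambda>w. run V n (y w) (x w)) \<in> M \<rightarrow>\<^sub>M configs"
  using assms(1)
proof (induction n arbitrary: y)
  case (Suc n)
  note [measurable] = Suc.prems and [simp] = L_pos
  show ?case
    unfolding run.simps
  proof (rule measurable_update)
    fix i
    have [measurable]: "Measurable.pred M (\<lambda>w. i \<in> active (coins (y w)))"
      by (rule measurable_compose[OF _ pred_active]) measurable
    show "Measurable.pred M (\<lambda>w. i \<in> active (coins (y w)) \<inter> V)"
      by simp
    show "(\<lambda>w. run V n (past (y w)) (x w)) \<in> M \<rightarrow>\<^sub>M configs"
      by (rule Suc.IH) measurable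
  qed measurable
qed (use assms in simp)

lemma pred_uncertain [measurable]: "Measurable.pred noise (\<lambda>y. i \<in> uncertain n y)"
proof (induction n arbitrary: i)
  case (Suc n)
  note [simp] = L_pos
  have past: "Measurable.pred noise (\<lambda>y. j \<in> uncertain n (past y))" for j
    by (rule measurable_compose[OF _ Suc.IH]) measurable
  have [measurable]: "Measurable.pred noise (\<lambda>y. \<exists>j\<in>insert i (nbrs i). j \<in> uncertain n (past y))"
    by (intro pred_intros_finite past) simp
  have [measurable]: "Measurable.pred noise (\<lambda>y. i \<in> active (coins y))"
    by (rule measurable_compose[OF _ pred_active]) measurable
  have pi: "(\<lambda>y. proposals L y i) \<in> noise \<rightarrow>\<^sub>M proposal_law L"
    by (rule measurable_compose[OF measurable_noise_fields(2)[OF L_pos]]) simp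
  have [measurable]: "(\<lambda>y. snd (proposals L y i)) \<in> borel_measurable noise"
    by (rule measurable_compose[OF pi], measurable)
  note past[measurable]
  show ?case unfolding uncertain_Suc_iff by measurable
qed simp

lemma measurable_factor [measurable]: "factor \<in> noise \<rightarrow>\<^sub>M configs"
proof (rule measurable_PiM_single')
  fix i :: "int ^ 'd"
  have 1: "(\<lambda>y. run UNIV n y (\<lambda>_. 0) i) \<in> noise \<rightarrow>\<^sub>M spin_space L" for n
    by (rule measurable_compose[OF measurable_run]) (simp_all add: zero_in_configs)
  have 2: "(\<lambda>y. LEAST n. i \<notin> uncertain n y) \<in> noise \<rightarrow>\<^sub>M count_space UNIV"
    by measurable
  show "(\<lambda>y. factor y i) \<in> noise \<rightarrow>\<^sub>M spin_space L"
    unfolding factor_def using measurable_compose_countable[OF 1 2] .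
qed (use factor_in_configs in \<open>auto simp: space_PiM\<close>)

section \<open>Exponential loss of memory\<close>

lemma prob_space_noise: "prob_space noise"
  by (intro prob_space_PiM prob_space_noise_law L_pos)

text \<open>
  The probability of heads at a given site and tails at all its neighbours.
\<close>

definition activity :: real where
  "activity = (1 / 2) ^ Suc (card (nbrs (0 :: int ^ 'd)))"

definition rate :: real where
  "rate = 1 - activity / 2"

lemma activity_bounds: "0 < activity" "activity \<le> 1"
  unfolding activity_def by (simp, rule power_le_one) auto

lemma rate_bounds: "0 < rate" "rate < 1"
  using activity_bounds by (auto simp: rate_def)

lemma emeasure_active: "emeasure coin_field {c \<in> space coin_field. i \<in> active c} = ennreal activity"
proof -
  interpret U: prob_space unif01 by (rule prob_space_unif01)
  interpret PU: product_prob_space "\<lambda>_::int ^ 'd. unif01" UNIV by unfold_locales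
  let ?A = "\<lambda>j. if j = i then {..1 / 2} else {1 / 2 <..} :: real set"
  have "{c \<in> space coin_field. i \<in> active c} = {c \<in> space coin_field. \<forall>j\<in>insert i (nbrs i). c j \<in> ?A j}"
    unfolding active_def using not_self_nbrs[of i] by (auto simp del: not_self_nbrs)
  also have "emeasure coin_field \<dots> = (\<Prod>j\<in>insert i (nbrs i). emeasure unif01 (?A j))"
    by (rule PU.emeasure_PiM_Collect) auto
  also have "\<dots> = (\<Prod>j\<in>insert i (nbrs i). ennreal (1 / 2))"
    by (intro prod.cong refl) (auto simp: emeasure_unif01_atMost emeasure_unif01_greaterThan)
  also have "\<dots> = ennreal activity"
    by (subst prod_ennreal) (simp_all add: card_nbrs[of i] activity_def)
  finally show ?thesis .
qed

lemma emeasure_inactive: "emeasure coin_field {c \<in> space coin_field. i \<notin> active c} = ennreal (1 - activity)"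
proof -
  interpret C: prob_space coin_field by (intro prob_space_PiM prob_space_unif01)
  have "C.prob {c \<in> space coin_field. i \<in> active c} = activity"
    using emeasure_active[of i] activity_bounds by (simp add: measure_def)
  then have "C.prob {c \<in> space coin_field. i \<notin> active c} = 1 - activity"
    by (subst C.prob_neg) auto
  then show ?thesis
    by (simp add: C.emeasure_eq_measure)
qed

lemma emeasure_late_proposal:
  "emeasure proposal_field {p \<in> space proposal_field. snd (p i) > exp (- 2 * K)} = ennreal (1 - exp (- 2 * K))"
proof -
  interpret U: prob_space unif01 by (rule prob_space_unif01)
  interpret T: prob_space "trunc_gauss L" by (rule prob_space_trunc_gauss[OF L_pos])
  interpret Q: prob_space "proposal_law L" by (rule prob_space_proposal_law[OF L_pos])
  interpret PQ: product_prob_space "\<lambda>_::int ^ 'd. proposal_law L" UNIV by unfold_locales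
  have set: "space (trunc_gauss L) \<times> {exp (- 2 * K) <..} \<in> sets (proposal_law L)"
    unfolding proposal_law_def by (intro pair_measureI sets.top) simp
  have "{p \<in> space proposal_field. snd (p i) > exp (- 2 * K)} =
      {p \<in> space proposal_field. p i \<in> space (trunc_gauss L) \<times> {exp (- 2 * K) <..}}"
    by (auto simp: space_PiM PiE_iff space_proposal_law mem_Times_iff)
  also have "emeasure proposal_field \<dots> = emeasure (proposal_law L) (space (trunc_gauss L) \<times> {exp (- 2 * K) <..})"
    using set by (intro PQ.emeasure_PiM_Collect_single) auto
  also have "\<dots> = emeasure unif01 {exp (- 2 * K) <..}"
    unfolding proposal_law_def
    by (subst U.emeasure_pair_measure_Times)
      (use sets.top[of "trunc_gauss L"] in \<open>auto simp: T.emeasure_space_1 simp del: space_trunc_gauss\<close>)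
  also have "\<dots> = ennreal (1 - exp (- 2 * K))"
    using K_nonneg by (intro emeasure_unif01_greaterThan) auto
  finally show ?thesis .
qed

text \<open>
  A site is uncertain after a step if it was inactive and uncertain before, or if it was active, its
  acceptance variable exceeded \<open>exp (- 2 * K)\<close>, and it or one of its neighbours was uncertain
  before. The three sources of randomness are independent. With \<open>N\<close> neighbours the union bound
  gives the factor
  \<open>1 - activity + activity * (1 - exp (- 2 * K)) * (N + 1) \<le> 1 - activity / 2\<close> per step.
\<close>

lemma emeasure_uncertain: "emeasure noise {y \<in> space noise. i \<in> uncertain n y} \<le> ennreal (rate ^ n)"
proof (induction n arbitrary: i)
  case 0
  interpret prob_space noise by (rule prob_space_noise)
  show ?case by (simp add: emeasure_space_1)
next
  case (Suc n)
  let ?B = "insert i (nbrs i)"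
  define a b c d where "a = (\<lambda>c :: int ^ 'd \<Rightarrow> real. indicator {c. i \<notin> active c} c :: ennreal)"
    and "b = (\<lambda>c :: int ^ 'd \<Rightarrow> real. indicator {c. i \<in> active c} c :: ennreal)"
    and "c = (\<lambda>p :: int ^ 'd \<Rightarrow> real \<times> real. indicator {p. snd (p i) > exp (- 2 * K)} p :: ennreal)"
    and "d = (\<lambda>j y. indicator {y. j \<in> uncertain n y} y :: ennreal)"
  interpret C: prob_space coin_field by (intro prob_space_PiM prob_space_unif01)
  interpret P: prob_space proposal_field by (intro prob_space_PiM prob_space_proposal_law L_pos)
  interpret Y: prob_space noise by (rule prob_space_noise)
  have [measurable]: "a \<in> borel_measurable coin_field" "b \<in> borel_measurable coin_field"
    unfolding a_def b_def by measurable
  have pi: "(\<lambda>p. p i) \<in> proposal_field \<rightarrow>\<^sub>M proposal_law L"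
    by simp
  have "(\<lambda>p. snd (p i)) \<in> borel_measurable proposal_field"
    by (rule measurable_compose[OF pi], measurable)
  then have [measurable]: "c \<in> borel_measurable proposal_field"
    unfolding c_def by measurable
  have [measurable]: "d j \<in> borel_measurable noise" for j
    unfolding d_def by measurable
  have A: "(\<integral>\<^sup>+x. a x \<partial>coin_field) = ennreal (1 - activity)"
    unfolding a_def emeasure_inactive[of i, symmetric] by (rule nn_integral_indicator_Collect) measurable
  have B: "(\<integral>\<^sup>+x. b x \<partial>coin_field) = ennreal activity"
    unfolding b_def emeasure_active[of i, symmetric] by (rule nn_integral_indicator_Collect) measurable
  have C: "(\<integral>\<^sup>+x. c x \<partial>proposal_field) = ennreal (1 - exp (- 2 * K))"
    using \<open>(\<lambda>p. snd (p i)) \<in> borel_measurable proposal_field\<close>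
    unfolding c_def emeasure_late_proposal[of i, symmetric]
    by (intro nn_integral_indicator_Collect) measurable
  have D: "(\<integral>\<^sup>+y. d j y \<partial>noise) \<le> ennreal (rate ^ n)" for j
  proof -
    have "(\<integral>\<^sup>+y. d j y \<partial>noise) = emeasure noise {y \<in> space noise. j \<in> uncertain n y}"
      unfolding d_def by (rule nn_integral_indicator_Collect) measurable
    with Suc.IH show ?thesis by simp
  qed
  have D': "(\<integral>\<^sup>+y. (\<Sum>j\<in>?B. d j y) \<partial>noise) \<le> ennreal ((real (card (nbrs (0 :: int ^ 'd))) + 1) * rate ^ n)"
  proof -
    have "(\<integral>\<^sup>+y. (\<Sum>j\<in>?B. d j y) \<partial>noise) = (\<Sum>j\<in>?B. \<integral>\<^sup>+y. d j y \<partial>noise)"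
      by (intro nn_integral_sum) measurable
    also have "\<dots> \<le> (\<Sum>j\<in>?B. ennreal (rate ^ n))"
      by (intro sum_mono D)
    also have "\<dots> = ennreal (\<Sum>j\<in>?B. rate ^ n)"
      using rate_bounds by (intro sum_ennreal) simp
    also have "(\<Sum>j\<in>?B. rate ^ n) = (real (card (nbrs (0 :: int ^ 'd))) + 1) * rate ^ n"
      by (simp add: card_nbrs[of i])
    finally show ?thesis .
  qed
  have "emeasure noise {y \<in> space noise. i \<in> uncertain (Suc n) y} =
      (\<integral>\<^sup>+y. indicator {y \<in> space noise. i \<in> uncertain (Suc n) y} y \<partial>noise)"
    by (rule nn_integral_indicator[symmetric]) (simp only: pred_uncertain predE)
  also have "\<dots> \<le> (\<integral>\<^sup>+y. (\<lambda>u p y. a u * d i y + b u * (c p * (\<Sum>j\<in>?B. d j y)))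
      (coins y) (proposals L y) (past y) \<partial>noise)"
  proof (rule nn_integral_mono)
    fix y
    have 1: "1 \<le> (\<Sum>j\<in>?B. d j (past y))" if "k \<in> ?B" "k \<in> uncertain n (past y)" for k
    proof -
      have "d k (past y) \<le> (\<Sum>j\<in>?B. d j (past y))"
        using that(1) by (intro member_le_sum) auto
      then show ?thesis using that(2) by (simp add: d_def)
    qed
    show "indicator {y \<in> space noise. i \<in> uncertain (Suc n) y} y
        \<le> (\<lambda>u p y. a u * d i y + b u * (c p * (\<Sum>j\<in>?B. d j y))) (coins y) (proposals L y) (past y)"
    proof (cases "i \<in> uncertain (Suc n) y")
      case True
      show ?thesis
      proof (cases "i \<in> active (coins y)")
        case act: True
        with True obtain k where "k \<in> ?B" "k \<in> uncertain n (past y)" "snd (proposals L y i) > exp (- 2 * K)"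
          by (auto simp: uncertain_Suc_iff)
        with 1[of k] True act show ?thesis
          by (simp add: a_def b_def c_def split: split_indicator)
      next
        case False
        with True show ?thesis
          by (simp add: uncertain_Suc_iff a_def b_def c_def d_def split: split_indicator)
      qed
    qed simp
  qed
  also have "\<dots> = (\<integral>\<^sup>+u. \<integral>\<^sup>+p. \<integral>\<^sup>+y. a u * d i y + b u * (c p * (\<Sum>j\<in>?B. d j y)) \<partial>noise \<partial>proposal_field \<partial>coin_field)"
    by (rule nn_integral_noise_fields[OF L_pos]) (simp add: split_beta')
  also have "\<dots> = ennreal (1 - activity) * (\<integral>\<^sup>+y. d i y \<partial>noise) +
      ennreal activity * (ennreal (1 - exp (- 2 * K)) * (\<integral>\<^sup>+y. (\<Sum>j\<in>?B. d j y) \<partial>noise))"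
    by (simp add: nn_integral_add nn_integral_cmult nn_integral_multc A B C P.emeasure_space_1)
  also have "\<dots> \<le> ennreal (1 - activity) * ennreal (rate ^ n) +
      ennreal activity * (ennreal (1 - exp (- 2 * K)) * ennreal ((real (card (nbrs (0 :: int ^ 'd))) + 1) * rate ^ n))"
    by (intro add_mono mult_left_mono D D') auto
  also have "\<dots> = ennreal ((1 - activity) * rate ^ n +
      activity * ((1 - exp (- 2 * K)) * ((real (card (nbrs (0 :: int ^ 'd))) + 1) * rate ^ n)))"
    using rate_bounds activity_bounds K_nonneg by (simp add: ennreal_mult ennreal_plus)
  also have "\<dots> \<le> ennreal (rate ^ Suc n)"
  proof (rule ennreal_leI)
    let ?N = "real (card (nbrs (0 :: int ^ 'd))) + 1"
    have "1 - exp (- 2 * K) \<le> 2 * K"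
      using exp_ge_add_one_self[of "- 2 * K"] by simp
    then have "(1 - exp (- 2 * K)) * ?N \<le> 2 * K * ?N"
      by (intro mult_right_mono) auto
    also have "\<dots> \<le> 1 / 2"
      using K_small by simp
    finally have "activity * ((1 - exp (- 2 * K)) * ?N) \<le> activity * (1 / 2)"
      using activity_bounds by (intro mult_left_mono) auto
    then have "1 - activity + activity * ((1 - exp (- 2 * K)) * ?N) \<le> rate"
      by (simp add: rate_def)
    then have "(1 - activity + activity * ((1 - exp (- 2 * K)) * ?N)) * rate ^ n \<le> rate * rate ^ n"
      using rate_bounds by (intro mult_right_mono) auto
    then show "(1 - activity) * rate ^ n + activity * ((1 - exp (- 2 * K)) * (?N * rate ^ n)) \<le> rate ^ Suc n"
      by (simp add: algebra_simps)
  qed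
  finally show ?case .
qed

end

section \<open>Stationary measures\<close>

lemma ennreal_le_of_geometric_error:
  fixes a b :: ennreal
  assumes le: "\<And>n. a \<le> b + ennreal (c * r ^ n)" and r: "0 \<le> r" "r < 1"
  shows "a \<le> b"
proof (rule LIMSEQ_le_const)
  have "(\<lambda>n. c * r ^ n) \<longlonglongrightarrow> c * 0"
    using r by (intro tendsto_intros LIMSEQ_realpow_zero) auto
  then have "(\<lambda>n. b + ennreal (c * r ^ n)) \<longlonglongrightarrow> b + ennreal (c * 0)"
    by (intro tendsto_add tendsto_const tendsto_ennrealI)
  then show "(\<lambda>n. b + ennreal (c * r ^ n)) \<longlonglongrightarrow> b"
    by simp
qed (use le in auto)

lemma nn_integral_unif01_threshold:
  assumes "0 \<le> a" "a \<le> 1"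
  shows "(\<integral>\<^sup>+v. (if v \<le> a then A else B) \<partial>unif01) = ennreal a * A + ennreal (1 - a) * B"
proof -
  have "(\<integral>\<^sup>+v. (if v \<le> a then A else B) \<partial>unif01) =
      (\<integral>\<^sup>+v. A * indicator {..a} v + B * indicator {a<..} v \<partial>unif01)"
    by (intro nn_integral_cong) (auto split: split_indicator)
  also have "\<dots> = A * emeasure unif01 {..a} + B * emeasure unif01 {a<..}"
  proof -
    have [measurable]: "{..a} \<in> sets unif01" "{a<..} \<in> sets unif01" by simp_all
    have "(\<integral>\<^sup>+v. A * indicator {..a} v + B * indicator {a<..} v \<partial>unif01) =
        (\<integral>\<^sup>+v. A * indicator {..a} v \<partial>unif01) + (\<integral>\<^sup>+v. B * indicator {a<..} v \<partial>unif01)"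
      by (rule nn_integral_add) measurable
    then show ?thesis by (simp add: nn_integral_cmult_indicator)
  qed
  finally show ?thesis
    using assms by (simp add: emeasure_unif01_atMost emeasure_unif01_greaterThan mult.commute)
qed

context small_coupling
begin

definition field_weight :: "(int ^ 'd \<Rightarrow> real) \<Rightarrow> int ^ 'd \<Rightarrow> real \<Rightarrow> ennreal" where
  "field_weight x i s = ennreal (exp (local_field \<epsilon> x i * s))"

text \<open>
  The statement that \<open>X i\<close> has the conditional density proportional to \<open>field_weight X i\<close> given
  all other spins, multiplied by the normalizing constant. The constant does not depend on
  \<open>x i\<close>, and in this form no division occurs.
\<close>

definition balanced :: "(int ^ 'd \<Rightarrow> real) measure \<Rightarrow> int ^ 'd \<Rightarrow> bool" where
  "balanced \<mu> i \<longleftrightarrow> (\<forall>f\<in>borel_measurable configs.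
     (\<integral>\<^sup>+x. (\<integral>\<^sup>+s. field_weight x i s * f x \<partial>trunc_gauss L) \<partial>\<mu>) =
     (\<integral>\<^sup>+x. (\<integral>\<^sup>+s. field_weight x i s * f (x(i := s)) \<partial>trunc_gauss L) \<partial>\<mu>))"

lemma prob_space_trunc_gauss_L: "prob_space (trunc_gauss L)"
  by (rule prob_space_trunc_gauss[OF L_pos])

lemma measurable_site_update [measurable (raw)]:
  assumes "x \<in> M \<rightarrow>\<^sub>M configs" "s \<in> M \<rightarrow>\<^sub>M spin_space L"
  shows "(\<lambda>w. (x w)(i := s w)) \<in> M \<rightarrow>\<^sub>M configs"
  using assms by (intro measurable_fun_upd[where J=UNIV]) auto

lemma measurable_field_weight [measurable (raw)]:
  assumes [measurable]: "x \<in> M \<rightarrow>\<^sub>M configs" "s \<in> borel_measurable M"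
  shows "(\<lambda>w. field_weight (x w) i (s w)) \<in> borel_measurable M"
  unfolding field_weight_def by measurable

text \<open>
  Integrating out the acceptance variable leaves \<open>a * f (x(i := s)) + (1 - a) * f x\<close> with
  \<open>a = exp (- K) * field_weight x i s\<close>. By balance, the first term integrates to the same value as
  \<open>a * f x\<close>, and the two terms add up to \<open>f x\<close>.
\<close>

lemma single_update_preserves:
  assumes "prob_space \<mu>" and sets [measurable_cong]: "sets \<mu> = sets configs" and bal: "balanced \<mu> i"
    and f[measurable]: "f \<in> borel_measurable configs"
  shows "(\<integral>\<^sup>+x. (\<integral>\<^sup>+q. f (update {i} (\<lambda>_. q) x) \<partial>proposal_law L) \<partial>\<mu>) = (\<integral>\<^sup>+x. f x \<partial>\<mu>)"
proof -
  interpret mu: prob_space \<mu> by fact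
  interpret T: prob_space "trunc_gauss L" by (rule prob_space_trunc_gauss_L)
  interpret U: prob_space unif01 by (rule prob_space_unif01)
  have space: "space \<mu> = space configs" using sets by (rule sets_eq_imp_space_eq)
  define a where "a x s = exp (local_field \<epsilon> x i * s - K)" for x s
  \<comment> \<open>The acceptance probability; it is at most one because \<open>K\<close> bounds the energy.\<close>
  have a: "0 \<le> a x s" "a x s \<le> 1" if "x \<in> space configs" "s \<in> {- L..L}" for x s
    using local_field_bound[OF that, of i] by (auto simp: a_def)
  have a_weight: "ennreal (a x s) = ennreal (exp (- K)) * field_weight x i s" for x s
    by (simp add: a_def field_weight_def ennreal_mult[symmetric] exp_diff exp_minus field_simps)
  have [measurable]: "(\<lambda>w. a (g w) (h w)) \<in> borel_measurable M"
    if [measurable]: "g \<in> M \<rightarrow>\<^sub>M configs" "h \<in> borel_measurable M" for g h and M :: "'w measure"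
    unfolding a_def by measurable
  have meas_upd: "(\<lambda>q. f (update {i} (\<lambda>_. q) x)) \<in> borel_measurable (proposal_law L)"
    if x: "x \<in> space configs" for x
  proof (rule measurable_compose[OF measurable_update f])
    show "(\<lambda>q _. q) \<in> proposal_law L \<rightarrow>\<^sub>M proposal_field"
      by (rule measurable_PiM_single') (auto simp: space_PiM)
  qed (use x in auto)
  have inner: "(\<integral>\<^sup>+q. f (update {i} (\<lambda>_. q) x) \<partial>proposal_law L) =
      (\<integral>\<^sup>+s. ennreal (a x s) * f (x(i := s)) \<partial>trunc_gauss L) + (\<integral>\<^sup>+s. ennreal (1 - a x s) * f x \<partial>trunc_gauss L)"
    if x: "x \<in> space configs" for x
  proof -
    have [measurable]: "(\<lambda>s. f (x(i := s))) \<in> borel_measurable (trunc_gauss L)"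
      using x by (intro measurable_compose[OF measurable_site_update f]) auto
    have [measurable]: "(\<lambda>s. a x s) \<in> borel_measurable (trunc_gauss L)"
      using x by measurable
    have "(\<integral>\<^sup>+q. f (update {i} (\<lambda>_. q) x) \<partial>proposal_law L) =
        (\<integral>\<^sup>+s. \<integral>\<^sup>+v. f (update {i} (\<lambda>_. (s, v)) x) \<partial>unif01 \<partial>trunc_gauss L)"
      using meas_upd[OF x] unfolding proposal_law_def by (rule U.nn_integral_fst[symmetric])
    also have "\<dots> = (\<integral>\<^sup>+s. ennreal (a x s) * f (x(i := s)) + ennreal (1 - a x s) * f x \<partial>trunc_gauss L)"
    proof (rule nn_integral_cong)
      fix s assume "s \<in> space (trunc_gauss L)"
      then have s: "s \<in> {- L..L}" by simp
      have "update {i} (\<lambda>_. (s, v)) x = (if v \<le> a x s then x(i := s) else x)" for v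
        by (auto simp: update_def a_def fun_eq_iff)
      then have "(\<integral>\<^sup>+v. f (update {i} (\<lambda>_. (s, v)) x) \<partial>unif01) =
          (\<integral>\<^sup>+v. (if v \<le> a x s then f (x(i := s)) else f x) \<partial>unif01)"
        by (intro nn_integral_cong) simp
      then show "(\<integral>\<^sup>+v. f (update {i} (\<lambda>_. (s, v)) x) \<partial>unif01) =
          ennreal (a x s) * f (x(i := s)) + ennreal (1 - a x s) * f x"
        by (simp add: nn_integral_unif01_threshold[OF a[OF x s]])
    qed
    also have "\<dots> = (\<integral>\<^sup>+s. ennreal (a x s) * f (x(i := s)) \<partial>trunc_gauss L) +
        (\<integral>\<^sup>+s. ennreal (1 - a x s) * f x \<partial>trunc_gauss L)"
      by (rule nn_integral_add) measurable
    finally show ?thesis .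
  qed
  \<comment> \<open>Balance trades the proposal for the old spin.\<close>
  have move: "(\<integral>\<^sup>+x. \<integral>\<^sup>+s. ennreal (a x s) * f (x(i := s)) \<partial>trunc_gauss L \<partial>\<mu>) =
      (\<integral>\<^sup>+x. \<integral>\<^sup>+s. ennreal (a x s) * f x \<partial>trunc_gauss L \<partial>\<mu>)"
  proof -
    have "(\<integral>\<^sup>+x. \<integral>\<^sup>+s. ennreal (a x s) * f (g x s) \<partial>trunc_gauss L \<partial>\<mu>) =
        ennreal (exp (- K)) * (\<integral>\<^sup>+x. \<integral>\<^sup>+s. field_weight x i s * f (g x s) \<partial>trunc_gauss L \<partial>\<mu>)"
      if g[measurable]: "(\<lambda>(x, s). g x s) \<in> configs \<Otimes>\<^sub>M trunc_gauss L \<rightarrow>\<^sub>M configs" for g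
    proof -
      have [measurable]: "(\<lambda>(x, s). field_weight x i s * f (g x s)) \<in> borel_measurable (configs \<Otimes>\<^sub>M trunc_gauss L)"
        using measurable_compose[OF g f] by (simp add: split_beta')
      have "(\<integral>\<^sup>+x. \<integral>\<^sup>+s. ennreal (a x s) * f (g x s) \<partial>trunc_gauss L \<partial>\<mu>) =
          (\<integral>\<^sup>+x. ennreal (exp (- K)) * (\<integral>\<^sup>+s. field_weight x i s * f (g x s) \<partial>trunc_gauss L) \<partial>\<mu>)"
      proof (rule nn_integral_cong)
        fix x assume "x \<in> space \<mu>"
        then have [measurable]: "(\<lambda>s. field_weight x i s * f (g x s)) \<in> borel_measurable (trunc_gauss L)"
          using measurable_Pair2[of "\<lambda>(x, s). field_weight x i s * f (g x s)" configs "trunc_gauss L" borel x]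
          by (simp add: space)
        show "(\<integral>\<^sup>+s. ennreal (a x s) * f (g x s) \<partial>trunc_gauss L) =
            ennreal (exp (- K)) * (\<integral>\<^sup>+s. field_weight x i s * f (g x s) \<partial>trunc_gauss L)"
          by (subst nn_integral_cmult[symmetric]) (simp_all add: a_weight mult.assoc)
      qed
      also have "\<dots> = ennreal (exp (- K)) * (\<integral>\<^sup>+x. \<integral>\<^sup>+s. field_weight x i s * f (g x s) \<partial>trunc_gauss L \<partial>\<mu>)"
        by (rule nn_integral_cmult) measurable
      finally show ?thesis .
    qed
    note pull = this
    have "(\<lambda>(x, s). x(i := s)) \<in> configs \<Otimes>\<^sub>M trunc_gauss L \<rightarrow>\<^sub>M configs"
      "(\<lambda>(x, s). x) \<in> configs \<Otimes>\<^sub>M trunc_gauss L \<rightarrow>\<^sub>M configs"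
      by (simp_all add: split_beta')
    from pull[OF this(1)] pull[OF this(2)] show ?thesis
      using bal[unfolded balanced_def, rule_format, OF f] by simp
  qed
  have "(\<integral>\<^sup>+x. (\<integral>\<^sup>+q. f (update {i} (\<lambda>_. q) x) \<partial>proposal_law L) \<partial>\<mu>) =
      (\<integral>\<^sup>+x. (\<integral>\<^sup>+s. ennreal (a x s) * f (x(i := s)) \<partial>trunc_gauss L) +
        (\<integral>\<^sup>+s. ennreal (1 - a x s) * f x \<partial>trunc_gauss L) \<partial>\<mu>)"
    by (intro nn_integral_cong inner) (simp add: space)
  also have "\<dots> = (\<integral>\<^sup>+x. \<integral>\<^sup>+s. ennreal (a x s) * f (x(i := s)) \<partial>trunc_gauss L \<partial>\<mu>) +
      (\<integral>\<^sup>+x. \<integral>\<^sup>+s. ennreal (1 - a x s) * f x \<partial>trunc_gauss L \<partial>\<mu>)"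
    by (rule nn_integral_add) measurable
  also have "\<dots> = (\<integral>\<^sup>+x. \<integral>\<^sup>+s. ennreal (a x s) * f x \<partial>trunc_gauss L \<partial>\<mu>) +
      (\<integral>\<^sup>+x. \<integral>\<^sup>+s. ennreal (1 - a x s) * f x \<partial>trunc_gauss L \<partial>\<mu>)"
    by (simp only: move)
  also have "\<dots> = (\<integral>\<^sup>+x. (\<integral>\<^sup>+s. ennreal (a x s) * f x \<partial>trunc_gauss L) +
        (\<integral>\<^sup>+s. ennreal (1 - a x s) * f x \<partial>trunc_gauss L) \<partial>\<mu>)"
    by (rule nn_integral_add[symmetric]) measurable
  also have "\<dots> = (\<integral>\<^sup>+x. f x \<partial>\<mu>)"
  proof (rule nn_integral_cong)
    fix x assume x: "x \<in> space \<mu>"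
    have [measurable]: "(\<lambda>s. a x s) \<in> borel_measurable (trunc_gauss L)"
      using x by (simp add: space)
    have "(\<integral>\<^sup>+s. ennreal (a x s) * f x \<partial>trunc_gauss L) + (\<integral>\<^sup>+s. ennreal (1 - a x s) * f x \<partial>trunc_gauss L) =
        (\<integral>\<^sup>+s. ennreal (a x s) * f x + ennreal (1 - a x s) * f x \<partial>trunc_gauss L)"
      by (rule nn_integral_add[symmetric]) measurable
    also have "\<dots> = (\<integral>\<^sup>+s. f x \<partial>trunc_gauss L)"
    proof (rule nn_integral_cong)
      fix s assume "s \<in> space (trunc_gauss L)"
      then have "0 \<le> a x s" "a x s \<le> 1" using a[of x s] x by (simp_all add: space)
      then show "ennreal (a x s) * f x + ennreal (1 - a x s) * f x = f x"
        by (simp add: distrib_right[symmetric] ennreal_plus[symmetric] del: ennreal_plus)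
    qed
    finally show "(\<integral>\<^sup>+s. ennreal (a x s) * f x \<partial>trunc_gauss L) +
        (\<integral>\<^sup>+s. ennreal (1 - a x s) * f x \<partial>trunc_gauss L) = f x"
      by (simp add: T.emeasure_space_1 del: space_trunc_gauss)
  qed
  finally show ?thesis .
qed

text \<open>
  The move at \<open>i\<close> looks at its neighbours only, and these do not move together with \<open>i\<close>.
\<close>

lemma update_insert:
  assumes "i \<notin> A" "nbrs i \<inter> A = {}"
  shows "update (insert i A) p x = update {i} (\<lambda>_. p i) (update A p x)"
proof
  have "local_field \<epsilon> (update A p x) i = local_field \<epsilon> x i"
    using assms by (intro local_field_cong) (auto simp: update_def)
  then show "update (insert i A) p x k = update {i} (\<lambda>_. p i) (update A p x) k" for k
    using assms(1) by (cases "k = i") (simp_all add: update_def)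
qed

text \<open>
  Replacing one proposal by an independent copy does not change the law of the field of proposals.
  This isolates the randomness of a single site without splitting the index set.
\<close>

lemma nn_integral_proposal_resample:
  assumes [measurable]: "g \<in> borel_measurable proposal_field"
  shows "(\<integral>\<^sup>+p. g p \<partial>proposal_field) = (\<integral>\<^sup>+p. \<integral>\<^sup>+q. g (p(i := q)) \<partial>proposal_law L \<partial>proposal_field)"
proof -
  interpret Q: prob_space "proposal_law L" by (rule prob_space_proposal_law[OF L_pos])
  interpret P: prob_space proposal_field by (intro prob_space_PiM Q.prob_space_axioms)
  interpret QP: pair_sigma_finite "proposal_law L" proposal_field ..
  have upd[measurable]: "(\<lambda>(q, p). p(i := q)) \<in> proposal_law L \<Otimes>\<^sub>M proposal_field \<rightarrow>\<^sub>M proposal_field"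
    unfolding split_beta' by (intro measurable_fun_upd[where J=UNIV]) auto
  have "proposal_field = distr (proposal_law L \<Otimes>\<^sub>M proposal_field) proposal_field (\<lambda>(q, p). p(i := q))"
    using distr_pair_PiM_eq_PiM[of UNIV "\<lambda>_::int ^ 'd. proposal_law L" i] Q.prob_space_axioms by simp
  then have "(\<integral>\<^sup>+p. g p \<partial>proposal_field) =
      (\<integral>\<^sup>+p. g p \<partial>distr (proposal_law L \<Otimes>\<^sub>M proposal_field) proposal_field (\<lambda>(q, p). p(i := q)))"
    by simp
  also have "\<dots> = (\<integral>\<^sup>+w. g ((\<lambda>(q, p). p(i := q)) w) \<partial>(proposal_law L \<Otimes>\<^sub>M proposal_field))"
    by (rule nn_integral_distr) measurable
  also have "\<dots> = (\<integral>\<^sup>+p. \<integral>\<^sup>+q. g (p(i := q)) \<partial>proposal_law L \<partial>proposal_field)"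
    by (subst QP.nn_integral_snd[symmetric]) auto
  finally show ?thesis .
qed

text \<open>
  Simultaneous moves in an independent set are successive moves with independent proposals, each of
  which preserves \<open>\<mu>\<close>.
\<close>

lemma update_preserves:
  assumes "prob_space \<mu>" and sets [measurable_cong]: "sets \<mu> = sets configs"
    and "finite A" and "\<And>i. i \<in> A \<Longrightarrow> balanced \<mu> i" and "\<And>i. i \<in> A \<Longrightarrow> nbrs i \<inter> A = {}"
    and "f \<in> borel_measurable configs"
  shows "(\<integral>\<^sup>+p. \<integral>\<^sup>+x. f (update A p x) \<partial>\<mu> \<partial>proposal_field) = (\<integral>\<^sup>+x. f x \<partial>\<mu>)"
  using assms(3-6)
proof (induction A arbitrary: f)
  case empty
  interpret P: prob_space proposal_field by (intro prob_space_PiM prob_space_proposal_law L_pos)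
  have "update {} p x = x" for p x
    by (simp add: update_def fun_eq_iff)
  then show ?case
    by (simp add: P.emeasure_space_1)
next
  case (insert i A)
  interpret mu: prob_space \<mu> by fact
  interpret Q: prob_space "proposal_law L" by (rule prob_space_proposal_law[OF L_pos])
  interpret P: prob_space proposal_field by (intro prob_space_PiM Q.prob_space_axioms)
  interpret muQ: pair_sigma_finite \<mu> "proposal_law L" ..
  note f[measurable] = insert.prems(3)
  have ind: "i \<notin> A" "nbrs i \<inter> A = {}"
    using insert.hyps insert.prems(2)[of i] by auto
  have upd[measurable]: "(\<lambda>w. update B (p w) (x w)) \<in> M \<rightarrow>\<^sub>M configs"
    if "p \<in> M \<rightarrow>\<^sub>M proposal_field" "x \<in> M \<rightarrow>\<^sub>M configs" for B p x and M :: "'w measure"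
    using that by (intro measurable_update) auto
  have const[measurable]: "(\<lambda>w _. q w) \<in> M \<rightarrow>\<^sub>M proposal_field" if "q \<in> M \<rightarrow>\<^sub>M proposal_law L"
    for q and M :: "'w measure"
    using measurable_space[OF that] that by (intro measurable_PiM_single') auto
  have pi[measurable]: "(\<lambda>p. p i) \<in> proposal_field \<rightarrow>\<^sub>M proposal_law L"
    by simp
  define F where "F z = (\<integral>\<^sup>+q. f (update {i} (\<lambda>_. q) z) \<partial>proposal_law L)" for z
  have F[measurable]: "F \<in> borel_measurable configs"
    unfolding F_def by measurable
  have "(\<integral>\<^sup>+p. \<integral>\<^sup>+x. f (update (insert i A) p x) \<partial>\<mu> \<partial>proposal_field) =
      (\<integral>\<^sup>+p. \<integral>\<^sup>+q. (\<integral>\<^sup>+x. f (update (insert i A) (p(i := q)) x) \<partial>\<mu>) \<partial>proposal_law L \<partial>proposal_field)"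
    by (rule nn_integral_proposal_resample) measurable
  also have "\<dots> = (\<integral>\<^sup>+p. \<integral>\<^sup>+x. F (update A p x) \<partial>\<mu> \<partial>proposal_field)"
  proof (rule nn_integral_cong)
    fix p :: "int ^ 'd \<Rightarrow> real \<times> real" assume p: "p \<in> space proposal_field"
    have "update (insert i A) (p(i := q)) x = update {i} (\<lambda>_. q) (update A p x)" for q x
    proof -
      have "update A (p(i := q)) x = update A p x"
        using ind by (auto simp: update_def fun_eq_iff)
      then show ?thesis by (simp add: update_insert[OF ind])
    qed
    then have "(\<integral>\<^sup>+q. (\<integral>\<^sup>+x. f (update (insert i A) (p(i := q)) x) \<partial>\<mu>) \<partial>proposal_law L) =
        (\<integral>\<^sup>+q. (\<integral>\<^sup>+x. f (update {i} (\<lambda>_. q) (update A p x)) \<partial>\<mu>) \<partial>proposal_law L)"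
      by simp
    also have "\<dots> = (\<integral>\<^sup>+x. (\<integral>\<^sup>+q. f (update {i} (\<lambda>_. q) (update A p x)) \<partial>proposal_law L) \<partial>\<mu>)"
    proof (rule muQ.Fubini')
      show "(\<lambda>(x, q). f (update {i} (\<lambda>_. q) (update A p x))) \<in> borel_measurable (\<mu> \<Otimes>\<^sub>M proposal_law L)"
        using p unfolding split_beta' by measurable
    qed
    finally show "(\<integral>\<^sup>+q. (\<integral>\<^sup>+x. f (update (insert i A) (p(i := q)) x) \<partial>\<mu>) \<partial>proposal_law L) =
        (\<integral>\<^sup>+x. F (update A p x) \<partial>\<mu>)"
      by (simp only: F_def)
  qed
  also have "\<dots> = (\<integral>\<^sup>+x. F x \<partial>\<mu>)"
    using insert.prems(1,2) F by (intro insert.IH) auto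
  also have "\<dots> = (\<integral>\<^sup>+x. f x \<partial>\<mu>)"
    unfolding F_def using insert.prems(1) f by (intro single_update_preserves assms(1) sets) auto
  finally show ?case .
qed

text \<open>
  The coins are independent of the proposals, so they can be fixed first. They select an independent
  subset of \<open>V\<close>, to which the previous lemma applies.
\<close>

lemma run_preserves:
  assumes "prob_space \<mu>" and sets [measurable_cong]: "sets \<mu> = sets configs"
    and V: "finite V" and bal: "\<And>i. i \<in> V \<Longrightarrow> balanced \<mu> i"
    and "f \<in> borel_measurable configs"
  shows "(\<integral>\<^sup>+y. \<integral>\<^sup>+x. f (run V n y x) \<partial>\<mu> \<partial>noise) = (\<integral>\<^sup>+x. f x \<partial>\<mu>)"
  using assms(5)
proof (induction n arbitrary: f)
  case 0
  interpret Y: prob_space noise by (rule prob_space_noise)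
  show ?case by (simp add: Y.emeasure_space_1)
next
  case (Suc n)
  note f[measurable] = Suc.prems
  interpret mu: prob_space \<mu> by fact
  interpret C: prob_space coin_field by (intro prob_space_PiM prob_space_unif01)
  have [measurable]: "Measurable.pred M (\<lambda>w. i \<in> active (c w))"
    if "c \<in> M \<rightarrow>\<^sub>M coin_field" for c i and M :: "'w measure"
    by (rule measurable_compose[OF that pred_active])
  have upd[measurable]: "(\<lambda>w. update (active (c w) \<inter> V) (p w) (x w)) \<in> M \<rightarrow>\<^sub>M configs"
    if [measurable]: "c \<in> M \<rightarrow>\<^sub>M coin_field" "p \<in> M \<rightarrow>\<^sub>M proposal_field" "x \<in> M \<rightarrow>\<^sub>M configs"
    for c p x and M :: "'w measure"
    by (intro measurable_update) auto
  have "(\<integral>\<^sup>+y. \<integral>\<^sup>+x. f (run V (Suc n) y x) \<partial>\<mu> \<partial>noise) =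
      (\<integral>\<^sup>+c. \<integral>\<^sup>+p. \<integral>\<^sup>+y. (\<integral>\<^sup>+x. f (update (active c \<inter> V) p (run V n y x)) \<partial>\<mu>) \<partial>noise \<partial>proposal_field \<partial>coin_field)"
    unfolding run.simps
    by (rule nn_integral_noise_fields[OF L_pos,
          where f="\<lambda>c p y. \<integral>\<^sup>+x. f (update (active c \<inter> V) p (run V n y x)) \<partial>\<mu>"])
      (unfold split_beta', measurable)
  also have "\<dots> = (\<integral>\<^sup>+c. \<integral>\<^sup>+p. (\<integral>\<^sup>+x. f (update (active c \<inter> V) p x) \<partial>\<mu>) \<partial>proposal_field \<partial>coin_field)"
  proof (intro nn_integral_cong Suc.IH)
    fix c :: "int ^ 'd \<Rightarrow> real" and p :: "int ^ 'd \<Rightarrow> real \<times> real"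
    assume "c \<in> space coin_field" "p \<in> space proposal_field"
    then show "(\<lambda>x. f (update (active c \<inter> V) p x)) \<in> borel_measurable configs"
      by (intro measurable_compose[OF upd f]) auto
  qed
  also have "\<dots> = (\<integral>\<^sup>+c. (\<integral>\<^sup>+x. f x \<partial>\<mu>) \<partial>coin_field)"
    using V bal f by (intro nn_integral_cong update_preserves assms(1) sets) (auto dest: active_nbrs)
  finally show ?case
    by (simp add: C.emeasure_space_1)
qed

definition determined_on :: "(int ^ 'd) set \<Rightarrow> ((int ^ 'd \<Rightarrow> real) \<Rightarrow> 'b) \<Rightarrow> bool" where
  "determined_on \<Delta> f \<longleftrightarrow>
     (\<forall>x\<in>space configs. \<forall>x'\<in>space configs. (\<forall>i\<in>\<Delta>. x i = x' i) \<longrightarrow> f x = f x')"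

definition field_law :: "(int ^ 'd \<Rightarrow> real) measure" where
  "field_law = distr noise configs factor"

lemma sets_field_law [simp, measurable_cong]: "sets field_law = sets configs"
  by (simp add: field_law_def)

lemma prob_space_field_law: "prob_space field_law"
proof -
  interpret prob_space noise by (rule prob_space_noise)
  show ?thesis unfolding field_law_def by (rule prob_space_distr) measurable
qed

text \<open>
  Two fields built from the same noise that agree outside the uncertain set can only be distinguished
  through \<open>\<Delta>\<close> if some site of \<open>\<Delta>\<close> is uncertain.
\<close>

lemma coupling_bound:
  assumes G[measurable]: "G \<in> noise \<rightarrow>\<^sub>M configs" "G' \<in> noise \<rightarrow>\<^sub>M configs"
    and eq: "\<And>i y. i \<in> \<Delta> \<Longrightarrow> i \<notin> uncertain n y \<Longrightarrow> G y i = G' y i"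
    and \<Delta>: "finite \<Delta>" and f[measurable]: "f \<in> borel_measurable configs"
    and det: "determined_on \<Delta> f" and b: "\<And>x. x \<in> space configs \<Longrightarrow> f x \<le> ennreal b" "0 \<le> b"
  shows "(\<integral>\<^sup>+y. f (G y) \<partial>noise) \<le> (\<integral>\<^sup>+y. f (G' y) \<partial>noise) + ennreal (b * real (card \<Delta>) * rate ^ n)"
proof -
  have "f (G y) \<le> f (G' y) + (\<Sum>i\<in>\<Delta>. ennreal b * indicator {y. i \<in> uncertain n y} y)"
    if y: "y \<in> space noise" for y
  proof (cases "\<exists>i\<in>\<Delta>. i \<in> uncertain n y")
    case True
    then obtain k where k: "k \<in> \<Delta>" "k \<in> uncertain n y" by blast
    have "f (G y) \<le> ennreal b"
      by (intro b measurable_space[OF G(1) y])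
    also have "\<dots> = ennreal b * indicator {y. k \<in> uncertain n y} y"
      using k by simp
    also have "\<dots> \<le> (\<Sum>i\<in>\<Delta>. ennreal b * indicator {y. i \<in> uncertain n y} y)"
      using k \<Delta> by (intro member_le_sum) auto
    finally show ?thesis by (simp add: add_increasing)
  next
    case False
    then have "f (G y) = f (G' y)"
      using det measurable_space[OF G(1) y] measurable_space[OF G(2) y] eq
      unfolding determined_on_def by blast
    then show ?thesis by simp
  qed
  then have "(\<integral>\<^sup>+y. f (G y) \<partial>noise) \<le>
      (\<integral>\<^sup>+y. f (G' y) + (\<Sum>i\<in>\<Delta>. ennreal b * indicator {y. i \<in> uncertain n y} y) \<partial>noise)"
    by (rule nn_integral_mono)
  also have "\<dots> = (\<integral>\<^sup>+y. f (G' y) \<partial>noise) +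
      (\<Sum>i\<in>\<Delta>. ennreal b * (\<integral>\<^sup>+y. indicator {y. i \<in> uncertain n y} y \<partial>noise))"
    by (simp add: nn_integral_add nn_integral_sum nn_integral_cmult)
  also have "\<dots> \<le> (\<integral>\<^sup>+y. f (G' y) \<partial>noise) + (\<Sum>i\<in>\<Delta>. ennreal b * ennreal (rate ^ n))"
    by (intro add_left_mono sum_mono mult_left_mono)
      (simp_all add: nn_integral_indicator_Collect pred_uncertain emeasure_uncertain)
  also have "(\<Sum>i\<in>\<Delta>. ennreal b * ennreal (rate ^ n)) = ennreal (b * real (card \<Delta>) * rate ^ n)"
    using b rate_bounds by (simp add: ennreal_mult[symmetric] ennreal_of_nat_eq_real_of_nat mult_ac)
  finally show ?thesis .
qed

text \<open>
  By stationarity \<open>\<mu>\<close> is also the law of the configuration after \<open>n\<close> steps started from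
  \<open>\<mu>\<close>. Outside the uncertain set this configuration agrees with \<open>factor\<close> on \<open>\<Delta>\<close>, whatever the
  initial configuration was.
\<close>

lemma balanced_close_to_field_law:
  assumes "prob_space \<mu>" and sets [measurable_cong]: "sets \<mu> = sets configs"
    and V: "finite V" and bal: "\<And>i. i \<in> V \<Longrightarrow> balanced \<mu> i" and ball: "\<And>i. i \<in> \<Delta> \<Longrightarrow> ball1 i n \<subseteq> V"
    and \<Delta>: "finite \<Delta>" and f[measurable]: "f \<in> borel_measurable configs"
    and det: "determined_on \<Delta> f" and b: "\<And>x. x \<in> space configs \<Longrightarrow> f x \<le> ennreal b" "0 \<le> b"
  shows "(\<integral>\<^sup>+x. f x \<partial>\<mu>) \<le> (\<integral>\<^sup>+x. f x \<partial>field_law) + ennreal (b * real (card \<Delta>) * rate ^ n)" (is ?A)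
    and "(\<integral>\<^sup>+x. f x \<partial>field_law) \<le> (\<integral>\<^sup>+x. f x \<partial>\<mu>) + ennreal (b * real (card \<Delta>) * rate ^ n)" (is ?B)
proof -
  interpret mu: prob_space \<mu> by fact
  interpret Y: prob_space noise by (rule prob_space_noise)
  interpret muY: pair_sigma_finite \<mu> noise ..
  have space: "space \<mu> = space configs" using sets by (rule sets_eq_imp_space_eq)
  let ?e = "ennreal (b * real (card \<Delta>) * rate ^ n)"
  have law: "(\<integral>\<^sup>+x. f x \<partial>field_law) = (\<integral>\<^sup>+y. f (factor y) \<partial>noise)"
    unfolding field_law_def by (rule nn_integral_distr) measurable
  have "(\<integral>\<^sup>+x. f x \<partial>\<mu>) = (\<integral>\<^sup>+y. \<integral>\<^sup>+x. f (run V n y x) \<partial>\<mu> \<partial>noise)"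
    by (rule run_preserves[OF assms(1) sets V bal f, symmetric])
  also have "\<dots> = (\<integral>\<^sup>+x. \<integral>\<^sup>+y. f (run V n y x) \<partial>noise \<partial>\<mu>)"
    by (rule muY.Fubini') (simp add: split_beta')
  finally have mu: "(\<integral>\<^sup>+x. f x \<partial>\<mu>) = (\<integral>\<^sup>+x. \<integral>\<^sup>+y. f (run V n y x) \<partial>noise \<partial>\<mu>)" .
  have run: "(\<lambda>y. run V n y x) \<in> noise \<rightarrow>\<^sub>M configs" if "x \<in> space configs" for x
    using that by measurable
  have eq: "run V n y x i = factor y i" if "x \<in> space configs" "i \<in> \<Delta>" "i \<notin> uncertain n y" for x i y
    using that ball by (intro run_eq_factor) auto
  have "(\<integral>\<^sup>+x. f x \<partial>\<mu>) \<le> (\<integral>\<^sup>+x. (\<integral>\<^sup>+y. f (factor y) \<partial>noise) + ?e \<partial>\<mu>)"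
    unfolding mu using eq run
    by (intro nn_integral_mono coupling_bound[OF _ measurable_factor _ \<Delta> f det b]) (auto simp: space)
  then show ?A
    by (simp add: law mu.emeasure_space_1)
  have "(\<integral>\<^sup>+x. (\<integral>\<^sup>+y. f (factor y) \<partial>noise) \<partial>\<mu>) \<le> (\<integral>\<^sup>+x. (\<integral>\<^sup>+y. f (run V n y x) \<partial>noise) + ?e \<partial>\<mu>)"
    using eq run
    by (intro nn_integral_mono coupling_bound[OF measurable_factor _ _ \<Delta> f det b]) (auto simp: space)
  also have "\<dots> = (\<integral>\<^sup>+x. f x \<partial>\<mu>) + ?e"
    unfolding mu by (subst nn_integral_add) (auto simp: mu.emeasure_space_1)
  finally show ?B
    by (simp add: law mu.emeasure_space_1)
qed

abbreviation cylinder :: "(int ^ 'd) set \<Rightarrow> (int ^ 'd) set \<Rightarrow> (int ^ 'd \<Rightarrow> real set) \<Rightarrow> (int ^ 'd \<Rightarrow> real) set" where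
  "cylinder I J A \<equiv> prod_emb I (\<lambda>_. spin_space L) J (Pi\<^sub>E J A)"

lemma determined_on_cylinder:
  "determined_on J (indicator (cylinder UNIV J A) :: _ \<Rightarrow> ennreal)"
  unfolding determined_on_def
proof (intro ballI impI)
  fix x x' :: "int ^ 'd \<Rightarrow> real"
  assume x: "x \<in> space configs" "x' \<in> space configs" and "\<forall>i\<in>J. x i = x' i"
  then have "restrict x J = restrict x' J" by (auto simp: fun_eq_iff)
  with x have "x \<in> cylinder UNIV J A \<longleftrightarrow>
      x' \<in> cylinder UNIV J A"
    unfolding prod_emb_def space_PiM by simp
  then show "indicator (cylinder UNIV J A) x =
      (indicator (cylinder UNIV J A) x' :: ennreal)"
    by (simp add: indicator_def)
qed

lemma balanced_unique:
  assumes "prob_space \<mu>" and sets: "sets \<mu> = sets configs" and bal: "\<And>i. balanced \<mu> i"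
  shows "\<mu> = field_law"
proof (rule measure_eqI_PiM_infinite)
  interpret mu: prob_space \<mu> by fact
  show "finite_measure \<mu>" by unfold_locales
  fix A and J :: "(int ^ 'd) set"
  assume J: "finite J" "J \<subseteq> UNIV" and A: "\<And>i. i \<in> J \<Longrightarrow> A i \<in> sets (spin_space L)"
  let ?E = "cylinder UNIV J A"
  have E[measurable]: "?E \<in> sets configs"
    using J A by (intro sets_PiM_I) auto
  have V: "finite (\<Union>i\<in>J. ball1 i n)" and ball: "\<And>i. i \<in> J \<Longrightarrow> ball1 i n \<subseteq> (\<Union>i\<in>J. ball1 i n)" for n
    using J(1) by auto
  have f: "(indicator ?E :: _ \<Rightarrow> ennreal) \<in> borel_measurable configs"
    by measurable
  have b: "indicator ?E x \<le> ennreal 1" for x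
    by (simp add: indicator_def)
  note close = balanced_close_to_field_law[OF assms(1,2) V bal ball J(1) f determined_on_cylinder b zero_le_one]
  have 1: "(\<integral>\<^sup>+x. indicator ?E x \<partial>\<mu>) \<le> (\<integral>\<^sup>+x. indicator ?E x \<partial>field_law)"
    using rate_bounds by (intro ennreal_le_of_geometric_error[OF close(1)]) auto
  have 2: "(\<integral>\<^sup>+x. indicator ?E x \<partial>field_law) \<le> (\<integral>\<^sup>+x. indicator ?E x \<partial>\<mu>)"
    using rate_bounds by (intro ennreal_le_of_geometric_error[OF close(2)]) auto
  from 1 2 show "emeasure \<mu> ?E = emeasure field_law ?E"
    using E sets by (simp add: nn_integral_indicator)
qed (simp_all add: sets)

end

section \<open>Gibbs measures\<close>

lemma edges_meeting_mono: "\<Lambda> \<subseteq> V \<Longrightarrow> edges_meeting \<Lambda> \<subseteq> edges_meeting V"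
  by (auto simp: edges_meeting_eq)

lemma edges_meeting_disjoint: "e \<in> edges_meeting V \<Longrightarrow> e \<notin> edges_meeting \<Lambda> \<Longrightarrow> i \<in> e \<Longrightarrow> i \<notin> \<Lambda>"
  unfolding edges_meeting_def by blast

lemma edges_meeting_subset: "e \<in> edges_meeting \<Lambda> \<Longrightarrow> i \<in> e \<Longrightarrow> i \<in> (\<Union>j\<in>\<Lambda>. insert j (nbrs j))"
  by (auto simp: edges_meeting_eq)

lemma hamiltonian_cong:
  assumes "\<And>i. i \<in> (\<Union>j\<in>\<Lambda>. insert j (nbrs j)) \<Longrightarrow> x i = x' i"
  shows "hamiltonian \<epsilon> \<Lambda> x = hamiltonian \<epsilon> \<Lambda> x'"
proof -
  have "(\<Sum>i\<in>\<Lambda>. (x i)\<^sup>2) = (\<Sum>i\<in>\<Lambda>. (x' i)\<^sup>2)"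
  proof (intro sum.cong refl)
    fix i assume "i \<in> \<Lambda>"
    then have "x i = x' i" by (intro assms) blast
    then show "(x i)\<^sup>2 = (x' i)\<^sup>2" by simp
  qed
  moreover have "(\<Sum>e\<in>edges_meeting \<Lambda>. \<Prod>i\<in>e. x i) = (\<Sum>e\<in>edges_meeting \<Lambda>. \<Prod>i\<in>e. x' i)"
    using assms edges_meeting_subset by (intro sum.cong prod.cong refl) blast
  ultimately show ?thesis
    unfolding hamiltonian_def by simp
qed

text \<open>
  The terms of the larger Hamiltonian that are missing in the smaller one do not involve sites of
  \<open>\<Lambda>\<close>. This is the consistency of the specification.
\<close>

lemma hamiltonian_diff_cong:
  assumes fin: "finite V" and sub: "\<Lambda> \<subseteq> V" and eq: "\<And>i. i \<notin> \<Lambda> \<Longrightarrow> x i = x' i"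
  shows "hamiltonian \<epsilon> V x - hamiltonian \<epsilon> \<Lambda> x = hamiltonian \<epsilon> V x' - hamiltonian \<epsilon> \<Lambda> x'"
proof -
  have split: "hamiltonian \<epsilon> V z - hamiltonian \<epsilon> \<Lambda> z =
      1 / 2 * (\<Sum>i\<in>V - \<Lambda>. (z i)\<^sup>2) - \<epsilon> / (2 * real CARD('a)) *
        (\<Sum>e\<in>edges_meeting V - edges_meeting \<Lambda>. \<Prod>i\<in>e. z i)" for z :: "int ^ 'a \<Rightarrow> real"
    unfolding hamiltonian_def sum.subset_diff[OF sub fin]
      sum.subset_diff[OF edges_meeting_mono[OF sub] finite_edges_meeting[OF fin]]
    by (simp add: distrib_left)
  have "(\<Sum>i\<in>V - \<Lambda>. (x i)\<^sup>2) = (\<Sum>i\<in>V - \<Lambda>. (x' i)\<^sup>2)"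
    using eq by (intro sum.cong) auto
  moreover have "(\<Sum>e\<in>edges_meeting V - edges_meeting \<Lambda>. \<Prod>i\<in>e. x i) =
      (\<Sum>e\<in>edges_meeting V - edges_meeting \<Lambda>. \<Prod>i\<in>e. x' i)"
    using eq edges_meeting_disjoint by (intro sum.cong prod.cong refl) blast
  ultimately show ?thesis
    unfolding split by simp
qed

context small_coupling
begin

abbreviation spins :: "(int ^ 'd) set \<Rightarrow> (int ^ 'd \<Rightarrow> real) measure" where
  "spins \<Lambda> \<equiv> Pi\<^sub>M \<Lambda> (\<lambda>_. spin_space L)"

text \<open>
  The configuration that occurs in \<open>boltzmann\<close>: \<open>s\<close> inside \<open>\<Lambda>\<close> and \<open>x\<close> outside.
\<close>

definition paste :: "(int ^ 'd) set \<Rightarrow> (int ^ 'd \<Rightarrow> real) \<Rightarrow> (int ^ 'd \<Rightarrow> real) \<Rightarrow> int ^ 'd \<Rightarrow> real" where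
  "paste \<Lambda> s x = merge \<Lambda> (- \<Lambda>) (s, x)"

lemma paste_apply: "paste \<Lambda> s x i = (if i \<in> \<Lambda> then s i else x i)"
  by (simp add: paste_def merge_def)

lemma in_spins: "s \<in> space (spins \<Lambda>) \<longleftrightarrow> (\<forall>i\<in>\<Lambda>. s i \<in> {- L..L}) \<and> s \<in> extensional \<Lambda>"
  by (auto simp: space_PiM PiE_iff)

lemma paste_in_configs: "s \<in> space (spins \<Lambda>) \<Longrightarrow> x \<in> space configs \<Longrightarrow> paste \<Lambda> s x \<in> space configs"
  by (auto simp: in_configs in_spins paste_apply)

lemma paste_paste: "paste \<Lambda> s' (paste \<Lambda> s x) = paste \<Lambda> s' x"
  by (simp add: fun_eq_iff paste_apply)

lemma restrict_paste: "s \<in> space (spins \<Lambda>) \<Longrightarrow> restrict (paste \<Lambda> s x) \<Lambda> = s"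
  "restrict (paste \<Lambda> s x) (- \<Lambda>) = restrict x (- \<Lambda>)"
  by (auto simp: fun_eq_iff paste_apply in_spins extensional_def)

lemma boltzmann_eq:
  fixes \<Lambda> :: "(int ^ 'd) set"
  shows "boltzmann \<epsilon> \<Lambda> x s = ennreal (exp (- hamiltonian \<epsilon> \<Lambda> (paste \<Lambda> s x)))"
  by (simp add: boltzmann_def paste_def)

lemma boltzmann_paste: "boltzmann \<epsilon> \<Lambda> (paste \<Lambda> s x) s' = boltzmann \<epsilon> \<Lambda> x s'"
  by (simp add: boltzmann_eq paste_paste)

lemma boltzmann_restrict:
  fixes \<Lambda> :: "(int ^ 'd) set"
  shows "boltzmann \<epsilon> \<Lambda> (restrict x (- \<Lambda>)) s = boltzmann \<epsilon> \<Lambda> x s"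
proof -
  have "paste \<Lambda> s (restrict x (- \<Lambda>)) = paste \<Lambda> s x" by (auto simp: fun_eq_iff paste_apply)
  then show ?thesis by (simp add: boltzmann_eq)
qed

lemma measurable_paste [measurable (raw)]:
  assumes s: "s \<in> M \<rightarrow>\<^sub>M spins \<Lambda>" and x: "\<And>i. i \<notin> \<Lambda> \<Longrightarrow> (\<lambda>w. x w i) \<in> M \<rightarrow>\<^sub>M spin_space L"
  shows "(\<lambda>w. paste \<Lambda> (s w) (x w)) \<in> M \<rightarrow>\<^sub>M configs"
proof (rule measurable_PiM_single')
  have comp: "(\<lambda>w. paste \<Lambda> (s w) (x w) i) \<in> M \<rightarrow>\<^sub>M spin_space L" for i
    using x[of i] measurable_compose[OF s measurable_component_singleton[of i \<Lambda>]]
    by (cases "i \<in> \<Lambda>") (simp_all add: paste_apply)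
  then show "(\<lambda>w. paste \<Lambda> (s w) (x w) i) \<in> M \<rightarrow>\<^sub>M spin_space L" for i .
  show "(\<lambda>w. paste \<Lambda> (s w) (x w)) \<in> space M \<rightarrow> (\<Pi>\<^sub>E i\<in>UNIV. space (spin_space L))"
    using measurable_space[OF comp] by (auto simp: PiE_iff)
qed

lemma measurable_paste_configs:
  assumes s: "s \<in> M \<rightarrow>\<^sub>M spins \<Lambda>" and x: "x \<in> M \<rightarrow>\<^sub>M configs"
  shows "(\<lambda>w. paste \<Lambda> (s w) (x w)) \<in> M \<rightarrow>\<^sub>M configs"
  using s by (rule measurable_paste) (rule measurable_compose[OF x], simp)

lemma measurable_hamiltonian:
  assumes "finite \<Lambda>" shows "hamiltonian \<epsilon> \<Lambda> \<in> borel_measurable configs"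
proof -
  have [measurable]: "(\<lambda>x. x i) \<in> borel_measurable configs" for i :: "int ^ 'd"
    by (rule measurable_from_spin_space[of _ _ L]) simp
  show ?thesis
    unfolding hamiltonian_def by measurable
qed

lemma measurable_boltzmann:
  assumes "finite \<Lambda>" and s: "s \<in> M \<rightarrow>\<^sub>M spins \<Lambda>" and x: "\<And>i. i \<notin> \<Lambda> \<Longrightarrow> (\<lambda>w. x w i) \<in> M \<rightarrow>\<^sub>M spin_space L"
  shows "(\<lambda>w. boltzmann \<epsilon> \<Lambda> (x w) (s w)) \<in> borel_measurable M"
proof -
  have [measurable]: "(\<lambda>w. hamiltonian \<epsilon> \<Lambda> (paste \<Lambda> (s w) (x w))) \<in> borel_measurable M"
    by (rule measurable_compose[OF measurable_paste[OF s x] measurable_hamiltonian[OF assms(1)]])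
  show ?thesis
    unfolding boltzmann_eq by measurable
qed

lemma measurable_boltzmann_configs:
  assumes "finite \<Lambda>" and s: "s \<in> M \<rightarrow>\<^sub>M spins \<Lambda>" and x: "x \<in> M \<rightarrow>\<^sub>M configs"
  shows "(\<lambda>w. boltzmann \<epsilon> \<Lambda> (x w) (s w)) \<in> borel_measurable M"
  using assms(1) s by (rule measurable_boltzmann) (rule measurable_compose[OF x], simp)

lemma hamiltonian_bounded:
  assumes "finite \<Lambda>" obtains B where "\<And>x. x \<in> space configs \<Longrightarrow> \<bar>hamiltonian \<epsilon> \<Lambda> x\<bar> \<le> B"
proof
  fix x :: "int ^ 'd \<Rightarrow> real" assume x: "x \<in> space configs"
  have xi: "\<bar>x i\<bar> \<le> L" for i
    using x by (auto simp: in_configs abs_le_iff minus_le_iff)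
  have "\<bar>\<Sum>i\<in>\<Lambda>. (x i)\<^sup>2\<bar> \<le> (\<Sum>i\<in>\<Lambda>. L\<^sup>2)"
    using xi L_pos by (intro order.trans[OF sum_abs] sum_mono) (auto simp: abs_le_square_iff[symmetric])
  moreover have "\<bar>\<Sum>e\<in>edges_meeting \<Lambda>. \<Prod>i\<in>e. x i\<bar> \<le> (\<Sum>e\<in>edges_meeting \<Lambda>. max 1 L ^ card e)"
  proof (intro order.trans[OF sum_abs] sum_mono)
    fix e assume "e \<in> edges_meeting \<Lambda>"
    have "\<bar>\<Prod>i\<in>e. x i\<bar> = (\<Prod>i\<in>e. \<bar>x i\<bar>)" by (rule abs_prod)
    also have "\<dots> \<le> (\<Prod>i\<in>e. max 1 L)"
      using xi by (intro prod_mono) (auto intro: max.coboundedI2)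
    finally show "\<bar>\<Prod>i\<in>e. x i\<bar> \<le> max 1 L ^ card e" by simp
  qed
  ultimately show "\<bar>hamiltonian \<epsilon> \<Lambda> x\<bar> \<le> 1 / 2 * (\<Sum>i\<in>\<Lambda>. L\<^sup>2) +
      \<bar>\<epsilon> / (2 * real CARD('d))\<bar> * (\<Sum>e\<in>edges_meeting \<Lambda>. max 1 L ^ card e)"
    unfolding hamiltonian_def
    by (intro order.trans[OF abs_triangle_ineq4] add_mono) (auto simp: abs_mult intro!: mult_left_mono divide_right_mono)
qed

lemma finite_measure_spins: "finite \<Lambda> \<Longrightarrow> finite_measure (spins \<Lambda>)"
  and emeasure_spins_pos: "finite \<Lambda> \<Longrightarrow> emeasure (spins \<Lambda>) (space (spins \<Lambda>)) \<noteq> 0"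
proof -
  interpret S: finite_measure "spin_space L" by (rule finite_measure_spin_space)
  interpret P: product_sigma_finite "\<lambda>_::int ^ 'd. spin_space L" by unfold_locales
  have eq: "emeasure (spins \<Lambda>) (space (spins \<Lambda>)) = (\<Prod>i\<in>\<Lambda>. ennreal (2 * L))" if "finite \<Lambda>"
  proof -
    have "emeasure (spins \<Lambda>) (space (spins \<Lambda>)) = (\<Prod>i\<in>\<Lambda>. emeasure (spin_space L) (space (spin_space L)))"
      unfolding space_PiM by (rule P.emeasure_PiM[OF that sets.top])
    also have "emeasure (spin_space L) (space (spin_space L)) = ennreal (2 * L)"
      using L_pos by (simp add: spin_space_def emeasure_restrict_space space_restrict_space)
    finally show ?thesis .
  qed
  show "finite_measure (spins \<Lambda>)" if "finite \<Lambda>"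
    using eq[OF that] L_pos by (intro finite_measureI) (simp add: ennreal_power)
  show "emeasure (spins \<Lambda>) (space (spins \<Lambda>)) \<noteq> 0" if "finite \<Lambda>"
    unfolding eq[OF that] using L_pos that by (simp add: prod_zero_iff)
qed

definition partition_function :: "(int ^ 'd) set \<Rightarrow> (int ^ 'd \<Rightarrow> real) \<Rightarrow> ennreal" where
  "partition_function \<Lambda> x = (\<integral>\<^sup>+s. boltzmann \<epsilon> \<Lambda> x s \<partial>spins \<Lambda>)"

lemma partition_function_bounded:
  assumes "finite \<Lambda>"
  obtains b where "0 \<le> b" "\<And>x. x \<in> space configs \<Longrightarrow> partition_function \<Lambda> x \<le> ennreal b"
proof -
  interpret M: finite_measure "spins \<Lambda>" using assms by (rule finite_measure_spins)
  obtain B where B: "\<And>x. x \<in> space configs \<Longrightarrow> \<bar>hamiltonian \<epsilon> \<Lambda> x\<bar> \<le> B"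
    using hamiltonian_bounded[OF assms] by blast
  show ?thesis
  proof
    show "0 \<le> exp B * measure (spins \<Lambda>) (space (spins \<Lambda>))" by simp
    fix x assume x: "x \<in> space configs"
    have "partition_function \<Lambda> x \<le> (\<integral>\<^sup>+s. ennreal (exp B) \<partial>spins \<Lambda>)"
      unfolding partition_function_def
    proof (rule nn_integral_mono)
      fix s assume "s \<in> space (spins \<Lambda>)"
      with x have "\<bar>hamiltonian \<epsilon> \<Lambda> (paste \<Lambda> s x)\<bar> \<le> B" by (intro B paste_in_configs)
      then show "boltzmann \<epsilon> \<Lambda> x s \<le> ennreal (exp B)"
        unfolding boltzmann_eq by (intro ennreal_leI) simp
    qed
    also have "\<dots> = ennreal (exp B * measure (spins \<Lambda>) (space (spins \<Lambda>)))"
      by (simp add: M.emeasure_eq_measure ennreal_mult)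
    finally show "partition_function \<Lambda> x \<le> ennreal (exp B * measure (spins \<Lambda>) (space (spins \<Lambda>)))" .
  qed
qed

lemma partition_function_finite:
  assumes "finite \<Lambda>" "x \<in> space configs" shows "partition_function \<Lambda> x \<noteq> \<infinity>"
proof -
  obtain b where "partition_function \<Lambda> x \<le> ennreal b"
    using partition_function_bounded[OF assms(1)] assms(2) by blast
  then show ?thesis by (auto simp: top_unique)
qed

lemma partition_function_pos:
  assumes "finite \<Lambda>" "x \<in> space configs" shows "partition_function \<Lambda> x \<noteq> 0"
proof
  assume 0: "partition_function \<Lambda> x = 0"
  have "(\<lambda>s. boltzmann \<epsilon> \<Lambda> x s) \<in> borel_measurable (spins \<Lambda>)"
    using assms by (intro measurable_boltzmann) (auto simp: in_configs simp del: atLeastAtMost_iff)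
  with 0 have "AE s in spins \<Lambda>. boltzmann \<epsilon> \<Lambda> x s = 0"
    unfolding partition_function_def by (simp add: nn_integral_0_iff_AE)
  then have "AE s in spins \<Lambda>. False"
    by (simp add: boltzmann_eq)
  then show False
    using emeasure_spins_pos[OF assms(1)] by (simp add: AE_iff_null null_setsD1)
qed

lemma partition_function_paste: "partition_function \<Lambda> (paste \<Lambda> s x) = partition_function \<Lambda> x"
  by (simp add: partition_function_def boltzmann_paste)

lemma partition_function_restrict: "partition_function \<Lambda> (restrict x (- \<Lambda>)) = partition_function \<Lambda> x"
  by (simp add: partition_function_def boltzmann_restrict)

lemma measurable_boltzmann_integral:
  assumes \<Lambda>: "finite \<Lambda>" and A: "A \<in> sets (spins \<Lambda>)"
  shows "(\<lambda>x. \<integral>\<^sup>+s. boltzmann \<epsilon> \<Lambda> x s * indicator A s \<partial>spins \<Lambda>) \<in> borel_measurable (spins (- \<Lambda>))"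
proof -
  interpret M: finite_measure "spins \<Lambda>" using \<Lambda> by (rule finite_measure_spins)
  have [measurable]: "(\<lambda>w. boltzmann \<epsilon> \<Lambda> (fst w) (snd w)) \<in> borel_measurable (spins (- \<Lambda>) \<Otimes>\<^sub>M spins \<Lambda>)"
  proof (rule measurable_boltzmann[OF \<Lambda>])
    fix i assume "i \<notin> \<Lambda>"
    then have "(\<lambda>x. x i) \<in> spins (- \<Lambda>) \<rightarrow>\<^sub>M spin_space L" by simp
    then show "(\<lambda>w. fst w i) \<in> spins (- \<Lambda>) \<Otimes>\<^sub>M spins \<Lambda> \<rightarrow>\<^sub>M spin_space L"
      by (rule measurable_compose[OF measurable_fst])
  qed simp
  show ?thesis
    using A by (intro M.borel_measurable_nn_integral) (simp add: split_beta')
qed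

lemma measurable_partition_function:
  assumes \<Lambda>: "finite \<Lambda>" shows "partition_function \<Lambda> \<in> borel_measurable (spins (- \<Lambda>))"
proof -
  have "partition_function \<Lambda> x = (\<integral>\<^sup>+s. boltzmann \<epsilon> \<Lambda> x s * indicator (space (spins \<Lambda>)) s \<partial>spins \<Lambda>)" for x
    unfolding partition_function_def by (intro nn_integral_cong) simp
  then have "partition_function \<Lambda> =
      (\<lambda>x. \<integral>\<^sup>+s. boltzmann \<epsilon> \<Lambda> x s * indicator (space (spins \<Lambda>)) s \<partial>spins \<Lambda>)"
    by (rule ext)
  then show ?thesis
    using measurable_boltzmann_integral[OF \<Lambda> sets.top] by (simp only:)
qed

lemma measurable_partition_function_configs:
  assumes \<Lambda>: "finite \<Lambda>" shows "partition_function \<Lambda> \<in> borel_measurable configs"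
proof -
  have "(\<lambda>x. partition_function \<Lambda> (restrict x (- \<Lambda>))) \<in> borel_measurable configs"
    by (rule measurable_compose[OF measurable_restrict_subset measurable_partition_function[OF \<Lambda>]]) simp
  then show ?thesis by (simp only: partition_function_restrict)
qed

lemma emeasure_gibbs_specification:
  assumes \<Lambda>: "finite \<Lambda>" and x: "x \<in> space configs" and A: "A \<in> sets (spins \<Lambda>)"
  shows "emeasure (gibbs_specification \<epsilon> L \<Lambda> x) A =
    (\<integral>\<^sup>+s. boltzmann \<epsilon> \<Lambda> x s * indicator A s \<partial>spins \<Lambda>) / partition_function \<Lambda> x"
proof -
  note A[measurable]
  have [measurable]: "(\<lambda>s. boltzmann \<epsilon> \<Lambda> x s) \<in> borel_measurable (spins \<Lambda>)"
    using \<Lambda> x by (intro measurable_boltzmann) (auto simp: in_configs simp del: atLeastAtMost_iff)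
  have "emeasure (gibbs_specification \<epsilon> L \<Lambda> x) A =
      (\<integral>\<^sup>+s. boltzmann \<epsilon> \<Lambda> x s / partition_function \<Lambda> x * indicator A s \<partial>spins \<Lambda>)"
    unfolding gibbs_specification_def Let_def partition_function_def[symmetric]
    by (rule emeasure_density) measurable
  also have "\<dots> = (\<integral>\<^sup>+s. boltzmann \<epsilon> \<Lambda> x s * indicator A s / partition_function \<Lambda> x \<partial>spins \<Lambda>)"
    by (intro nn_integral_cong) (simp add: divide_ennreal_def mult_ac)
  also have "\<dots> = (\<integral>\<^sup>+s. boltzmann \<epsilon> \<Lambda> x s * indicator A s \<partial>spins \<Lambda>) / partition_function \<Lambda> x"
    by (rule nn_integral_divide) measurable
  finally show ?thesis .
qed

lemma prob_space_gibbs_specification: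
  assumes \<Lambda>: "finite \<Lambda>" and x: "x \<in> space configs"
  shows "prob_space (gibbs_specification \<epsilon> L \<Lambda> x)"
proof (rule prob_spaceI)
  have "space (gibbs_specification \<epsilon> L \<Lambda> x) = space (spins \<Lambda>)"
    by (simp add: gibbs_specification_def Let_def)
  then have "emeasure (gibbs_specification \<epsilon> L \<Lambda> x) (space (gibbs_specification \<epsilon> L \<Lambda> x)) =
      (\<integral>\<^sup>+s. boltzmann \<epsilon> \<Lambda> x s * indicator (space (spins \<Lambda>)) s \<partial>spins \<Lambda>) / partition_function \<Lambda> x"
    using emeasure_gibbs_specification[OF assms sets.top] by simp
  also have "(\<integral>\<^sup>+s. boltzmann \<epsilon> \<Lambda> x s * indicator (space (spins \<Lambda>)) s \<partial>spins \<Lambda>) = partition_function \<Lambda> x"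
    unfolding partition_function_def by (intro nn_integral_cong) simp
  also have "partition_function \<Lambda> x / partition_function \<Lambda> x = 1"
    using partition_function_finite[OF assms] partition_function_pos[OF assms]
    by (intro ennreal_divide_self) (auto simp: top.not_eq_extremum)
  finally show "emeasure (gibbs_specification \<epsilon> L \<Lambda> x) (space (gibbs_specification \<epsilon> L \<Lambda> x)) = 1" .
qed

abbreviation gibbs_sum ::
    "(int ^ 'd) set \<Rightarrow> ((int ^ 'd \<Rightarrow> real) \<Rightarrow> ennreal) \<Rightarrow> (int ^ 'd \<Rightarrow> real) \<Rightarrow> ennreal" where
  "gibbs_sum \<Lambda> f x \<equiv> \<integral>\<^sup>+s. boltzmann \<epsilon> \<Lambda> x s * f (paste \<Lambda> s x) \<partial>spins \<Lambda>"

text \<open>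
  The DLR equation for \<open>\<Lambda>\<close>, multiplied by the partition function as in \<open>balanced\<close>.
\<close>

definition dlr :: "(int ^ 'd \<Rightarrow> real) measure \<Rightarrow> (int ^ 'd) set \<Rightarrow> bool" where
  "dlr \<mu> \<Lambda> \<longleftrightarrow> (\<forall>f\<in>borel_measurable configs.
     (\<integral>\<^sup>+x. partition_function \<Lambda> x * f x \<partial>\<mu>) =
     (\<integral>\<^sup>+x. (gibbs_sum \<Lambda> f x) \<partial>\<mu>))"

lemma measurable_boltzmann_mult_paste:
  assumes \<Lambda>: "finite \<Lambda>" and f: "f \<in> borel_measurable configs"
  shows "(\<lambda>(x, s). boltzmann \<epsilon> \<Lambda> x s * f (paste \<Lambda> s x)) \<in> borel_measurable (configs \<Otimes>\<^sub>M spins \<Lambda>)"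
proof -
  have [measurable]: "(\<lambda>w. boltzmann \<epsilon> \<Lambda> (fst w) (snd w)) \<in> borel_measurable (configs \<Otimes>\<^sub>M spins \<Lambda>)"
    by (rule measurable_boltzmann_configs[OF \<Lambda>]) simp_all
  have [measurable]: "(\<lambda>w. f (paste \<Lambda> (snd w) (fst w))) \<in> borel_measurable (configs \<Otimes>\<^sub>M spins \<Lambda>)"
    by (rule measurable_compose[OF measurable_paste_configs f]) simp_all
  show ?thesis
    by (simp add: split_beta')
qed

lemma measurable_dlr_integral:
  assumes \<Lambda>: "finite \<Lambda>" and f: "f \<in> borel_measurable configs"
  shows "(\<lambda>x. gibbs_sum \<Lambda> f x) \<in> borel_measurable configs"
proof -
  interpret M: finite_measure "spins \<Lambda>" using \<Lambda> by (rule finite_measure_spins)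
  show ?thesis
    using measurable_boltzmann_mult_paste[OF assms] by (rule M.borel_measurable_nn_integral)
qed

text \<open>
  Both sides of the DLR equation are integrals of \<open>f\<close> against finite measures, and finite measures
  on the configuration space are determined by their values on cylinders.
\<close>

lemma dlr_from_cylinders:
  assumes "prob_space \<mu>" and sets [measurable_cong]: "sets \<mu> = sets configs" and \<Lambda>: "finite \<Lambda>"
    and cyl: "\<And>J A. finite J \<Longrightarrow> (\<And>i. i \<in> J \<Longrightarrow> A i \<in> sets (spin_space L)) \<Longrightarrow>
      (\<integral>\<^sup>+x. partition_function \<Lambda> x * indicator (cylinder UNIV J A) x \<partial>\<mu>) =
      (\<integral>\<^sup>+x. (gibbs_sum \<Lambda> (indicator (cylinder UNIV J A)) x) \<partial>\<mu>)"
  shows "dlr \<mu> \<Lambda>"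
proof -
  interpret mu: prob_space \<mu> by fact
  interpret M: finite_measure "spins \<Lambda>" using \<Lambda> by (rule finite_measure_spins)
  have space: "space \<mu> = space configs" using sets by (rule sets_eq_imp_space_eq)
  note [measurable] = measurable_partition_function_configs[OF \<Lambda>]
  have b[measurable]: "(\<lambda>(x, s). boltzmann \<epsilon> \<Lambda> x s) \<in> borel_measurable (\<mu> \<Otimes>\<^sub>M spins \<Lambda>)"
    using measurable_boltzmann_mult_paste[OF \<Lambda>, of "\<lambda>_. 1"] by (simp cong: measurable_cong_sets sets_pair_measure_cong)
  have p[measurable]: "(\<lambda>(x, s). paste \<Lambda> s x) \<in> \<mu> \<Otimes>\<^sub>M spins \<Lambda> \<rightarrow>\<^sub>M configs"
    unfolding split_beta' by (rule measurable_paste_configs) measurable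
  let ?m1 = "density \<mu> (partition_function \<Lambda>)"
  let ?m2 = "distr (density (\<mu> \<Otimes>\<^sub>M spins \<Lambda>) (\<lambda>(x, s). boltzmann \<epsilon> \<Lambda> x s)) configs (\<lambda>(x, s). paste \<Lambda> s x)"
  have m1: "(\<integral>\<^sup>+x. f x \<partial>?m1) = (\<integral>\<^sup>+x. partition_function \<Lambda> x * f x \<partial>\<mu>)"
    if [measurable]: "f \<in> borel_measurable configs" for f
    by (rule nn_integral_density) measurable
  have m2: "(\<integral>\<^sup>+x. f x \<partial>?m2) = (\<integral>\<^sup>+x. (gibbs_sum \<Lambda> f x) \<partial>\<mu>)"
    if f[measurable]: "f \<in> borel_measurable configs" for f
  proof -
    have fp[measurable]: "(\<lambda>w. f (paste \<Lambda> (snd w) (fst w))) \<in> borel_measurable (\<mu> \<Otimes>\<^sub>M spins \<Lambda>)"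
      using measurable_compose[OF p f] by (simp add: split_beta')
    have "(\<integral>\<^sup>+x. f x \<partial>?m2) =
        (\<integral>\<^sup>+w. f (paste \<Lambda> (snd w) (fst w)) \<partial>density (\<mu> \<Otimes>\<^sub>M spins \<Lambda>) (\<lambda>(x, s). boltzmann \<epsilon> \<Lambda> x s))"
      using p by (subst nn_integral_distr) (simp_all add: split_beta')
    also have "\<dots> = (\<integral>\<^sup>+w. boltzmann \<epsilon> \<Lambda> (fst w) (snd w) * f (paste \<Lambda> (snd w) (fst w)) \<partial>(\<mu> \<Otimes>\<^sub>M spins \<Lambda>))"
      using b by (subst nn_integral_density) (simp_all add: split_beta')
    also have "\<dots> = (\<integral>\<^sup>+x. (gibbs_sum \<Lambda> f x) \<partial>\<mu>)"
      using b by (subst M.nn_integral_fst[symmetric]) (simp_all add: split_beta')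
    finally show ?thesis .
  qed
  have eq: "?m1 = ?m2"
  proof (rule measure_eqI_PiM_infinite)
    obtain z where z: "\<And>x. x \<in> space configs \<Longrightarrow> partition_function \<Lambda> x \<le> ennreal z"
      using partition_function_bounded[OF \<Lambda>] by blast
    have "(\<integral>\<^sup>+x. 1 \<partial>?m1) \<le> (\<integral>\<^sup>+x. ennreal z \<partial>\<mu>)"
      unfolding m1[OF borel_measurable_const] using z by (intro nn_integral_mono) (simp add: space)
    then have "emeasure ?m1 (space ?m1) \<noteq> \<infinity>"
      by (auto simp: mu.emeasure_space_1 top_unique)
    then show "finite_measure ?m1"
      by (rule finite_measureI)
    fix A and J :: "(int ^ 'd) set"
    assume J: "finite J" "J \<subseteq> UNIV" and A: "\<And>i. i \<in> J \<Longrightarrow> A i \<in> sets (spin_space L)"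
    let ?E = "cylinder UNIV J A"
    have E: "?E \<in> sets configs"
      using J A by (intro sets_PiM_I) auto
    then have f: "(indicator ?E :: _ \<Rightarrow> ennreal) \<in> borel_measurable configs"
      by simp
    show "emeasure ?m1 ?E = emeasure ?m2 ?E"
      using m1[OF f] m2[OF f] cyl[OF J(1) A] E sets by (simp add: nn_integral_indicator)
  qed (simp_all add: sets)
  show ?thesis
    unfolding dlr_def
  proof
    fix f :: "(int ^ 'd \<Rightarrow> real) \<Rightarrow> ennreal" assume f: "f \<in> borel_measurable configs"
    have "(\<integral>\<^sup>+x. f x \<partial>?m1) = (\<integral>\<^sup>+x. f x \<partial>?m2)"
      by (simp only: eq)
    then show "(\<integral>\<^sup>+x. partition_function \<Lambda> x * f x \<partial>\<mu>) =
        (\<integral>\<^sup>+x. (gibbs_sum \<Lambda> f x) \<partial>\<mu>)"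
      by (simp only: m1[OF f] m2[OF f])
  qed
qed

text \<open>
  For a single site the Boltzmann weight is the Gaussian weight times the exponential tilt
  \<open>field_weight\<close>; the Gaussian weight is absorbed in the reference measure \<open>trunc_gauss L\<close>.
\<close>

lemma dlr_singleton_imp_balanced:
  assumes sets [measurable_cong]: "sets \<mu> = sets configs" and dlr: "dlr \<mu> {i}"
  shows "balanced \<mu> i"
  unfolding balanced_def
proof
  fix f :: "(int ^ 'd \<Rightarrow> real) \<Rightarrow> ennreal" assume f[measurable]: "f \<in> borel_measurable configs"
  interpret S: finite_measure "spin_space L" by (rule finite_measure_spin_space)
  interpret P: product_sigma_finite "\<lambda>_::int ^ 'd. spin_space L" by unfold_locales
  have space: "space \<mu> = space configs" using sets by (rule sets_eq_imp_space_eq)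
  have b: "boltzmann \<epsilon> {i} x s = gauss_weight (s i) * field_weight x i (s i)" for x s
  proof -
    have "local_field \<epsilon> (paste {i} s x) i = local_field \<epsilon> x i"
      by (intro local_field_cong) (auto simp: paste_apply)
    moreover have "hamiltonian \<epsilon> {i} z = (z i)\<^sup>2 / 2 - local_field \<epsilon> z i * z i" for z :: "int ^ 'd \<Rightarrow> real"
      unfolding hamiltonian_def sum_edges_meeting_singleton local_field_def by simp
    ultimately have "hamiltonian \<epsilon> {i} (paste {i} s x) = (s i)\<^sup>2 / 2 - local_field \<epsilon> x i * s i"
      by (simp add: paste_apply)
    then show ?thesis
      by (simp add: boltzmann_eq gauss_weight_def field_weight_def ennreal_mult[symmetric] exp_add[symmetric])
  qed
  have paste: "paste {i} s x = x(i := s i)" for s x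
    by (auto simp: fun_eq_iff paste_apply)
  have red: "(\<integral>\<^sup>+s. field_weight x i s * g s \<partial>trunc_gauss L) =
      (\<integral>\<^sup>+s. boltzmann \<epsilon> {i} x s * g (s i) \<partial>spins {i}) / gauss_mass L"
    if x: "x \<in> space configs" and g[measurable]: "g \<in> borel_measurable (spin_space L)" for x g
  proof -
    have [measurable]: "(\<lambda>s. field_weight x i s) \<in> borel_measurable (spin_space L)"
      using x by (intro measurable_field_weight) (auto simp: measurable_spin_space_real)
    have "(\<integral>\<^sup>+s. boltzmann \<epsilon> {i} x s * g (s i) \<partial>spins {i}) =
        (\<integral>\<^sup>+s. gauss_weight s * (field_weight x i s * g s) \<partial>spin_space L)"
      unfolding b mult.assoc by (rule P.product_nn_integral_singleton) measurable
    then show ?thesis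
      by (simp add: nn_integral_trunc_gauss)
  qed
  have [measurable]: "(\<lambda>x. \<integral>\<^sup>+s. boltzmann \<epsilon> {i} x s * f (paste {i} s x) \<partial>spins {i}) \<in> borel_measurable \<mu>"
    using measurable_dlr_integral[of "{i}", OF _ f] by simp
  note [measurable] = measurable_partition_function_configs[of "{i}"]
  have "(\<integral>\<^sup>+x. (\<integral>\<^sup>+s. field_weight x i s * f x \<partial>trunc_gauss L) \<partial>\<mu>) =
      (\<integral>\<^sup>+x. partition_function {i} x * f x / gauss_mass L \<partial>\<mu>)"
  proof (rule nn_integral_cong)
    fix x assume "x \<in> space \<mu>"
    then have x: "x \<in> space configs" by (simp add: space)
    have "(\<lambda>s. boltzmann \<epsilon> {i} x s) \<in> borel_measurable (spins {i})"
      using x by (intro measurable_boltzmann) (auto simp: in_configs simp del: atLeastAtMost_iff)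
    then show "(\<integral>\<^sup>+s. field_weight x i s * f x \<partial>trunc_gauss L) = partition_function {i} x * f x / gauss_mass L"
      using red[OF x, of "\<lambda>_. f x"] by (simp add: partition_function_def nn_integral_multc)
  qed
  also have "\<dots> = (\<integral>\<^sup>+x. partition_function {i} x * f x \<partial>\<mu>) / gauss_mass L"
    by (rule nn_integral_divide) measurable
  also have "\<dots> = (\<integral>\<^sup>+x. (\<integral>\<^sup>+s. boltzmann \<epsilon> {i} x s * f (paste {i} s x) \<partial>spins {i}) \<partial>\<mu>) / gauss_mass L"
    using dlr f unfolding dlr_def by simp
  also have "\<dots> = (\<integral>\<^sup>+x. (\<integral>\<^sup>+s. boltzmann \<epsilon> {i} x s * f (paste {i} s x) \<partial>spins {i}) / gauss_mass L \<partial>\<mu>)"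
    by (rule nn_integral_divide[symmetric]) measurable
  also have "\<dots> = (\<integral>\<^sup>+x. (\<integral>\<^sup>+s. field_weight x i s * f (x(i := s)) \<partial>trunc_gauss L) \<partial>\<mu>)"
  proof (rule nn_integral_cong)
    fix x assume "x \<in> space \<mu>"
    then have x: "x \<in> space configs" by (simp add: space)
    then have "(\<lambda>s. f (x(i := s))) \<in> borel_measurable (spin_space L)"
      by (intro measurable_compose[OF measurable_site_update f]) auto
    from red[OF x this] show "(\<integral>\<^sup>+s. boltzmann \<epsilon> {i} x s * f (paste {i} s x) \<partial>spins {i}) / gauss_mass L =
        (\<integral>\<^sup>+s. field_weight x i s * f (x(i := s)) \<partial>trunc_gauss L)"
      by (simp add: paste)
  qed
  finally show "(\<integral>\<^sup>+x. (\<integral>\<^sup>+s. field_weight x i s * f x \<partial>trunc_gauss L) \<partial>\<mu>) =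
      (\<integral>\<^sup>+x. (\<integral>\<^sup>+s. field_weight x i s * f (x(i := s)) \<partial>trunc_gauss L) \<partial>\<mu>)" .
qed

end

section \<open>Conditional laws\<close>

lemma ennreal_mult_divide_cancel: "c \<noteq> 0 \<Longrightarrow> c \<noteq> \<infinity> \<Longrightarrow> c * (a / c) = (a :: ennreal)"
  by (subst ennreal_times_divide, subst mult.commute, rule mult_divide_eq_ennreal) simp_all

lemma finite_measure_subalgebra_vimage:
  assumes "prob_space P" and Y: "Y \<in> P \<rightarrow>\<^sub>M K"
  shows "finite_measure_subalgebra P (vimage_algebra (space P) Y K)"
proof -
  interpret P: prob_space P by fact
  have "sets (vimage_algebra (space P) Y K) \<subseteq> sets P"
    using measurable_sets[OF Y] measurable_space[OF Y] by (subst sets_vimage_algebra2) auto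
  then show ?thesis
    by unfold_locales (simp add: subalgebra_def)
qed

text \<open>
  The conditional law is given event by event; since functions of \<open>Y\<close> pull out of conditional
  expectations, it also computes integrals weighted by such functions.
\<close>

lemma conditional_law_nn_integral:
  fixes g :: "'b \<Rightarrow> real"
  assumes "prob_space P" and X: "X \<in> P \<rightarrow>\<^sub>M N" and Y: "Y \<in> P \<rightarrow>\<^sub>M K"
    and law: "conditional_law P N X K Y \<kappa>" and A: "A \<in> sets N"
    and g: "g \<in> borel_measurable K" and g_bounds: "\<And>k. k \<in> space K \<Longrightarrow> 0 \<le> g k" "\<And>k. k \<in> space K \<Longrightarrow> g k \<le> b"
  shows "(\<integral>\<^sup>+\<omega>. ennreal (g (Y \<omega>)) * indicator A (X \<omega>) \<partial>P) =
    (\<integral>\<^sup>+\<omega>. ennreal (g (Y \<omega>) * measure (\<kappa> \<omega>) A) \<partial>P)"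
proof -
  let ?F = "vimage_algebra (space P) Y K"
  let ?I = "indicator (X -` A \<inter> space P) :: _ \<Rightarrow> real"
  interpret P: prob_space P by fact
  interpret F: finite_measure_subalgebra P ?F
    using assms(1) Y by (rule finite_measure_subalgebra_vimage)
  have XA: "X -` A \<inter> space P \<in> sets P"
    using X A by (rule measurable_sets)
  have Y_space: "Y \<omega> \<in> space K" if "\<omega> \<in> space P" for \<omega>
    using measurable_space[OF Y that] .
  have gY: "(\<lambda>\<omega>. g (Y \<omega>)) \<in> borel_measurable ?F"
    using Y_space by (intro measurable_compose[OF measurable_vimage_algebra1 g]) auto
  have gY'[measurable]: "(\<lambda>\<omega>. g (Y \<omega>)) \<in> borel_measurable P"
    by (rule measurable_compose[OF Y g])
  have I[measurable]: "?I \<in> borel_measurable P"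
    using XA by simp
  have int: "integrable P (\<lambda>\<omega>. g (Y \<omega>) * ?I \<omega>)"
  proof (rule P.integrable_const_bound[where B=b])
    show "AE \<omega> in P. norm (g (Y \<omega>) * ?I \<omega>) \<le> b"
      using g_bounds Y_space by (intro AE_I2) (force simp: indicator_def intro: order.trans)
  qed measurable
  note cond = F.real_cond_exp_intg[OF int gY I]
  have AE: "AE \<omega> in P. real_cond_exp P ?F ?I \<omega> = measure (\<kappa> \<omega>) A"
    using law A by (simp add: conditional_law_def)
  have "(\<integral>\<^sup>+\<omega>. ennreal (g (Y \<omega>)) * indicator A (X \<omega>) \<partial>P) = (\<integral>\<^sup>+\<omega>. ennreal (g (Y \<omega>) * ?I \<omega>) \<partial>P)"
    by (intro nn_integral_cong) (auto simp: indicator_def)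
  also have "\<dots> = ennreal (\<integral>\<omega>. g (Y \<omega>) * ?I \<omega> \<partial>P)"
    using int g_bounds Y_space by (intro nn_integral_eq_integral AE_I2) (auto simp: indicator_def)
  also have "(\<integral>\<omega>. g (Y \<omega>) * ?I \<omega> \<partial>P) = (\<integral>\<omega>. g (Y \<omega>) * real_cond_exp P ?F ?I \<omega> \<partial>P)"
    by (rule cond(2)[symmetric])
  also have "ennreal \<dots> = (\<integral>\<^sup>+\<omega>. ennreal (g (Y \<omega>) * real_cond_exp P ?F ?I \<omega>) \<partial>P)"
  proof (rule nn_integral_eq_integral[symmetric, OF cond(1)])
    show "AE \<omega> in P. 0 \<le> g (Y \<omega>) * real_cond_exp P ?F ?I \<omega>"
      using AE AE_space by eventually_elim (simp add: g_bounds Y_space)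
  qed
  also have "\<dots> = (\<integral>\<^sup>+\<omega>. ennreal (g (Y \<omega>) * measure (\<kappa> \<omega>) A) \<partial>P)"
    using AE by (intro nn_integral_cong_AE) auto
  finally show ?thesis .
qed

lemma conditional_lawI:
  assumes "prob_space P" and X: "X \<in> P \<rightarrow>\<^sub>M N" and Y: "Y \<in> P \<rightarrow>\<^sub>M K"
    and meas: "\<And>A. A \<in> sets N \<Longrightarrow> (\<lambda>\<omega>. measure (\<kappa> \<omega>) A) \<in> borel_measurable (vimage_algebra (space P) Y K)"
    and le_1: "\<And>\<omega> A. \<omega> \<in> space P \<Longrightarrow> A \<in> sets N \<Longrightarrow> measure (\<kappa> \<omega>) A \<le> 1"
    and eq: "\<And>A B. A \<in> sets N \<Longrightarrow> B \<in> sets K \<Longrightarrow>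
      (\<integral>\<^sup>+\<omega>. indicator A (X \<omega>) * indicator B (Y \<omega>) \<partial>P) =
      (\<integral>\<^sup>+\<omega>. ennreal (measure (\<kappa> \<omega>) A) * indicator B (Y \<omega>) \<partial>P)"
  shows "conditional_law P N X K Y \<kappa>"
  unfolding conditional_law_def
proof
  fix A assume A: "A \<in> sets N"
  let ?F = "vimage_algebra (space P) Y K"
  let ?I = "indicator (X -` A \<inter> space P) :: _ \<Rightarrow> real"
  interpret P: prob_space P by fact
  interpret F: finite_measure_subalgebra P ?F
    using assms(1) Y by (rule finite_measure_subalgebra_vimage)
  have XA: "X -` A \<inter> space P \<in> sets P"
    using X A by (rule measurable_sets)
  have kA[measurable]: "(\<lambda>\<omega>. measure (\<kappa> \<omega>) A) \<in> borel_measurable P"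
    using meas[OF A] F.subalg by (rule measurable_from_subalg[rotated])
  have I[measurable]: "?I \<in> borel_measurable P"
    using XA by simp
  have int_k: "integrable P (\<lambda>\<omega>. measure (\<kappa> \<omega>) A)"
    using le_1[OF _ A] by (intro P.integrable_const_bound[where B=1]) auto
  have int_I: "integrable P ?I"
    by (intro P.integrable_const_bound[where B=1]) auto
  show "AE \<omega> in P. real_cond_exp P ?F ?I \<omega> = measure (\<kappa> \<omega>) A"
  proof (rule F.real_cond_exp_charact[OF _ int_I int_k meas[OF A]])
    fix C assume "C \<in> sets ?F"
    then obtain B where B: "B \<in> sets K" "C = Y -` B \<inter> space P"
      using measurable_space[OF Y] by (subst (asm) sets_vimage_algebra2) auto
    have C[measurable]: "C \<in> sets P"
      unfolding B(2) by (rule measurable_sets[OF Y B(1)])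
    have "integrable P (\<lambda>\<omega>. indicator C \<omega> *\<^sub>R ?I \<omega>)"
      using C int_I by (rule integrable_mult_indicator)
    then have 1: "ennreal (\<integral>\<omega>\<in>C. ?I \<omega> \<partial>P) = (\<integral>\<^sup>+\<omega>. indicator A (X \<omega>) * indicator B (Y \<omega>) \<partial>P)"
      unfolding set_lebesgue_integral_def
      by (subst nn_integral_eq_integral[symmetric])
        (auto intro!: nn_integral_cong simp: B(2) indicator_def)
    have "integrable P (\<lambda>\<omega>. indicator C \<omega> *\<^sub>R measure (\<kappa> \<omega>) A)"
      using C int_k by (rule integrable_mult_indicator)
    then have 2: "ennreal (\<integral>\<omega>\<in>C. measure (\<kappa> \<omega>) A \<partial>P) =
        (\<integral>\<^sup>+\<omega>. ennreal (measure (\<kappa> \<omega>) A) * indicator B (Y \<omega>) \<partial>P)"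
      unfolding set_lebesgue_integral_def
      by (subst nn_integral_eq_integral[symmetric])
        (auto intro!: nn_integral_cong simp: B(2) indicator_def)
    have "0 \<le> (\<integral>\<omega>\<in>C. ?I \<omega> \<partial>P)" "0 \<le> (\<integral>\<omega>\<in>C. measure (\<kappa> \<omega>) A \<partial>P)"
      unfolding set_lebesgue_integral_def by (intro integral_nonneg_AE AE_I2; simp)+
    moreover have "ennreal (\<integral>\<omega>\<in>C. ?I \<omega> \<partial>P) = ennreal (\<integral>\<omega>\<in>C. measure (\<kappa> \<omega>) A \<partial>P)"
      unfolding 1 2 by (rule eq[OF A B(1)])
    ultimately show "(\<integral>\<omega>\<in>C. ?I \<omega> \<partial>P) = (\<integral>\<omega>\<in>C. measure (\<kappa> \<omega>) A \<partial>P)"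
      by simp
  qed
qed

context small_coupling
begin

lemma measurable_restrict_configs [measurable]: "(\<lambda>x. restrict x \<Lambda>) \<in> configs \<rightarrow>\<^sub>M spins \<Lambda>"
  by (rule measurable_restrict_subset) simp

lemma cylinder_sets:
  "finite J \<Longrightarrow> J \<subseteq> \<Lambda> \<Longrightarrow> (\<And>i. i \<in> J \<Longrightarrow> A i \<in> sets (spin_space L)) \<Longrightarrow>
    cylinder \<Lambda> J A \<in> sets (spins \<Lambda>)"
  by (rule sets_PiM_I) auto

lemma in_cylinder:
  "x \<in> cylinder \<Lambda> J A \<longleftrightarrow> x \<in> space (spins \<Lambda>) \<and> (\<forall>i\<in>J. x i \<in> A i)"
  by (auto simp: prod_emb_def space_PiM restrict_PiE_iff)

lemma restrict_in_spins: "x \<in> space configs \<Longrightarrow> restrict x \<Lambda> \<in> space (spins \<Lambda>)"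
  by (auto simp: in_configs in_spins)

text \<open>
  A cylinder is an event inside \<open>\<Lambda>\<close> intersected with an event outside. The partition function and
  the outer event only depend on the spins outside \<open>\<Lambda>\<close>, so they act as weights when the inner event
  is replaced by its conditional probability.
\<close>

lemma conditional_law_imp_dlr:
  assumes "prob_space \<mu>" and sets [measurable_cong]: "sets \<mu> = sets configs" and \<Lambda>: "finite \<Lambda>"
    and law: "conditional_law \<mu> (spins \<Lambda>) (\<lambda>x. restrict x \<Lambda>) (spins (- \<Lambda>)) (\<lambda>x. restrict x (- \<Lambda>))
      (gibbs_specification \<epsilon> L \<Lambda>)"
  shows "dlr \<mu> \<Lambda>"
proof (rule dlr_from_cylinders[OF assms(1) sets \<Lambda>])
  fix A and J :: "(int ^ 'd) set"
  assume J: "finite J" and A: "\<And>i. i \<in> J \<Longrightarrow> A i \<in> sets (spin_space L)"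
  have space: "space \<mu> = space configs" using sets by (rule sets_eq_imp_space_eq)
  let ?E = "cylinder UNIV J A"
  let ?E1 = "cylinder \<Lambda> (J \<inter> \<Lambda>) A"
  let ?E2 = "cylinder (- \<Lambda>) (J - \<Lambda>) A"
  have E1: "?E1 \<in> sets (spins \<Lambda>)" and E2: "?E2 \<in> sets (spins (- \<Lambda>))"
    using J A by (auto intro!: cylinder_sets)
  have split: "x \<in> ?E \<longleftrightarrow> restrict x \<Lambda> \<in> ?E1 \<and> restrict x (- \<Lambda>) \<in> ?E2" if "x \<in> space configs" for x
    using that restrict_in_spins[OF that] unfolding in_cylinder by auto
  obtain b where b: "0 \<le> b" "\<And>x. x \<in> space configs \<Longrightarrow> partition_function \<Lambda> x \<le> ennreal b"
    using partition_function_bounded[OF \<Lambda>] by blast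
  define g where "g k = enn2real (partition_function \<Lambda> k) * indicator ?E2 k" for k
  have g_meas: "g \<in> borel_measurable (spins (- \<Lambda>))"
    unfolding g_def using E2 measurable_partition_function[OF \<Lambda>] by measurable
  have g_le: "g k \<le> b" if k: "k \<in> space (spins (- \<Lambda>))" for k
  proof -
    have "paste \<Lambda> (\<lambda>_. 0) k \<in> space configs"
      using k L_pos by (auto simp: in_configs in_spins paste_apply)
    from b(2)[OF this] have "enn2real (partition_function \<Lambda> k) \<le> b"
      using b(1) by (simp add: partition_function_paste enn2real_leI)
    then show ?thesis using b(1) by (simp add: g_def indicator_def)
  qed
  have pf: "ennreal (enn2real (partition_function \<Lambda> x)) = partition_function \<Lambda> x" if "x \<in> space configs" for x
    using partition_function_finite[OF \<Lambda> that] by (simp add: top.not_eq_extremum)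
  have "(\<integral>\<^sup>+x. partition_function \<Lambda> x * indicator ?E x \<partial>\<mu>) =
      (\<integral>\<^sup>+x. ennreal (g (restrict x (- \<Lambda>))) * indicator ?E1 (restrict x \<Lambda>) \<partial>\<mu>)"
  proof (rule nn_integral_cong)
    fix x assume "x \<in> space \<mu>"
    then have x: "x \<in> space configs" by (simp add: space)
    show "partition_function \<Lambda> x * indicator ?E x = ennreal (g (restrict x (- \<Lambda>))) * indicator ?E1 (restrict x \<Lambda>)"
      using split[OF x] pf[OF x] by (auto simp: g_def partition_function_restrict indicator_def)
  qed
  also have "\<dots> = (\<integral>\<^sup>+x. ennreal (g (restrict x (- \<Lambda>)) * measure (gibbs_specification \<epsilon> L \<Lambda> x) ?E1) \<partial>\<mu>)"
    using g_le by (intro conditional_law_nn_integral[OF assms(1) _ _ law E1 g_meas, where b=b])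
      (simp_all add: g_def cong: measurable_cong_sets)
  also have "\<dots> = (\<integral>\<^sup>+x. (gibbs_sum \<Lambda> (indicator ?E) x) \<partial>\<mu>)"
  proof (rule nn_integral_cong)
    fix x assume "x \<in> space \<mu>"
    then have x: "x \<in> space configs" by (simp add: space)
    interpret G: prob_space "gibbs_specification \<epsilon> L \<Lambda> x"
      using \<Lambda> x by (rule prob_space_gibbs_specification)
    let ?I = "\<integral>\<^sup>+s. boltzmann \<epsilon> \<Lambda> x s * indicator ?E1 s \<partial>spins \<Lambda>"
    have "ennreal (g (restrict x (- \<Lambda>)) * measure (gibbs_specification \<epsilon> L \<Lambda> x) ?E1) =
        indicator ?E2 (restrict x (- \<Lambda>)) * (partition_function \<Lambda> x * emeasure (gibbs_specification \<epsilon> L \<Lambda> x) ?E1)"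
      using pf[OF x] by (simp add: g_def partition_function_restrict ennreal_mult G.emeasure_eq_measure indicator_def)
    also have "partition_function \<Lambda> x * emeasure (gibbs_specification \<epsilon> L \<Lambda> x) ?E1 = ?I"
      using partition_function_pos[OF \<Lambda> x] partition_function_finite[OF \<Lambda> x]
      unfolding emeasure_gibbs_specification[OF \<Lambda> x E1]
      by (intro ennreal_mult_divide_cancel) simp_all
    also have "indicator ?E2 (restrict x (- \<Lambda>)) * ?I =
        (gibbs_sum \<Lambda> (indicator ?E) x)"
    proof -
      have "indicator ?E (paste \<Lambda> s x) = (indicator ?E2 (restrict x (- \<Lambda>)) * indicator ?E1 s :: ennreal)"
        if s: "s \<in> space (spins \<Lambda>)" for s
        using split[OF paste_in_configs[OF s x]] unfolding restrict_paste(1)[OF s] restrict_paste(2)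
        by (auto simp: indicator_def)
      then have "(gibbs_sum \<Lambda> (indicator ?E) x) =
          (\<integral>\<^sup>+s. boltzmann \<epsilon> \<Lambda> x s * (indicator ?E2 (restrict x (- \<Lambda>)) * indicator ?E1 s) \<partial>spins \<Lambda>)"
        by (intro nn_integral_cong) simp
      then show ?thesis
        by (cases "restrict x (- \<Lambda>) \<in> ?E2") simp_all
    qed
    finally show "ennreal (g (restrict x (- \<Lambda>)) * measure (gibbs_specification \<epsilon> L \<Lambda> x) ?E1) =
        (gibbs_sum \<Lambda> (indicator ?E) x)" .
  qed
  finally show "(\<integral>\<^sup>+x. partition_function \<Lambda> x * indicator ?E x \<partial>\<mu>) =
      (\<integral>\<^sup>+x. (gibbs_sum \<Lambda> (indicator ?E) x) \<partial>\<mu>)" .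
qed

text \<open>
  The DLR equation is applied to the indicator of an inner and an outer event, divided by the
  partition function.
\<close>

lemma dlr_imp_conditional_law:
  assumes "prob_space \<mu>" and sets [measurable_cong]: "sets \<mu> = sets configs" and \<Lambda>: "finite \<Lambda>"
    and dlr: "dlr \<mu> \<Lambda>"
  shows "conditional_law \<mu> (spins \<Lambda>) (\<lambda>x. restrict x \<Lambda>) (spins (- \<Lambda>)) (\<lambda>x. restrict x (- \<Lambda>))
    (gibbs_specification \<epsilon> L \<Lambda>)"
proof (rule conditional_lawI[OF assms(1)])
  have space: "space \<mu> = space configs" using sets by (rule sets_eq_imp_space_eq)
  show "(\<lambda>x. restrict x \<Lambda>) \<in> \<mu> \<rightarrow>\<^sub>M spins \<Lambda>" and r: "(\<lambda>x. restrict x (- \<Lambda>)) \<in> \<mu> \<rightarrow>\<^sub>M spins (- \<Lambda>)"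
    by measurable
  fix A assume A: "A \<in> sets (spins \<Lambda>)"
  let ?I = "\<lambda>x. \<integral>\<^sup>+s. boltzmann \<epsilon> \<Lambda> x s * indicator A s \<partial>spins \<Lambda>"
  have gibbs: "emeasure (gibbs_specification \<epsilon> L \<Lambda> x) A = ?I x / partition_function \<Lambda> x"
    if "x \<in> space configs" for x
    using emeasure_gibbs_specification[OF \<Lambda> that A] .
  have "(\<lambda>k. enn2real (?I k / partition_function \<Lambda> k)) \<in> borel_measurable (spins (- \<Lambda>))"
    using measurable_boltzmann_integral[OF \<Lambda> A] measurable_partition_function[OF \<Lambda>] by measurable
  then have "(\<lambda>x. enn2real (?I (restrict x (- \<Lambda>)) / partition_function \<Lambda> (restrict x (- \<Lambda>)))) \<in>
      borel_measurable (vimage_algebra (space \<mu>) (\<lambda>x. restrict x (- \<Lambda>)) (spins (- \<Lambda>)))"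
    by (intro measurable_compose[OF measurable_vimage_algebra1]) (blast intro: measurable_space[OF r])
  then show "(\<lambda>x. measure (gibbs_specification \<epsilon> L \<Lambda> x) A) \<in>
      borel_measurable (vimage_algebra (space \<mu>) (\<lambda>x. restrict x (- \<Lambda>)) (spins (- \<Lambda>)))"
    by (rule measurable_cong[THEN iffD1, rotated])
      (simp add: space measure_def gibbs boltzmann_restrict partition_function_restrict)
  show "measure (gibbs_specification \<epsilon> L \<Lambda> x) A \<le> 1" if "x \<in> space \<mu>" for x
    using that by (intro prob_space.prob_le_1 prob_space_gibbs_specification[OF \<Lambda>]) (simp add: space)
  fix B assume B: "B \<in> sets (spins (- \<Lambda>))"
  define h where "h x = indicator A (restrict x \<Lambda>) * indicator B (restrict x (- \<Lambda>)) / partition_function \<Lambda> x"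
    for x
  have [measurable]: "(\<lambda>x. indicator A (restrict x \<Lambda>) :: ennreal) \<in> borel_measurable configs"
    "(\<lambda>x. indicator B (restrict x (- \<Lambda>)) :: ennreal) \<in> borel_measurable configs"
    using A B by (auto intro: measurable_compose[OF measurable_restrict_configs])
  note [measurable] = measurable_partition_function_configs[OF \<Lambda>]
  have h: "h \<in> borel_measurable configs"
    unfolding h_def by measurable
  have "(\<integral>\<^sup>+x. indicator A (restrict x \<Lambda>) * indicator B (restrict x (- \<Lambda>)) \<partial>\<mu>) =
      (\<integral>\<^sup>+x. partition_function \<Lambda> x * h x \<partial>\<mu>)"
    using partition_function_pos[OF \<Lambda>] partition_function_finite[OF \<Lambda>]
    by (intro nn_integral_cong) (simp add: h_def space ennreal_mult_divide_cancel)
  also have "\<dots> = (\<integral>\<^sup>+x. (gibbs_sum \<Lambda> h x) \<partial>\<mu>)"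
    using dlr h unfolding dlr_def by blast
  also have "\<dots> = (\<integral>\<^sup>+x. ennreal (measure (gibbs_specification \<epsilon> L \<Lambda> x) A) * indicator B (restrict x (- \<Lambda>)) \<partial>\<mu>)"
  proof (rule nn_integral_cong)
    fix x assume "x \<in> space \<mu>"
    then have x: "x \<in> space configs" by (simp add: space)
    interpret G: prob_space "gibbs_specification \<epsilon> L \<Lambda> x"
      using \<Lambda> x by (rule prob_space_gibbs_specification)
    have [measurable]: "(\<lambda>s. boltzmann \<epsilon> \<Lambda> x s) \<in> borel_measurable (spins \<Lambda>)"
      using \<Lambda> x by (intro measurable_boltzmann) (auto simp: in_configs simp del: atLeastAtMost_iff)
    note A[measurable]
    have "(gibbs_sum \<Lambda> h x) =
        (\<integral>\<^sup>+s. boltzmann \<epsilon> \<Lambda> x s * indicator A s * (indicator B (restrict x (- \<Lambda>)) / partition_function \<Lambda> x) \<partial>spins \<Lambda>)"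
      by (intro nn_integral_cong)
        (simp add: h_def restrict_paste partition_function_paste divide_ennreal_def mult_ac)
    also have "\<dots> = ?I x * (indicator B (restrict x (- \<Lambda>)) / partition_function \<Lambda> x)"
      by (rule nn_integral_multc) measurable
    also have "\<dots> = emeasure (gibbs_specification \<epsilon> L \<Lambda> x) A * indicator B (restrict x (- \<Lambda>))"
      unfolding gibbs[OF x] by (simp add: divide_ennreal_def mult_ac)
    finally show "(gibbs_sum \<Lambda> h x) =
        ennreal (measure (gibbs_specification \<epsilon> L \<Lambda> x) A) * indicator B (restrict x (- \<Lambda>))"
      by (simp add: G.emeasure_eq_measure)
  qed
  finally show "(\<integral>\<^sup>+x. indicator A (restrict x \<Lambda>) * indicator B (restrict x (- \<Lambda>)) \<partial>\<mu>) =
      (\<integral>\<^sup>+x. ennreal (measure (gibbs_specification \<epsilon> L \<Lambda> x) A) * indicator B (restrict x (- \<Lambda>)) \<partial>\<mu>)" .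
qed

section \<open>Existence and uniqueness of the Gibbs measure\<close>

text \<open>
  The Gibbs measure in \<open>V\<close> with all spins outside \<open>V\<close> frozen at zero.
\<close>

definition finite_volume :: "(int ^ 'd) set \<Rightarrow> (int ^ 'd \<Rightarrow> real) measure" where
  "finite_volume V = distr (gibbs_specification \<epsilon> L V (\<lambda>_. 0)) configs (\<lambda>s. paste V s (\<lambda>_. 0))"

lemma sets_finite_volume [simp, measurable_cong]: "sets (finite_volume V) = sets configs"
  by (simp add: finite_volume_def)

lemma sets_gibbs_specification [simp, measurable_cong]: "sets (gibbs_specification \<epsilon> L V x) = sets (spins V)"
  by (simp add: gibbs_specification_def Let_def)

lemma measurable_paste_zero [measurable]: "(\<lambda>s. paste V s (\<lambda>_. 0)) \<in> spins V \<rightarrow>\<^sub>M configs"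
  using zero_in_configs by (intro measurable_paste_configs) auto

lemma prob_space_finite_volume:
  assumes "finite V" shows "prob_space (finite_volume V)"
  unfolding finite_volume_def
  using prob_space_gibbs_specification[OF assms zero_in_configs]
  by (rule prob_space.prob_space_distr) measurable

lemma nn_integral_finite_volume:
  assumes V: "finite V" and f[measurable]: "f \<in> borel_measurable configs"
  shows "(\<integral>\<^sup>+x. f x \<partial>finite_volume V) =
    (\<integral>\<^sup>+s. boltzmann \<epsilon> V (\<lambda>_. 0) s * f (paste V s (\<lambda>_. 0)) \<partial>spins V) / partition_function V (\<lambda>_. 0)"
proof -
  have [measurable]: "(\<lambda>s. boltzmann \<epsilon> V (\<lambda>_. 0) s) \<in> borel_measurable (spins V)"
    using V zero_in_configs by (intro measurable_boltzmann_configs) auto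
  have "(\<integral>\<^sup>+x. f x \<partial>finite_volume V) = (\<integral>\<^sup>+s. f (paste V s (\<lambda>_. 0)) \<partial>gibbs_specification \<epsilon> L V (\<lambda>_. 0))"
    unfolding finite_volume_def by (rule nn_integral_distr) measurable
  also have "\<dots> = (\<integral>\<^sup>+s. boltzmann \<epsilon> V (\<lambda>_. 0) s / partition_function V (\<lambda>_. 0) * f (paste V s (\<lambda>_. 0)) \<partial>spins V)"
    unfolding gibbs_specification_def Let_def partition_function_def[symmetric]
    by (rule nn_integral_density) measurable
  also have "\<dots> = (\<integral>\<^sup>+s. boltzmann \<epsilon> V (\<lambda>_. 0) s * f (paste V s (\<lambda>_. 0)) / partition_function V (\<lambda>_. 0) \<partial>spins V)"
    by (intro nn_integral_cong) (simp add: divide_ennreal_def mult_ac)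
  also have "\<dots> = (\<integral>\<^sup>+s. boltzmann \<epsilon> V (\<lambda>_. 0) s * f (paste V s (\<lambda>_. 0)) \<partial>spins V) / partition_function V (\<lambda>_. 0)"
    by (rule nn_integral_divide) measurable
  finally show ?thesis .
qed

text \<open>
  By Fubini the spins in \<open>V - \<Lambda>\<close> are integrated last. For fixed such spins the weight of \<open>V\<close> is a
  constant times the weight of \<open>\<Lambda>\<close>, and both sides of the DLR equation become the product of the same
  two integrals over the spins in \<open>\<Lambda>\<close>.
\<close>

lemma dlr_finite_volume:
  assumes V: "finite V" and sub: "\<Lambda> \<subseteq> V"
  shows "dlr (finite_volume V) \<Lambda>"
  unfolding dlr_def
proof
  fix f :: "(int ^ 'd \<Rightarrow> real) \<Rightarrow> ennreal" assume f[measurable]: "f \<in> borel_measurable configs"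
  have \<Lambda>: "finite \<Lambda>" using V sub by (rule finite_subset[rotated])
  interpret S: finite_measure "spin_space L" by (rule finite_measure_spin_space)
  interpret P: product_sigma_finite "\<lambda>_::int ^ 'd. spin_space L" by unfold_locales
  \<comment> \<open>The spins in \<open>V - \<Lambda>\<close> on a zero background; the zeros in \<open>\<Lambda>\<close> are always pasted over.\<close>
  let ?z = "\<lambda>t. paste (V - \<Lambda>) t (\<lambda>_. 0)"
  let ?R = "\<lambda>t. ennreal (exp (- (hamiltonian \<epsilon> V (?z t) - hamiltonian \<epsilon> \<Lambda> (?z t))))"
  have fold: "(\<integral>\<^sup>+x. F x \<partial>finite_volume V) =
      (\<integral>\<^sup>+t. (\<integral>\<^sup>+s. ?R t * (boltzmann \<epsilon> \<Lambda> (?z t) s * F (paste \<Lambda> s (?z t))) \<partial>spins \<Lambda>) \<partial>spins (V - \<Lambda>))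
        / partition_function V (\<lambda>_. 0)"
    if F[measurable]: "F \<in> borel_measurable configs" for F
  proof -
    have [measurable]: "(\<lambda>s. boltzmann \<epsilon> V (\<lambda>_. 0) s) \<in> borel_measurable (spins V)"
      using V zero_in_configs by (intro measurable_boltzmann_configs) auto
    have un: "(V - \<Lambda>) \<union> \<Lambda> = V" "(V - \<Lambda>) \<inter> \<Lambda> = {}"
      using sub by auto
    have "(\<integral>\<^sup>+u. boltzmann \<epsilon> V (\<lambda>_. 0) u * F (paste V u (\<lambda>_. 0)) \<partial>spins V) =
        (\<integral>\<^sup>+t. (\<integral>\<^sup>+s. boltzmann \<epsilon> V (\<lambda>_. 0) (merge (V - \<Lambda>) \<Lambda> (t, s)) *
          F (paste V (merge (V - \<Lambda>) \<Lambda> (t, s)) (\<lambda>_. 0)) \<partial>spins \<Lambda>) \<partial>spins (V - \<Lambda>))"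
      using P.product_nn_integral_fold[OF un(2), of "\<lambda>u. boltzmann \<epsilon> V (\<lambda>_. 0) u * F (paste V u (\<lambda>_. 0))"] V \<Lambda>
      unfolding un(1) by simp
    also have "\<dots> = (\<integral>\<^sup>+t. (\<integral>\<^sup>+s. ?R t * (boltzmann \<epsilon> \<Lambda> (?z t) s * F (paste \<Lambda> s (?z t))) \<partial>spins \<Lambda>) \<partial>spins (V - \<Lambda>))"
    proof (intro nn_integral_cong)
      fix t s :: "int ^ 'd \<Rightarrow> real"
      have p: "paste V (merge (V - \<Lambda>) \<Lambda> (t, s)) (\<lambda>_. 0) = paste \<Lambda> s (?z t)"
        using sub by (auto simp: fun_eq_iff paste_apply merge_def)
      have "hamiltonian \<epsilon> V (paste \<Lambda> s (?z t)) - hamiltonian \<epsilon> \<Lambda> (paste \<Lambda> s (?z t)) =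
          hamiltonian \<epsilon> V (?z t) - hamiltonian \<epsilon> \<Lambda> (?z t)"
        by (rule hamiltonian_diff_cong[OF V sub]) (simp add: paste_apply)
      then have "- hamiltonian \<epsilon> V (paste \<Lambda> s (?z t)) =
          - (hamiltonian \<epsilon> V (?z t) - hamiltonian \<epsilon> \<Lambda> (?z t)) + - hamiltonian \<epsilon> \<Lambda> (paste \<Lambda> s (?z t))"
        by simp
      then have "boltzmann \<epsilon> V (\<lambda>_. 0) (merge (V - \<Lambda>) \<Lambda> (t, s)) = ?R t * boltzmann \<epsilon> \<Lambda> (?z t) s"
        unfolding boltzmann_eq p by (simp only: exp_add ennreal_mult exp_ge_zero)
      then show "boltzmann \<epsilon> V (\<lambda>_. 0) (merge (V - \<Lambda>) \<Lambda> (t, s)) * F (paste V (merge (V - \<Lambda>) \<Lambda> (t, s)) (\<lambda>_. 0)) =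
          ?R t * (boltzmann \<epsilon> \<Lambda> (?z t) s * F (paste \<Lambda> s (?z t)))"
        by (simp only: p mult.assoc)
    qed
    finally show ?thesis
      by (simp only: nn_integral_finite_volume[OF V F])
  qed
  let ?c = "\<lambda>x. gibbs_sum \<Lambda> f x"
  note [measurable] = measurable_partition_function_configs[OF \<Lambda>] measurable_dlr_integral[OF \<Lambda> f]
  have inner: "(\<integral>\<^sup>+s. ?R t * (boltzmann \<epsilon> \<Lambda> (?z t) s * (partition_function \<Lambda> (paste \<Lambda> s (?z t)) * f (paste \<Lambda> s (?z t)))) \<partial>spins \<Lambda>) =
      (\<integral>\<^sup>+s. ?R t * (boltzmann \<epsilon> \<Lambda> (?z t) s * ?c (paste \<Lambda> s (?z t))) \<partial>spins \<Lambda>)"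
    if t: "t \<in> space (spins (V - \<Lambda>))" for t
  proof -
    have z: "?z t \<in> space configs"
      using t zero_in_configs by (rule paste_in_configs)
    have b[measurable]: "(\<lambda>s. boltzmann \<epsilon> \<Lambda> (?z t) s) \<in> borel_measurable (spins \<Lambda>)"
      using \<Lambda> z by (intro measurable_boltzmann_configs) auto
    have [measurable]: "(\<lambda>s. f (paste \<Lambda> s (?z t))) \<in> borel_measurable (spins \<Lambda>)"
      using z by (intro measurable_compose[OF measurable_paste_configs f]) auto
    have "(\<integral>\<^sup>+s. ?R t * (boltzmann \<epsilon> \<Lambda> (?z t) s * (partition_function \<Lambda> (paste \<Lambda> s (?z t)) * f (paste \<Lambda> s (?z t)))) \<partial>spins \<Lambda>) =
        (\<integral>\<^sup>+s. (?R t * partition_function \<Lambda> (?z t)) * (boltzmann \<epsilon> \<Lambda> (?z t) s * f (paste \<Lambda> s (?z t))) \<partial>spins \<Lambda>)"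
      by (simp only: partition_function_paste mult_ac)
    also have "\<dots> = (?R t * partition_function \<Lambda> (?z t)) * ?c (?z t)"
      by (rule nn_integral_cmult) measurable
    also have "\<dots> = (\<integral>\<^sup>+s. (?R t * ?c (?z t)) * boltzmann \<epsilon> \<Lambda> (?z t) s \<partial>spins \<Lambda>)"
      by (subst nn_integral_cmult[OF b]) (simp only: partition_function_def mult_ac)
    also have "\<dots> = (\<integral>\<^sup>+s. ?R t * (boltzmann \<epsilon> \<Lambda> (?z t) s * ?c (paste \<Lambda> s (?z t))) \<partial>spins \<Lambda>)"
      by (simp only: boltzmann_paste paste_paste mult_ac)
    finally show ?thesis .
  qed
  show "(\<integral>\<^sup>+x. partition_function \<Lambda> x * f x \<partial>finite_volume V) = (\<integral>\<^sup>+x. ?c x \<partial>finite_volume V)"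
    by (subst fold, measurable, subst fold, measurable)
      (intro arg_cong2[where f="(/)"] refl nn_integral_cong inner)
qed

text \<open>
  For a cylinder, both sides of the DLR equation are integrals of bounded functions of finitely many
  spins. They agree for the finite-volume measures, which approximate \<open>field_law\<close> on every finite set
  of sites as the volume grows.
\<close>

lemma dlr_field_law:
  assumes \<Lambda>: "finite \<Lambda>" shows "dlr field_law \<Lambda>"
proof (rule dlr_from_cylinders[OF prob_space_field_law sets_field_law \<Lambda>])
  fix A and J :: "(int ^ 'd) set"
  assume J: "finite J" and A: "\<And>i. i \<in> J \<Longrightarrow> A i \<in> sets (spin_space L)"
  let ?E = "cylinder UNIV J A"
  let ?f = "\<lambda>x. partition_function \<Lambda> x * indicator ?E x"
  let ?g = "\<lambda>x. gibbs_sum \<Lambda> (indicator ?E) x"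
  define \<Delta> where "\<Delta> = J \<union> (\<Union>j\<in>\<Lambda>. insert j (nbrs j))"
  have \<Delta>: "finite \<Delta>" using J \<Lambda> by (auto simp: \<Delta>_def)
  have E[measurable]: "?E \<in> sets configs"
    using J A by (intro cylinder_sets) auto
  have ind: "(indicator ?E :: _ \<Rightarrow> ennreal) \<in> borel_measurable configs"
    by measurable
  note [measurable] = measurable_partition_function_configs[OF \<Lambda>]
  have f: "?f \<in> borel_measurable configs" and g: "?g \<in> borel_measurable configs"
    using measurable_dlr_integral[OF \<Lambda> ind] by measurable
  have boltz: "boltzmann \<epsilon> \<Lambda> x s = boltzmann \<epsilon> \<Lambda> x' s" if "\<forall>i\<in>\<Delta>. x i = x' i" for x x' s
  proof -
    have "hamiltonian \<epsilon> \<Lambda> (paste \<Lambda> s x) = hamiltonian \<epsilon> \<Lambda> (paste \<Lambda> s x')"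
      using that by (intro hamiltonian_cong) (auto simp: \<Delta>_def paste_apply)
    then show ?thesis by (simp add: boltzmann_eq)
  qed
  have det_E: "indicator ?E x = (indicator ?E x' :: ennreal)"
    if "x \<in> space configs" "x' \<in> space configs" "\<forall>i\<in>J. x i = x' i" for x x'
    using determined_on_cylinder[of J A] that unfolding determined_on_def by blast
  have det_f: "determined_on \<Delta> ?f"
    unfolding determined_on_def
  proof (intro ballI impI)
    fix x x' assume x: "x \<in> space configs" "x' \<in> space configs" and eq: "\<forall>i\<in>\<Delta>. x i = x' i"
    have "indicator ?E x = (indicator ?E x' :: ennreal)"
      using eq x by (intro det_E) (auto simp: \<Delta>_def)
    then show "?f x = ?f x'"
      unfolding partition_function_def using ext[of "boltzmann \<epsilon> \<Lambda> x" "boltzmann \<epsilon> \<Lambda> x'", OF boltz[OF eq]] by (simp only:)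
  qed
  have det_g: "determined_on \<Delta> ?g"
    unfolding determined_on_def
  proof (intro ballI impI nn_integral_cong)
    fix x x' s assume x: "x \<in> space configs" "x' \<in> space configs" and eq: "\<forall>i\<in>\<Delta>. x i = x' i"
      and s: "s \<in> space (spins \<Lambda>)"
    have "indicator ?E (paste \<Lambda> s x) = (indicator ?E (paste \<Lambda> s x') :: ennreal)"
      using eq by (intro det_E paste_in_configs s x) (auto simp: \<Delta>_def paste_apply)
    then show "boltzmann \<epsilon> \<Lambda> x s * indicator ?E (paste \<Lambda> s x) = boltzmann \<epsilon> \<Lambda> x' s * indicator ?E (paste \<Lambda> s x')"
      by (simp only: boltz[OF eq])
  qed
  obtain b where b: "0 \<le> b" "\<And>x. x \<in> space configs \<Longrightarrow> partition_function \<Lambda> x \<le> ennreal b"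
    using partition_function_bounded[OF \<Lambda>] by blast
  have b_f: "?f x \<le> ennreal b" if "x \<in> space configs" for x
    using b(2)[OF that] by (auto simp: indicator_def)
  have b_g: "?g x \<le> ennreal b" if "x \<in> space configs" for x
  proof -
    have "?g x \<le> partition_function \<Lambda> x"
      unfolding partition_function_def by (intro nn_integral_mono) (auto simp: indicator_def)
    with b(2)[OF that] show ?thesis by simp
  qed
  \<comment> \<open>Seen from \<open>\<Delta>\<close>, \<open>n\<close> steps of the dynamics in this volume look like steps in infinite volume.\<close>
  define V where "V n = (\<Union>i\<in>\<Delta>. ball1 i n)" for n
  have V: "finite (V n)" for n using \<Delta> by (simp add: V_def)
  have \<Delta>V: "\<Delta> \<subseteq> V n" for n
    unfolding V_def using self_in_ball1 by blast
  have bal: "balanced (finite_volume (V n)) i" if "i \<in> V n" for i n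
    using that by (intro dlr_singleton_imp_balanced dlr_finite_volume V) auto
  have ball: "ball1 i n \<subseteq> V n" if "i \<in> \<Delta>" for i n
    using that by (auto simp: V_def)
  let ?e = "\<lambda>n. b * real (card \<Delta>) * rate ^ n"
  have eq: "(\<integral>\<^sup>+x. ?f x \<partial>finite_volume (V n)) = (\<integral>\<^sup>+x. ?g x \<partial>finite_volume (V n))" for n
  proof -
    have "\<Lambda> \<subseteq> V n" using \<Delta>V[of n] by (auto simp: \<Delta>_def)
    then show ?thesis using dlr_finite_volume[OF V] ind unfolding dlr_def by blast
  qed
  note close_f = balanced_close_to_field_law[OF prob_space_finite_volume[OF V] sets_finite_volume V bal ball \<Delta> f det_f b_f b(1)]
  note close_g = balanced_close_to_field_law[OF prob_space_finite_volume[OF V] sets_finite_volume V bal ball \<Delta> g det_g b_g b(1)]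
  have two: "ennreal (?e n) + ennreal (?e n) = ennreal (2 * b * real (card \<Delta>) * rate ^ n)" for n
    using b(1) rate_bounds by (simp add: ennreal_plus[symmetric] del: ennreal_plus)
  have "(\<integral>\<^sup>+x. ?f x \<partial>field_law) \<le> (\<integral>\<^sup>+x. ?g x \<partial>field_law) + ennreal (2 * b * real (card \<Delta>) * rate ^ n)" for n
  proof -
    have "(\<integral>\<^sup>+x. ?f x \<partial>field_law) \<le> (\<integral>\<^sup>+x. ?g x \<partial>finite_volume (V n)) + ennreal (?e n)"
      using close_f(2) unfolding eq .
    also have "\<dots> \<le> ((\<integral>\<^sup>+x. ?g x \<partial>field_law) + ennreal (?e n)) + ennreal (?e n)"
      using close_g(1) by (rule add_right_mono)
    finally show ?thesis by (simp only: add.assoc two)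
  qed
  then have 1: "(\<integral>\<^sup>+x. ?f x \<partial>field_law) \<le> (\<integral>\<^sup>+x. ?g x \<partial>field_law)"
    by (rule ennreal_le_of_geometric_error) (use rate_bounds in auto)
  have "(\<integral>\<^sup>+x. ?g x \<partial>field_law) \<le> (\<integral>\<^sup>+x. ?f x \<partial>field_law) + ennreal (2 * b * real (card \<Delta>) * rate ^ n)" for n
  proof -
    have "(\<integral>\<^sup>+x. ?g x \<partial>field_law) \<le> (\<integral>\<^sup>+x. ?f x \<partial>finite_volume (V n)) + ennreal (?e n)"
      using close_g(2) unfolding eq .
    also have "\<dots> \<le> ((\<integral>\<^sup>+x. ?f x \<partial>field_law) + ennreal (?e n)) + ennreal (?e n)"
      using close_f(1) by (rule add_right_mono)
    finally show ?thesis by (simp only: add.assoc two)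
  qed
  then have 2: "(\<integral>\<^sup>+x. ?g x \<partial>field_law) \<le> (\<integral>\<^sup>+x. ?f x \<partial>field_law)"
    by (rule ennreal_le_of_geometric_error) (use rate_bounds in auto)
  from 1 2 show "(\<integral>\<^sup>+x. ?f x \<partial>field_law) = (\<integral>\<^sup>+x. ?g x \<partial>field_law)"
    by (rule antisym)
qed

text \<open>
  Uniqueness comes from the DLR equations of single sites, existence from those of all finite sets.
\<close>

lemma gibbs_measure_iff: "gibbs_measure \<epsilon> L \<mu> \<longleftrightarrow> \<mu> = field_law"
proof
  assume g: "gibbs_measure \<epsilon> L \<mu>"
  then have mu: "prob_space \<mu>" "sets \<mu> = sets configs"
    by (auto simp: gibbs_measure_def field_distribution_def)
  have "dlr \<mu> {i}" for i
    using g by (intro conditional_law_imp_dlr mu) (auto simp: gibbs_measure_def)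
  then show "\<mu> = field_law"
    by (intro balanced_unique mu dlr_singleton_imp_balanced)
next
  assume "\<mu> = field_law"
  then show "gibbs_measure \<epsilon> L \<mu>"
    using dlr_imp_conditional_law[OF prob_space_field_law sets_field_law _ dlr_field_law] prob_space_field_law
    by (simp add: gibbs_measure_def field_distribution_def)
qed

lemma truncated_gaussian_field_eq: "truncated_gaussian_field \<epsilon> L = field_law"
  unfolding truncated_gaussian_field_def gibbs_measure_iff by simp

end

section \<open>Finite range of dependence\<close>

lemma indep_vars_coordinates:
  assumes N: "prob_space N"
  shows "prob_space.indep_vars (Pi\<^sub>M UNIV (\<lambda>_::'i. N)) (\<lambda>_. N) (\<lambda>i y. y i) UNIV"
proof -
  interpret prob_space "Pi\<^sub>M UNIV (\<lambda>_::'i. N)" by (intro prob_space_PiM N)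
  have "distr (Pi\<^sub>M UNIV (\<lambda>_::'i. N)) N (\<lambda>y. y i) = N" for i
    using distr_PiM_component[of UNIV "\<lambda>_. N" i] N by simp
  then show ?thesis
    by (subst indep_vars_iff_distr_eq_PiM') (simp_all add: restrict_def)
qed

text \<open>
  The field on \<open>A\<close> is a function of the noise within distance \<open>r\<close> of \<open>A\<close>, and for sets at
  distance greater than \<open>2 * r\<close> these regions are disjoint.
\<close>

lemma dependent_within_block_factor:
  fixes G :: "(int ^ 'd \<Rightarrow> 'y) \<Rightarrow> int ^ 'd \<Rightarrow> 's"
  assumes N: "prob_space N" and G[measurable]: "G \<in> config_space N \<rightarrow>\<^sub>M config_space S"
    and local: "\<And>i y y'. y \<in> space (config_space N) \<Longrightarrow> y' \<in> space (config_space N) \<Longrightarrow>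
      (\<And>j. j \<in> ball1 i r \<Longrightarrow> y j = y' j) \<Longrightarrow> G y i = G y' i"
    and l: "2 * r \<le> l"
  shows "dependent_within S l (distr (config_space N) (config_space S) G)"
  unfolding dependent_within_def
proof (intro conjI allI impI)
  let ?P = "config_space N :: (int ^ 'd \<Rightarrow> 'y) measure" and ?X = "config_space S :: (int ^ 'd \<Rightarrow> 's) measure"
  let ?mu = "distr ?P ?X G"
  interpret P: prob_space ?P by (intro prob_space_PiM N)
  interpret mu: prob_space ?mu by (rule P.prob_space_distr) simp
  show "field_distribution S ?mu"
    unfolding field_distribution_def using mu.prob_space_axioms by simp
  fix A A' :: "(int ^ 'd) set"
  assume far: "\<forall>i\<in>A. \<forall>j\<in>A'. norm1 (i - j) > int l"
  \<comment> \<open>The noise outside the neighbourhood is filled in by a fixed configuration.\<close>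
  obtain y0 where y0: "y0 \<in> space ?P" using P.not_empty by blast
  define nh where "nh B = (\<Union>i\<in>B. ball1 i r)" for B :: "(int ^ 'd) set"
  define H where "H B z = restrict (G (merge (nh B) (- nh B) (z, y0))) B" for B z
  have disj: "nh A \<inter> nh A' = {}"
  proof (rule ccontr)
    assume "nh A \<inter> nh A' \<noteq> {}"
    then obtain i j k where k: "i \<in> A" "j \<in> A'" "norm1 (i - k) \<le> int r" "norm1 (j - k) \<le> int r"
      by (auto simp: nh_def ball1_def)
    have "norm1 (i - j) \<le> norm1 (i - k) + norm1 (k - j)" by (rule norm1_triangle)
    also have "\<dots> \<le> int l" using k l by (simp add: norm1_minus_commute[of k j])
    finally show False using far k by force
  qed
  have restr[measurable]: "(\<lambda>x. restrict x B) \<in> ?X \<rightarrow>\<^sub>M Pi\<^sub>M B (\<lambda>_. S)" for B :: "(int ^ 'd) set"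
    by (rule measurable_restrict_subset) simp
  have H[measurable]: "H B \<in> Pi\<^sub>M (nh B) (\<lambda>_. N) \<rightarrow>\<^sub>M Pi\<^sub>M B (\<lambda>_. S)" for B
  proof -
    have "(\<lambda>z. merge (nh B) (- nh B) (z, y0)) \<in> Pi\<^sub>M (nh B) (\<lambda>_. N) \<rightarrow>\<^sub>M ?P"
    proof (rule measurable_PiM_single')
      show "(\<lambda>z. merge (nh B) (- nh B) (z, y0) i) \<in> Pi\<^sub>M (nh B) (\<lambda>_. N) \<rightarrow>\<^sub>M N" for i
        using y0 by (cases "i \<in> nh B") (simp_all add: merge_def space_PiM PiE_iff)
    qed (use y0 in \<open>auto simp: space_PiM PiE_iff merge_def\<close>)
    then show ?thesis
      unfolding H_def by measurable
  qed
  have H_eq: "H B (restrict y (nh B)) = restrict (G y) B" if y: "y \<in> space ?P" for B y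
  proof
    fix i
    have m: "merge (nh B) (- nh B) (restrict y (nh B), y0) \<in> space ?P"
      using y y0 by (auto simp: space_PiM PiE_iff merge_def)
    have "G (merge (nh B) (- nh B) (restrict y (nh B), y0)) i = G y i" if "i \<in> B"
      using that by (intro local[OF m y]) (auto simp: merge_def nh_def)
    then show "H B (restrict y (nh B)) i = restrict (G y) B i"
      by (simp add: H_def)
  qed
  have restr_N[measurable]: "(\<lambda>y. restrict y B) \<in> ?P \<rightarrow>\<^sub>M Pi\<^sub>M B (\<lambda>_. N)" for B :: "(int ^ 'd) set"
    by (rule measurable_restrict_subset) simp
  have "P.indep_var (Pi\<^sub>M (nh A) (\<lambda>_. N)) (\<lambda>y. restrict (\<lambda>i. y i) (nh A))
      (Pi\<^sub>M (nh A') (\<lambda>_. N)) (\<lambda>y. restrict (\<lambda>i. y i) (nh A'))"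
    using disj by (intro P.indep_var_restrict[OF indep_vars_coordinates[OF N]]) auto
  then have "P.indep_var (Pi\<^sub>M A (\<lambda>_. S)) (H A \<circ> (\<lambda>y. restrict (\<lambda>i. y i) (nh A)))
      (Pi\<^sub>M A' (\<lambda>_. S)) (H A' \<circ> (\<lambda>y. restrict (\<lambda>i. y i) (nh A')))"
    by (rule P.indep_var_compose) measurable
  then have indep: "distr ?P (Pi\<^sub>M A (\<lambda>_. S)) (\<lambda>y. H A (restrict y (nh A))) \<Otimes>\<^sub>M
        distr ?P (Pi\<^sub>M A' (\<lambda>_. S)) (\<lambda>y. H A' (restrict y (nh A'))) =
      distr ?P (Pi\<^sub>M A (\<lambda>_. S) \<Otimes>\<^sub>M Pi\<^sub>M A' (\<lambda>_. S))
        (\<lambda>y. (H A (restrict y (nh A)), H A' (restrict y (nh A'))))"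
    unfolding P.indep_var_distribution_eq by (simp add: comp_def)
  have marg: "distr ?mu (Pi\<^sub>M B (\<lambda>_. S)) (\<lambda>x. restrict x B) =
      distr ?P (Pi\<^sub>M B (\<lambda>_. S)) (\<lambda>y. H B (restrict y (nh B)))" for B
  proof -
    have "distr ?mu (Pi\<^sub>M B (\<lambda>_. S)) (\<lambda>x. restrict x B) = distr ?P (Pi\<^sub>M B (\<lambda>_. S)) (\<lambda>y. restrict (G y) B)"
      by (subst distr_distr) (simp_all add: comp_def)
    also have "\<dots> = distr ?P (Pi\<^sub>M B (\<lambda>_. S)) (\<lambda>y. H B (restrict y (nh B)))"
      by (intro distr_cong refl) (simp only: H_eq)
    finally show ?thesis .
  qed
  have joint: "distr ?mu (Pi\<^sub>M A (\<lambda>_. S) \<Otimes>\<^sub>M Pi\<^sub>M A' (\<lambda>_. S)) (\<lambda>x. (restrict x A, restrict x A')) =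
      distr ?P (Pi\<^sub>M A (\<lambda>_. S) \<Otimes>\<^sub>M Pi\<^sub>M A' (\<lambda>_. S)) (\<lambda>y. (H A (restrict y (nh A)), H A' (restrict y (nh A'))))"
  proof -
    have "distr ?mu (Pi\<^sub>M A (\<lambda>_. S) \<Otimes>\<^sub>M Pi\<^sub>M A' (\<lambda>_. S)) (\<lambda>x. (restrict x A, restrict x A')) =
        distr ?P (Pi\<^sub>M A (\<lambda>_. S) \<Otimes>\<^sub>M Pi\<^sub>M A' (\<lambda>_. S)) (\<lambda>y. (restrict (G y) A, restrict (G y) A'))"
      by (subst distr_distr) (simp_all add: comp_def)
    also have "\<dots> = distr ?P (Pi\<^sub>M A (\<lambda>_. S) \<Otimes>\<^sub>M Pi\<^sub>M A' (\<lambda>_. S))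
        (\<lambda>y. (H A (restrict y (nh A)), H A' (restrict y (nh A'))))"
      by (intro distr_cong refl) (simp only: H_eq)
    finally show ?thesis .
  qed
  show "mu.indep_var (Pi\<^sub>M A (\<lambda>_. S)) (\<lambda>x. restrict x A) (Pi\<^sub>M A' (\<lambda>_. S)) (\<lambda>x. restrict x A')"
    unfolding mu.indep_var_distribution_eq marg joint by (simp add: indep restr)
qed

section \<open>Total variation\<close>

lemma measure_close_of_emeasure:
  assumes "prob_space M" "prob_space N" "0 \<le> c"
    and "emeasure M A \<le> emeasure N B + ennreal c" "emeasure N B \<le> emeasure M A + ennreal c"
  shows "\<bar>measure M A - measure N B\<bar> \<le> c"
proof -
  interpret M: prob_space M by fact
  interpret N: prob_space N by fact
  have "measure M A \<le> measure N B + c" "measure N B \<le> measure M A + c"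
    using assms(3-5) unfolding M.emeasure_eq_measure N.emeasure_eq_measure
    by (simp_all add: ennreal_plus[symmetric] del: ennreal_plus)
  then show ?thesis by linarith
qed

lemma tv_distance_leI:
  assumes "\<And>A. A \<in> sets M \<Longrightarrow> \<bar>measure M A - measure N A\<bar> \<le> c"
  shows "tv_distance M N \<le> c"
  unfolding tv_distance_def using sets.top assms by (intro cSUP_least) auto

lemma tv_distance_le_1:
  assumes "prob_space M" "prob_space N" shows "tv_distance M N \<le> 1"
proof (rule tv_distance_leI)
  fix A
  show "\<bar>measure M A - measure N A\<bar> \<le> 1"
    using prob_space.prob_le_1[OF assms(1), of A] prob_space.prob_le_1[OF assms(2), of A]
      measure_nonneg[of M A] measure_nonneg[of N A] by linarith
qed

lemma prob_space_marginal:
  assumes "prob_space \<mu>" and [measurable_cong]: "sets \<mu> = sets (config_space S)"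
  shows "prob_space (marginal S \<Lambda> \<mu>)"
  unfolding marginal_def
proof (rule prob_space.prob_space_distr[OF assms(1)])
  show "(\<lambda>x. restrict x \<Lambda>) \<in> \<mu> \<rightarrow>\<^sub>M Pi\<^sub>M \<Lambda> (\<lambda>_. S)"
    unfolding measurable_cong_sets[OF assms(2) refl] by (rule measurable_restrict_subset) simp
qed

lemma marginal_singleton:
  fixes \<mu> :: "(int ^ 'd \<Rightarrow> 's) measure"
  assumes sets: "sets \<mu> = sets (config_space S)"
  shows "marginal S {i} \<mu> = distr (distr \<mu> S (\<lambda>x. x i)) (Pi\<^sub>M {i} (\<lambda>_. S)) (\<lambda>s. \<lambda>k\<in>{i}. s)"
proof -
  have 1: "(\<lambda>x. x i) \<in> \<mu> \<rightarrow>\<^sub>M S"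
    unfolding measurable_cong_sets[OF sets refl] by simp
  have 2: "(\<lambda>s. \<lambda>k\<in>{i}. s) \<in> S \<rightarrow>\<^sub>M Pi\<^sub>M {i} (\<lambda>_. S)"
    by (rule measurable_restrict) simp
  have "(\<lambda>x. restrict x {i}) = (\<lambda>s. \<lambda>k\<in>{i}. s) \<circ> (\<lambda>x :: int ^ 'd \<Rightarrow> 's. x i)"
    by (auto simp: fun_eq_iff)
  then show ?thesis
    unfolding marginal_def using distr_distr[OF 2 1] by simp
qed

text \<open>
  The space of configurations on no site has one point, and on a single site the marginals are equal.
  On two or more sites the right-hand side is at least one.
\<close>

lemma tv_distance_equal_site_marginals:
  fixes \<mu> \<nu> :: "(int ^ 'd \<Rightarrow> 's) measure"
  assumes \<mu>: "prob_space \<mu>" "sets \<mu> = sets (config_space S)"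
    and \<nu>: "prob_space \<nu>" "sets \<nu> = sets (config_space S)"
    and eq: "\<And>i. distr \<mu> S (\<lambda>x. x i) = distr \<nu> S (\<lambda>x. x i)" and \<Lambda>: "finite \<Lambda>"
  shows "tv_distance (marginal S \<Lambda> \<mu>) (marginal S \<Lambda> \<nu>) \<le> real (card \<Lambda>) * (1 / 2)"
proof -
  interpret M: prob_space "marginal S \<Lambda> \<mu>" using \<mu> by (rule prob_space_marginal)
  interpret N: prob_space "marginal S \<Lambda> \<nu>" using \<nu> by (rule prob_space_marginal)
  consider "\<Lambda> = {}" | i where "\<Lambda> = {i}" | "2 \<le> card \<Lambda>"
  proof (cases "card \<Lambda> \<le> 1")
    case True
    then have "card \<Lambda> = 0 \<or> card \<Lambda> = 1" by linarith
    then show ?thesis using \<Lambda> that by (auto simp: card_1_singleton_iff)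
  qed (use that in force)
  then show ?thesis
  proof cases
    case 1
    have "\<bar>measure (marginal S \<Lambda> \<mu>) A - measure (marginal S \<Lambda> \<nu>) A\<bar> \<le> 0"
      if A: "A \<in> sets (marginal S \<Lambda> \<mu>)" for A
    proof -
      have space: "space (marginal S \<Lambda> \<mu>) = {\<lambda>_. undefined}" "space (marginal S \<Lambda> \<nu>) = {\<lambda>_. undefined}"
        by (simp_all add: marginal_def space_PiM 1)
      have "A = {} \<or> A = {\<lambda>_. undefined}"
        using sets.sets_into_space[OF A] unfolding space by blast
      then show ?thesis
        using M.prob_space N.prob_space unfolding space by auto
    qed
    then show ?thesis
      by (intro order.trans[OF tv_distance_leI[where c=0]]) auto
  next
    case (2 i)
    have "marginal S \<Lambda> \<mu> = marginal S \<Lambda> \<nu>"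
      unfolding 2 marginal_singleton[OF \<mu>(2)] marginal_singleton[OF \<nu>(2)] eq ..
    then show ?thesis
      by (intro order.trans[OF tv_distance_leI[where c=0]]) auto
  next
    case 3
    have "tv_distance (marginal S \<Lambda> \<mu>) (marginal S \<Lambda> \<nu>) \<le> 1"
      by (intro tv_distance_le_1 M.prob_space_axioms N.prob_space_axioms)
    also have "1 \<le> real (card \<Lambda>) * (1 / 2)" using 3 by simp
    finally show ?thesis .
  qed
qed

section \<open>The factor map and the approximations\<close>

lemma measurable_translate [measurable]:
  "translate v \<in> config_space S \<rightarrow>\<^sub>M config_space S"
  unfolding translate_def[abs_def] by (rule measurable_PiM_single') (auto simp: space_PiM PiE_iff)

lemma distr_translate_iid:
  fixes v :: "int ^ 'd"
  assumes "prob_space N"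
  shows "distr (config_space N) (config_space N) (translate v) = config_space N"
  using distr_PiM_reindex[of UNIV "\<lambda>_. N" "\<lambda>i. i + v" UNIV] assms
  by (simp add: translate_def[abs_def] inj_on_def restrict_def)

context small_coupling
begin

lemma field_law_translation_invariant: "distr field_law configs (translate v) = field_law"
proof -
  have "distr field_law configs (translate v) = distr noise configs (translate v \<circ> factor)"
    unfolding field_law_def by (rule distr_distr) measurable
  also have "translate v \<circ> factor = factor \<circ> translate v"
    by (simp add: fun_eq_iff factor_translate)
  also have "distr noise configs (factor \<circ> translate v) = distr (distr noise noise (translate v)) configs factor"
    by (rule distr_distr[symmetric]) measurable
  also have "distr noise noise (translate v) = noise"
    by (rule distr_translate_iid[OF prob_space_noise_law[OF L_pos]])
  finally show ?thesis
    by (simp add: field_law_def)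
qed

lemma factor_of_iid_field_law: "factor_of_iid (spin_space L) field_law (noise_law L) factor"
  unfolding factor_of_iid_def
proof (intro conjI)
  show "field_distribution (spin_space L) field_law"
    using prob_space_field_law by (simp add: field_distribution_def)
  show "translation_invariant (spin_space L) field_law"
    by (simp add: translation_invariant_def field_law_translation_invariant)
  show "equivariant (noise_law L) factor"
    by (simp add: equivariant_def factor_translate)
  show "field_law = distr noise configs factor"
    by (rule field_law_def)
qed (simp_all add: prob_space_noise_law[OF L_pos])

text \<open>
  Whether the origin is uncertain after \<open>n\<close> steps and, if not, the value of the factor there are both
  functions of the noise within distance \<open>n\<close>.
\<close>

lemma coding_radius_le:
  assumes "0 \<notin> uncertain n y" shows "coding_radius (noise_law L) factor y \<le> ereal (real n)"
  unfolding coding_radius_def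
proof (rule Inf_lower, intro image_eqI[OF refl] CollectI conjI ballI impI)
  fix y' assume "\<forall>j. real_of_int (norm1 j) \<le> real n \<longrightarrow> y' j = y j"
  then have eq: "y j = y' j" if "j \<in> ball1 0 n" for j
    using that norm1_minus_commute[of 0 j] by (simp add: ball1_def)
  have "factor y 0 = run UNIV n y (\<lambda>_. 0) 0"
    using assms zero_in_configs by (intro run_eq_factor[symmetric]) auto
  also have "\<dots> = run UNIV n y' (\<lambda>_. 0) 0"
    by (intro run_cong eq refl)
  also have "\<dots> = factor y' 0"
    using assms zero_in_configs uncertain_cong[OF eq] by (intro run_eq_factor) auto
  finally show "factor y 0 = factor y' 0" .
qed simp

lemma finitary_factor: "finitary (noise_law L) factor"
  unfolding finitary_def
proof (rule AE_I')
  let ?N = "{y \<in> space noise. \<forall>n. 0 \<in> uncertain n y}"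
  have "emeasure noise ?N \<le> 0 + ennreal (1 * rate ^ n)" for n
  proof -
    have "emeasure noise ?N \<le> emeasure noise {y \<in> space noise. 0 \<in> uncertain n y}"
      by (intro emeasure_mono) auto
    with emeasure_uncertain[of 0 n] show ?thesis by simp
  qed
  then have "emeasure noise ?N \<le> 0"
    by (rule ennreal_le_of_geometric_error) (use rate_bounds in auto)
  moreover have "?N \<in> sets noise"
    by measurable
  ultimately show "?N \<in> null_sets noise"
    by (simp add: null_sets_def)
  have "coding_radius (noise_law L) factor y < \<infinity>" if "0 \<notin> uncertain n y" for n y
    using coding_radius_le[OF that] by (rule order.strict_trans1) simp
  then show "{y \<in> space noise. \<not> coding_radius (noise_law L) factor y < \<infinity>} \<subseteq> ?N"
    by blast
qed

text \<open>
  A coding radius of at least \<open>n\<close> forces the origin to be uncertain after \<open>n - 1\<close> steps; the lost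
  step accounts for the constant \<open>1 / rate\<close>.
\<close>

lemma exponential_tails_factor: "exponential_tails (noise_law L) factor"
  unfolding exponential_tails_def
proof (rule exI[of _ "- ln rate"], intro conjI, goal_cases)
  case 1
  show ?case using rate_bounds by simp
next
  case 2
  have "outer_measure_of noise {y \<in> space noise. coding_radius (noise_law L) factor y \<ge> ereal (real n)}
      \<le> ennreal (1 / rate * exp (- (- ln rate) * real n))" for n
  proof -
    have "{y \<in> space noise. coding_radius (noise_law L) factor y \<ge> ereal (real n)} \<subseteq>
        {y \<in> space noise. 0 \<in> uncertain (n - 1) y}"
    proof (cases n)
      case (Suc m)
      have "0 \<in> uncertain m y" if "coding_radius (noise_law L) factor y \<ge> ereal (real n)" for y
      proof (rule ccontr)
        assume "0 \<notin> uncertain m y"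
        from order.trans[OF that coding_radius_le[OF this]] show False
          by (simp add: Suc)
      qed
      then show ?thesis by (auto simp: Suc)
    qed simp
    then have "outer_measure_of noise {y \<in> space noise. coding_radius (noise_law L) factor y \<ge> ereal (real n)}
        \<le> outer_measure_of noise {y \<in> space noise. 0 \<in> uncertain (n - 1) y}"
      by (rule outer_measure_of_mono)
    also have "\<dots> = emeasure noise {y \<in> space noise. 0 \<in> uncertain (n - 1) y}"
      by (rule outer_measure_of_eq) measurable
    also have "\<dots> \<le> ennreal (rate ^ (n - 1))"
      by (rule emeasure_uncertain)
    also have "\<dots> \<le> ennreal (1 / rate * exp (- (- ln rate) * real n))"
    proof (rule ennreal_leI)
      have "exp (- (- ln rate) * real n) = rate ^ n"
        using rate_bounds by (simp add: exp_of_nat2_mult)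
      then show "rate ^ (n - 1) \<le> 1 / rate * exp (- (- ln rate) * real n)"
        using rate_bounds by (cases n) (simp_all add: field_simps)
    qed
    finally show ?thesis .
  qed
  then show ?case
    using rate_bounds by (intro exI[of _ "1 / rate"]) auto
qed

lemma tv_distance_coupling:
  assumes G[measurable]: "G \<in> noise \<rightarrow>\<^sub>M configs"
    and eq: "\<And>i y. i \<notin> uncertain n y \<Longrightarrow> G y i = factor y i" and \<Lambda>: "finite \<Lambda>"
  shows "tv_distance (marginal (spin_space L) \<Lambda> field_law) (marginal (spin_space L) \<Lambda> (distr noise configs G))
    \<le> real (card \<Lambda>) * rate ^ n"
proof (rule tv_distance_leI)
  fix A assume "A \<in> sets (marginal (spin_space L) \<Lambda> field_law)"
  then have A[measurable]: "A \<in> sets (spins \<Lambda>)" by (simp add: marginal_def)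
  let ?f = "\<lambda>x. indicator A (restrict x \<Lambda>) :: ennreal"
  interpret Y: prob_space noise by (rule prob_space_noise)
  have f: "?f \<in> borel_measurable configs" by measurable
  have det: "determined_on \<Lambda> ?f"
    unfolding determined_on_def
  proof (intro ballI impI)
    fix x x' :: "int ^ 'd \<Rightarrow> real" assume "\<forall>i\<in>\<Lambda>. x i = x' i"
    then have "restrict x \<Lambda> = restrict x' \<Lambda>" by (auto simp: fun_eq_iff)
    then show "?f x = ?f x'" by simp
  qed
  have b: "?f x \<le> ennreal 1" for x by (simp add: indicator_def)
  have marg: "emeasure (marginal (spin_space L) \<Lambda> (distr noise configs G')) A = (\<integral>\<^sup>+y. ?f (G' y) \<partial>noise)"
    if [measurable]: "G' \<in> noise \<rightarrow>\<^sub>M configs" for G'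
  proof -
    have "emeasure (marginal (spin_space L) \<Lambda> (distr noise configs G')) A =
        (\<integral>\<^sup>+s. indicator A s \<partial>marginal (spin_space L) \<Lambda> (distr noise configs G'))"
      by (rule nn_integral_indicator[symmetric]) (simp add: marginal_def)
    also have "\<dots> = (\<integral>\<^sup>+x. ?f x \<partial>distr noise configs G')"
      unfolding marginal_def by (rule nn_integral_distr) simp_all
    also have "\<dots> = (\<integral>\<^sup>+y. ?f (G' y) \<partial>noise)"
      using f by (intro nn_integral_distr) simp_all
    finally show ?thesis .
  qed
  have prob: "prob_space (marginal (spin_space L) \<Lambda> (distr noise configs G'))"
    if [measurable]: "G' \<in> noise \<rightarrow>\<^sub>M configs" for G'
    by (rule prob_space_marginal[OF Y.prob_space_distr]) simp_all
  have "emeasure (marginal (spin_space L) \<Lambda> (distr noise configs factor)) A \<le>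
      emeasure (marginal (spin_space L) \<Lambda> (distr noise configs G)) A + ennreal (1 * real (card \<Lambda>) * rate ^ n)"
    unfolding marg[OF G] marg[OF measurable_factor]
    by (rule coupling_bound[OF measurable_factor G _ \<Lambda> f det b]) (simp_all add: eq)
  moreover have "emeasure (marginal (spin_space L) \<Lambda> (distr noise configs G)) A \<le>
      emeasure (marginal (spin_space L) \<Lambda> (distr noise configs factor)) A + ennreal (1 * real (card \<Lambda>) * rate ^ n)"
    unfolding marg[OF G] marg[OF measurable_factor]
    by (rule coupling_bound[OF G measurable_factor _ \<Lambda> f det b]) (simp_all add: eq)
  ultimately show "\<bar>measure (marginal (spin_space L) \<Lambda> field_law) A -
      measure (marginal (spin_space L) \<Lambda> (distr noise configs G)) A\<bar> \<le> real (card \<Lambda>) * rate ^ n"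
    unfolding field_law_def using rate_bounds
    by (intro measure_close_of_emeasure prob G measurable_factor) simp_all
qed

abbreviation approximates :: "nat \<Rightarrow> real \<Rightarrow> (int ^ 'd \<Rightarrow> real) measure \<Rightarrow> bool" where
  "approximates l b \<nu> \<equiv> dependent_within (spin_space L) l \<nu> \<and> (\<forall>\<Lambda>. finite \<Lambda> \<longrightarrow>
    tv_distance (marginal (spin_space L) \<Lambda> field_law) (marginal (spin_space L) \<Lambda> \<nu>) \<le> real (card \<Lambda>) * b)"

text \<open>
  Cutting off the past after \<open>n\<close> steps makes the value at a site a function of the noise within
  distance \<open>n\<close>, and changes it only if the site is uncertain.
\<close>

lemma block_approximation:
  assumes "2 * n \<le> l"
  shows "\<exists>\<nu>. approximates l (rate ^ n) \<nu>"
proof (intro exI conjI allI impI)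
  let ?G = "\<lambda>y. run UNIV n y (\<lambda>_. 0)"
  have G: "?G \<in> noise \<rightarrow>\<^sub>M configs"
    using zero_in_configs by measurable
  show "dependent_within (spin_space L) l (distr noise configs ?G)"
    using assms
    by (intro dependent_within_block_factor[where r=n] prob_space_noise_law[OF L_pos] G run_cong) auto
  show "tv_distance (marginal (spin_space L) \<Lambda> field_law) (marginal (spin_space L) \<Lambda> (distr noise configs ?G))
      \<le> real (card \<Lambda>) * rate ^ n" if "finite \<Lambda>" for \<Lambda>
    using that zero_in_configs by (intro tv_distance_coupling G run_eq_factor) auto
qed

text \<open>
  The sites are made independent while keeping the one-site marginal of \<open>field_law\<close>, which is the
  same at all sites by translation invariance. As a block factor of range zero of itself, the product
  measure is \<open>l\<close>-dependent for every \<open>l\<close>.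
\<close>

lemma independent_approximation:
  "\<exists>\<nu>. approximates l (1 / 2) \<nu>"
proof -
  let ?m = "distr field_law (spin_space L) (\<lambda>x. x 0)"
  let ?M = "config_space ?m :: (int ^ 'd \<Rightarrow> real) measure"
  interpret F: prob_space field_law by (rule prob_space_field_law)
  interpret m: prob_space ?m by (rule F.prob_space_distr) simp
  have sets: "sets ?M = sets configs"
    by (intro sets_PiM_cong) simp_all
  have id: "distr ?M configs (\<lambda>y. y) = ?M"
    by (rule distr_id2) (rule sets[symmetric])
  have "dependent_within (spin_space L) l (distr ?M configs (\<lambda>y. y))"
  proof (rule dependent_within_block_factor[OF m.prob_space_axioms, where r=0])
    show "(\<lambda>y. y) \<in> ?M \<rightarrow>\<^sub>M configs"
      unfolding measurable_cong_sets[OF sets refl] by simp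
  qed simp_all
  then have dep: "dependent_within (spin_space L) l ?M"
    by (simp only: id)
  have site: "distr field_law (spin_space L) (\<lambda>x. x i) = ?m" for i
  proof -
    have "?m = distr (distr field_law configs (translate i)) (spin_space L) (\<lambda>x. x 0)"
      by (simp only: field_law_translation_invariant)
    also have "\<dots> = distr field_law (spin_space L) (\<lambda>x. x i)"
      by (subst distr_distr) (simp_all add: comp_def translate_def)
    finally show ?thesis by simp
  qed
  have site': "distr ?M (spin_space L) (\<lambda>x. x i) = ?m" for i
  proof -
    have "distr ?M (spin_space L) (\<lambda>x. x i) = distr ?M ?m (\<lambda>x. x i)"
      by (rule distr_cong) simp_all
    also have "\<dots> = ?m"
      by (rule distr_PiM_component) (simp_all add: m.prob_space_axioms)
    finally show ?thesis .
  qed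
  have "tv_distance (marginal (spin_space L) \<Lambda> field_law) (marginal (spin_space L) \<Lambda> ?M)
      \<le> real (card \<Lambda>) * (1 / 2)" if "finite \<Lambda>" for \<Lambda>
    by (rule tv_distance_equal_site_marginals[OF prob_space_field_law sets_field_law
          prob_space_PiM[OF m.prob_space_axioms] sets _ that])
      (rule trans[OF site site'[symmetric]])
  with dep show ?thesis
    by blast
qed

text \<open>
  For \<open>l \<ge> 2\<close> there are \<open>l div 2 \<ge> l / 3\<close> steps, which explains \<open>- ln rate / 3\<close>; for
  \<open>l \<le> 1\<close> the exponential is at least \<open>1 / 2\<close> because the constant is at most \<open>ln 2\<close>.
\<close>

lemma finitely_dependent_approximation:
  "\<exists>c>0. \<forall>l::nat. \<exists>\<nu>. approximates l (exp (- c * real l)) \<nu>"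
proof -
  let ?c = "min (ln 2) (- ln rate / 3)"
  have pos: "?c > 0" using rate_bounds by simp
  have weaken: "\<exists>\<nu>. approximates l (exp (- ?c * real l)) \<nu>"
    if ex: "\<exists>\<nu>. approximates l b \<nu>"
    and b: "b \<le> exp (- ?c * real l)" for b and l :: nat
  proof -
    obtain \<nu> where \<nu>: "dependent_within (spin_space L) l \<nu>"
      and tv: "\<And>\<Lambda>. finite \<Lambda> \<Longrightarrow>
        tv_distance (marginal (spin_space L) \<Lambda> field_law) (marginal (spin_space L) \<Lambda> \<nu>) \<le> real (card \<Lambda>) * b"
      using ex by blast
    have "tv_distance (marginal (spin_space L) \<Lambda> field_law) (marginal (spin_space L) \<Lambda> \<nu>)
        \<le> real (card \<Lambda>) * exp (- ?c * real l)" if "finite \<Lambda>" for \<Lambda>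
      using tv[OF that] mult_left_mono[OF b, of "real (card \<Lambda>)"] by linarith
    with \<nu> show ?thesis
      by blast
  qed
  have main: "\<exists>\<nu>. approximates l (exp (- ?c * real l)) \<nu>" for l :: nat
  proof (cases "l \<le> 1")
    case True
    have "?c * real l \<le> ln 2 * 1"
      using True rate_bounds by (intro mult_mono) auto
    then have "exp (- ln 2) \<le> exp (- ?c * real l)"
      by simp
    then have "1 / 2 \<le> exp (- ?c * real l)"
      by (simp add: exp_minus)
    then show ?thesis
      by (rule weaken[OF independent_approximation])
  next
    case False
    have "l \<le> 3 * (l div 2)"
      using False by presburger
    then have "real l \<le> real (3 * (l div 2))"
      by (simp only: of_nat_le_iff)
    then have "real l / 3 \<le> real (l div 2)"
      by simp
    have "?c * real l \<le> - ln rate / 3 * real l"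
      by (intro mult_right_mono) auto
    also have "\<dots> = real l / 3 * (- ln rate)"
      by simp
    also have "\<dots> \<le> real (l div 2) * (- ln rate)"
      using \<open>real l / 3 \<le> real (l div 2)\<close> rate_bounds by (intro mult_right_mono) auto
    finally have "real (l div 2) * ln rate \<le> - ?c * real l"
      by linarith
    then have "exp (real (l div 2) * ln rate) \<le> exp (- ?c * real l)"
      by (simp only: exp_le_cancel_iff)
    moreover have "exp (real (l div 2) * ln rate) = rate ^ (l div 2)"
      using rate_bounds by (simp add: exp_of_nat_mult)
    ultimately show ?thesis
      by (intro weaken[OF block_approximation[of "l div 2"]]) simp_all
  qed
  show ?thesis
    by (rule exI[of _ ?c], rule conjI, rule pos, rule allI, rule main)
qed

end

text \<open>
  The threshold makes \<open>\<bar>\<epsilon>\<bar> * N * L\<^sup>2\<close> at most \<open>1 / (4 * (N + 1))\<close>, where \<open>N\<close> is the number of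
  neighbours of a site. This number serves as \<open>K\<close>, and then the Gibbs measure is unique and equal
  to \<open>field_law\<close>.
\<close>

theorem theorem1p4:
  fixes L :: real
  assumes "L > 0"
  shows "\<exists>\<epsilon>\<^sub>0>0. \<epsilon>\<^sub>0 < 1 / (2 * L\<^sup>2) \<and>
    (\<forall>\<epsilon>::real. \<bar>\<epsilon>\<bar> \<le> \<epsilon>\<^sub>0 \<longrightarrow>
      (let S = spin_space L;
           \<mu> = (truncated_gaussian_field \<epsilon> L :: (int ^ 'd \<Rightarrow> real) measure)
       in ffiid_exponential_tails S \<mu> \<and>
          (\<exists>c>0. \<forall>l::nat. \<exists>\<nu>. dependent_within S l \<nu> \<and>
             (\<forall>\<Lambda>. finite \<Lambda> \<longrightarrow>
                tv_distance (marginal S \<Lambda> \<mu>) (marginal S \<Lambda> \<nu>)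
                  \<le> real (card \<Lambda>) * exp (- c * real l)))))"
proof -
  define N where "N = real (card (nbrs (0 :: int ^ 'd)))"
  define \<epsilon>\<^sub>0 where "\<epsilon>\<^sub>0 = 1 / (4 * (N + 1)\<^sup>2 * L\<^sup>2)"
  define K where "K = 1 / (4 * (N + 1))"
  have N: "0 \<le> N" by (simp add: N_def)
  have L2: "0 < L\<^sup>2" using assms by simp
  have pos: "0 < \<epsilon>\<^sub>0"
    unfolding \<epsilon>\<^sub>0_def using N L2 by (intro divide_pos_pos mult_pos_pos) auto
  have less: "\<epsilon>\<^sub>0 < 1 / (2 * L\<^sup>2)"
  proof -
    have "1 \<le> (N + 1)\<^sup>2" using N by (intro one_le_power) simp
    then have "2 < 4 * (N + 1)\<^sup>2" by simp
    then have "2 * L\<^sup>2 < 4 * (N + 1)\<^sup>2 * L\<^sup>2" using L2 by (intro mult_strict_right_mono)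
    then show ?thesis unfolding \<epsilon>\<^sub>0_def using assms N
      by (intro divide_strict_left_mono mult_pos_pos zero_less_power) auto
  qed
  have "small_coupling TYPE('d) L \<epsilon> K" if \<epsilon>: "\<bar>\<epsilon>\<bar> \<le> \<epsilon>\<^sub>0" for \<epsilon>
  proof
    show "L > 0" by fact
    show "4 * K * (real (card (nbrs (0 :: int ^ 'd))) + 1) \<le> 1"
      using N by (simp add: K_def N_def[symmetric])
    have "1 \<le> real CARD('d)"
      by (simp add: Suc_leI)
    then have "1 \<le> 2 * real CARD('d)"
      by linarith
    then have "\<bar>\<epsilon>\<bar> / (2 * real CARD('d)) \<le> \<epsilon>\<^sub>0 / 1"
      by (rule frac_le[OF less_imp_le[OF pos] \<epsilon> zero_less_one])
    then have "\<bar>\<epsilon>\<bar> / (2 * real CARD('d)) * N * L\<^sup>2 \<le> \<epsilon>\<^sub>0 * (N + 1) * L\<^sup>2"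
      using N L2 pos by (intro mult_right_mono mult_mono) auto
    also have "\<dots> = K"
      using N assms by (simp add: \<epsilon>\<^sub>0_def K_def power2_eq_square)
    finally show "\<bar>\<epsilon>\<bar> / (2 * real CARD('d)) * real (card (nbrs (0 :: int ^ 'd))) * L\<^sup>2 \<le> K"
      by (simp only: N_def)
  qed
  note coupling = this
  show ?thesis
  proof (intro exI[of _ \<epsilon>\<^sub>0] conjI pos less allI impI)
    fix \<epsilon> :: real assume "\<bar>\<epsilon>\<bar> \<le> \<epsilon>\<^sub>0"
    then interpret small_coupling L \<epsilon> K "TYPE('d)" by (rule coupling)
    show "let S = spin_space L; \<mu> = (truncated_gaussian_field \<epsilon> L :: (int ^ 'd \<Rightarrow> real) measure)
       in ffiid_exponential_tails S \<mu> \<and>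
          (\<exists>c>0. \<forall>l::nat. \<exists>\<nu>. dependent_within S l \<nu> \<and>
             (\<forall>\<Lambda>. finite \<Lambda> \<longrightarrow>
                tv_distance (marginal S \<Lambda> \<mu>) (marginal S \<Lambda> \<nu>)
                  \<le> real (card \<Lambda>) * exp (- c * real l)))"
      unfolding Let_def truncated_gaussian_field_eq
    proof
      show "ffiid_exponential_tails (spin_space L) field_law"
        unfolding ffiid_exponential_tails_def
        using factor_of_iid_field_law finitary_factor exponential_tails_factor by blast
    qed (rule finitely_dependent_approximation)
  qed
qed

end
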